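(* Let $M$ be a connected manifold of dimension at least $2$, and let $F(x,\xi)=\sqrt{g(\xi,\xi)}+\omega(\xi)$ and $\bar F(x,\xi)=\sqrt{\bar g(\xi,\xi)}+\bar\omega(\xi)$ be two Randers metrics on $M$, where $g,\bar g$ are Riemannian metrics and $\omega,\bar\omega$ are $1$-forms on $M$. Suppose that $F$ and $\bar F$ are pointwise projectively related and that the form $\omega$ is not closed. Then there exists a positive constant $c\in\mathbb{R}$ such that $g=c^2\cdot\bar g$ on $M$ and such that for every point $x\in M$ we have, at $x$, $d\omega=c\cdot d\bar\omega$ or $d\omega=-c\cdot d\bar\omega$.
   Context: All objects considered (metrics, forms) are assumed to be at least $C^2$-smooth. A Randers metric on a manifold $M$ is a Finsler metric of the form $F(x,\xi)=\sqrt{g(x)_{ij}\xi^i\xi^j}+\omega(x)_i\xi^i=\sqrt{g(\xi,\xi)}+\omega(\xi)$, where $g$ is a Riemannian metric and $\omega$ is a $1$-form on $M$; that $F$ is a Finsler metric is equivalent to the $g$-norm of $\omega$ being less than one at every point. A forward (respectively backward) geodesic of a Finsler metric $F$ is a regular curve $x:I\to M$ ($I$ an interval) such that for any sufficiently close $a,b\in I$, $a\le b$, the restriction of $x$ to $[a,b]$ is an extremal of the functional $L^+_F(c)=\int_a^b F(c(t),\dot c(t))\,dt$ (respectively $L^-_F(c)=\int_a^b F(c(t),-\dot c(t))\,dt$) in the set of all smooth curves $c:[a,b]\to M$ connecting $x(a)$ and $x(b)$. No preferred parameter is assumed: orientation-preserving reparameterizations of forward (backward) geodesics are again forward (backward)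 geodesics. The reverse curve $t\mapsto x(-t)$ of a forward geodesic is a backward geodesic, and vice versa. Two Finsler metrics $F$ and $\bar F$ on one manifold $M$ are pointwise projectively related if they have the same geodesics as point sets, i.e. the same geodesics when orientation is disregarded (so each forward geodesic of one metric is, after an orientation-preserving reparameterization, a forward or a backward geodesic of the other). *)

theory Defs
  imports "HOL-Analysis.Analysis"
begin

section \<open>Maps of class \<open>C\<^sup>k\<close>\<close>

text \<open>Derivatives are taken within \<open>S\<close>, so that one-sided derivatives are used at the boundary
  points of an interval or of a strip. In finite dimension, continuity of all directional
  derivatives \<open>\<lambda>x. D x h\<close> is continuity of \<open>D\<close> in operator norm.\<close>

fun Ck_on :: "nat \<Rightarrow> ('b::euclidean_space \<Rightarrow> 'c::euclidean_space) \<Rightarrow> 'b set \<Rightarrow> bool" where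
  "Ck_on 0 f S \<longleftrightarrow> continuous_on S f"
| "Ck_on (Suc k) f S \<longleftrightarrow>
     (\<exists>D. (\<forall>x\<in>S. (f has_derivative D x) (at x within S)) \<and> (\<forall>h. Ck_on k (\<lambda>x. D x h) S))"


section \<open>Manifolds\<close>

text \<open>A chart is a pair of its domain and its coordinate map; the values of the coordinate map
  outside the domain are irrelevant.\<close>

type_synonym ('a, 'e) chart = "'a set \<times> ('a \<Rightarrow> 'e)"

definition chart_inv :: "('a, 'e) chart \<Rightarrow> 'e \<Rightarrow> 'a" where
  "chart_inv \<phi> = inv_into (fst \<phi>) (snd \<phi>)"

definition chart_image :: "('a, 'e) chart \<Rightarrow> 'e set" where
  "chart_image \<phi> = snd \<phi> ` fst \<phi>"

definition is_chart :: "('a::topological_space, 'e::euclidean_space) chart \<Rightarrow> bool" where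
  "is_chart \<phi> \<longleftrightarrow> open (fst \<phi>) \<and> open (chart_image \<phi>) \<and>
     homeomorphism (fst \<phi>) (chart_image \<phi>) (snd \<phi>) (chart_inv \<phi>)"

definition smooth_atlas ::
    "('a::{t2_space,second_countable_topology}, 'e::euclidean_space) chart set \<Rightarrow> bool" where
  "smooth_atlas A \<longleftrightarrow> (\<forall>\<phi>\<in>A. is_chart \<phi>) \<and>
     (\<forall>\<phi>\<in>A. \<forall>\<psi>\<in>A. \<forall>k. Ck_on k (snd \<psi> \<circ> chart_inv \<phi>) (snd \<phi> ` (fst \<phi> \<inter> fst \<psi>)))"

text \<open>The manifold given by an atlas \<open>A\<close> is the open subspace \<open>points A\<close> of \<open>'a\<close>. Its dimension
  is \<open>DIM('e)\<close>.\<close>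

definition points :: "('a, 'e) chart set \<Rightarrow> 'a set" where
  "points A = \<Union> (fst ` A)"

definition charts_at :: "('a, 'e) chart set \<Rightarrow> 'a \<Rightarrow> ('a, 'e) chart set" where
  "charts_at A p = {\<phi> \<in> A. p \<in> fst \<phi>}"

definition Ck_map :: "('a::topological_space, 'e::euclidean_space) chart set \<Rightarrow> nat \<Rightarrow>
    'b::euclidean_space set \<Rightarrow> ('b \<Rightarrow> 'a) \<Rightarrow> bool" where
  "Ck_map A k S f \<longleftrightarrow> f ` S \<subseteq> points A \<and> continuous_on S f \<and>
     (\<forall>\<phi>\<in>A. Ck_on k (snd \<phi> \<circ> f) (S \<inter> f -` fst \<phi>))"


section \<open>Tangent vectors\<close>

text \<open>A tangent vector at \<open>p\<close> is the family of its components in all charts at \<open>p\<close>, related by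
  the Jacobians of the coordinate changes. The vector space operations are pointwise; the value
  \<open>0\<close> at the remaining charts makes the representation unique.\<close>

type_synonym ('a, 'e) tvector = "('a, 'e) chart \<Rightarrow> 'e"

definition transition_deriv ::
    "'a \<Rightarrow> ('a, 'e::euclidean_space) chart \<Rightarrow> ('a, 'e) chart \<Rightarrow> 'e \<Rightarrow> 'e" where
  "transition_deriv p \<phi> \<psi> = frechet_derivative (snd \<psi> \<circ> chart_inv \<phi>) (at (snd \<phi> p))"

definition tangent_space ::
    "('a, 'e::euclidean_space) chart set \<Rightarrow> 'a \<Rightarrow> ('a, 'e) tvector set" where
  "tangent_space A p =
     {v. (\<forall>\<phi>\<in>charts_at A p. \<forall>\<psi>\<in>charts_at A p. v \<psi> = transition_deriv p \<phi> \<psi> (v \<phi>)) \<and>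
         (\<forall>\<phi>. \<phi> \<notin> charts_at A p \<longrightarrow> v \<phi> = 0)}"

text \<open>The tangent vector at \<open>p\<close> with component \<open>h\<close> in the chart \<open>\<phi>\<close>.\<close>

definition coord_vector ::
    "('a, 'e::euclidean_space) chart set \<Rightarrow> ('a, 'e) chart \<Rightarrow> 'a \<Rightarrow> 'e \<Rightarrow> ('a, 'e) tvector" where
  "coord_vector A \<phi> p h = (\<lambda>\<psi>. if \<psi> \<in> charts_at A p then transition_deriv p \<phi> \<psi> h else 0)"

definition velocity :: "('a, 'e::euclidean_space) chart set \<Rightarrow> real set \<Rightarrow> (real \<Rightarrow> 'a) \<Rightarrow> real
    \<Rightarrow> ('a, 'e) tvector" where
  "velocity A I c t =
     (\<lambda>\<phi>. if \<phi> \<in> charts_at A (c t) then vector_derivative (snd \<phi> \<circ> c) (at t within I) else 0)"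


section \<open>Riemannian metrics, 1-forms, Finsler and Randers metrics\<close>

text \<open>Functions on the tangent bundle, 1-forms (as functions on the tangent bundle) and
  bilinear forms; their values are only relevant at tangent vectors. The prefix \<open>loc\<close> marks the
  expression of such an object in a chart.\<close>

type_synonym ('a, 'e) tfun = "'a \<Rightarrow> ('a, 'e) tvector \<Rightarrow> real"
type_synonym ('a, 'e) tform2 = "'a \<Rightarrow> ('a, 'e) tvector \<Rightarrow> ('a, 'e) tvector \<Rightarrow> real"

definition loc1 :: "('a, 'e::euclidean_space) chart set \<Rightarrow> ('a, 'e) chart \<Rightarrow> ('a, 'e) tfun
    \<Rightarrow> 'e \<Rightarrow> 'e \<Rightarrow> real" where
  "loc1 A \<phi> F u h = F (chart_inv \<phi> u) (coord_vector A \<phi> (chart_inv \<phi> u) h)"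

definition loc2 :: "('a, 'e::euclidean_space) chart set \<Rightarrow> ('a, 'e) chart \<Rightarrow> ('a, 'e) tform2
    \<Rightarrow> 'e \<Rightarrow> 'e \<Rightarrow> 'e \<Rightarrow> real" where
  "loc2 A \<phi> g u h k = g (chart_inv \<phi> u) (coord_vector A \<phi> (chart_inv \<phi> u) h)
                                         (coord_vector A \<phi> (chart_inv \<phi> u) k)"

definition riemannian_metric ::
    "('a, 'e::euclidean_space) chart set \<Rightarrow> ('a, 'e) tform2 \<Rightarrow> bool" where
  "riemannian_metric A g \<longleftrightarrow> (\<forall>\<phi>\<in>A.
     (\<forall>u\<in>chart_image \<phi>. bilinear (loc2 A \<phi> g u) \<and>
        (\<forall>h k. loc2 A \<phi> g u h k = loc2 A \<phi> g u k h) \<and>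
        (\<forall>h. h \<noteq> 0 \<longrightarrow> loc2 A \<phi> g u h h > 0)) \<and>
     (\<forall>h k. Ck_on 2 (\<lambda>u. loc2 A \<phi> g u h k) (chart_image \<phi>)))"

definition one_form ::
    "('a, 'e::euclidean_space) chart set \<Rightarrow> ('a, 'e) tfun \<Rightarrow> bool" where
  "one_form A \<omega> \<longleftrightarrow> (\<forall>\<phi>\<in>A.
     (\<forall>u\<in>chart_image \<phi>. linear (loc1 A \<phi> \<omega> u)) \<and>
     (\<forall>h. Ck_on 2 (\<lambda>u. loc1 A \<phi> \<omega> u h) (chart_image \<phi>)))"

text \<open>In a chart, \<open>d\<omega>(v,w) = \<partial>\<^sub>v(\<omega>(w)) - \<partial>\<^sub>w(\<omega>(v))\<close> for the constant extensions of the components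
  of \<open>v\<close> and \<open>w\<close>. The result does not depend on the chart.\<close>

definition ext_deriv ::
    "('a, 'e::euclidean_space) chart set \<Rightarrow> ('a, 'e) tfun \<Rightarrow> ('a, 'e) tform2" where
  "ext_deriv A \<omega> p v w =
     (let \<phi> = (SOME \<phi>. \<phi> \<in> charts_at A p); u = snd \<phi> p in
        frechet_derivative (\<lambda>u. loc1 A \<phi> \<omega> u (w \<phi>)) (at u) (v \<phi>)
      - frechet_derivative (\<lambda>u. loc1 A \<phi> \<omega> u (v \<phi>)) (at u) (w \<phi>))"

definition closed_form ::
    "('a, 'e::euclidean_space) chart set \<Rightarrow> ('a, 'e) tfun \<Rightarrow> bool" where
  "closed_form A \<omega> \<longleftrightarrow>
     (\<forall>p\<in>points A. \<forall>v\<in>tangent_space A p. \<forall>w\<in>tangent_space A p. ext_deriv A \<omega> p v w = 0)"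

text \<open>The last condition is positive definiteness of the fundamental tensor, that is, of the
  Hessian of \<open>F\<^sup>2/2\<close> in the fibre directions, at all nonzero tangent vectors.\<close>

definition finsler_metric ::
    "('a, 'e::euclidean_space) chart set \<Rightarrow> ('a, 'e) tfun \<Rightarrow> bool" where
  "finsler_metric A F \<longleftrightarrow> (\<forall>\<phi>\<in>A.
     continuous_on (chart_image \<phi> \<times> UNIV) (\<lambda>(u, h). loc1 A \<phi> F u h) \<and>
     Ck_on 2 (\<lambda>(u, h). loc1 A \<phi> F u h) (chart_image \<phi> \<times> (- {0})) \<and>
     (\<forall>u\<in>chart_image \<phi>.
        (\<forall>h. \<forall>r\<ge>0. loc1 A \<phi> F u (r *\<^sub>R h) = r * loc1 A \<phi> F u h) \<and>
        (\<forall>h. h \<noteq> 0 \<longrightarrow> loc1 A \<phi> F u h > 0) \<and>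
        (\<forall>h k. h \<noteq> 0 \<longrightarrow> k \<noteq> 0 \<longrightarrow>
           (deriv ^^ 2) (\<lambda>s. (loc1 A \<phi> F u (h + s *\<^sub>R k))\<^sup>2 / 2) 0 > 0)))"

definition randers :: "('a, 'e) tform2 \<Rightarrow> ('a, 'e) tfun \<Rightarrow> ('a, 'e) tfun" where
  "randers g \<omega> = (\<lambda>x \<xi>. sqrt (g x \<xi> \<xi>) + \<omega> x \<xi>)"


section \<open>Geodesics\<close>

definition length_functional :: "('a, 'e::euclidean_space) chart set \<Rightarrow> ('a, 'e) tfun
    \<Rightarrow> real \<Rightarrow> real \<Rightarrow> (real \<Rightarrow> 'a) \<Rightarrow> real" where
  "length_functional A F a b c = integral {a..b} (\<lambda>t. F (c t) (velocity A {a..b} c t))"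

text \<open>Extremals are the stationary points of the functional with respect to variations with
  fixed end points. Curves and variations are of class \<open>C\<^sup>2\<close>: geodesics of a metric that is only
  \<open>C\<^sup>2\<close> need not be \<open>C\<^sup>\<infinity>\<close>.\<close>

definition extremal :: "('a::topological_space, 'e::euclidean_space) chart set \<Rightarrow> ('a, 'e) tfun
    \<Rightarrow> real \<Rightarrow> real \<Rightarrow> (real \<Rightarrow> 'a) \<Rightarrow> bool" where
  "extremal A F a b c \<longleftrightarrow> (\<forall>\<epsilon>>0. \<forall>\<Gamma> :: real \<times> real \<Rightarrow> 'a.
     Ck_map A 2 ({-\<epsilon><..<\<epsilon>} \<times> {a..b}) \<Gamma> \<longrightarrow>
     (\<forall>t\<in>{a..b}. \<Gamma> (0, t) = c t) \<longrightarrow>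
     (\<forall>s\<in>{-\<epsilon><..<\<epsilon>}. \<Gamma> (s, a) = c a \<and> \<Gamma> (s, b) = c b) \<longrightarrow>
     ((\<lambda>s. length_functional A F a b (\<lambda>t. \<Gamma> (s, t))) has_real_derivative 0) (at 0))"

definition nontrivial_interval :: "real set \<Rightarrow> bool" where
  "nontrivial_interval I \<longleftrightarrow> is_interval I \<and> interior I \<noteq> {}"

definition regular_curve :: "('a::topological_space, 'e::euclidean_space) chart set \<Rightarrow> real set
    \<Rightarrow> (real \<Rightarrow> 'a) \<Rightarrow> bool" where
  "regular_curve A I c \<longleftrightarrow> Ck_map A 2 I c \<and> (\<forall>t\<in>I. velocity A I c t \<noteq> (\<lambda>\<phi>. 0))"

definition forward_geodesic :: "('a::topological_space, 'e::euclidean_space) chart set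
    \<Rightarrow> ('a, 'e) tfun \<Rightarrow> real set \<Rightarrow> (real \<Rightarrow> 'a) \<Rightarrow> bool" where
  "forward_geodesic A F I c \<longleftrightarrow> nontrivial_interval I \<and> regular_curve A I c \<and>
     (\<forall>t\<in>I. \<exists>\<delta>>0. \<forall>a\<in>I. \<forall>b\<in>I. \<bar>a - t\<bar> < \<delta> \<longrightarrow> \<bar>b - t\<bar> < \<delta> \<longrightarrow> a \<le> b \<longrightarrow> extremal A F a b c)"

text \<open>The functional defining backward geodesics integrates \<open>F(c, -c')\<close>.\<close>

definition backward_geodesic :: "('a::topological_space, 'e::euclidean_space) chart set
    \<Rightarrow> ('a, 'e) tfun \<Rightarrow> real set \<Rightarrow> (real \<Rightarrow> 'a) \<Rightarrow> bool" where
  "backward_geodesic A F = forward_geodesic A (\<lambda>x \<xi>. F x (\<lambda>\<phi>. - \<xi> \<phi>))"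

definition increasing_reparam :: "real set \<Rightarrow> real set \<Rightarrow> (real \<Rightarrow> real) \<Rightarrow> bool" where
  "increasing_reparam J I \<tau> \<longleftrightarrow> nontrivial_interval J \<and> \<tau> ` J = I \<and> Ck_on 2 \<tau> J \<and>
     (\<forall>s\<in>J. vector_derivative \<tau> (at s within J) > 0)"

definition geodesics_contained :: "('a::topological_space, 'e::euclidean_space) chart set
    \<Rightarrow> ('a, 'e) tfun \<Rightarrow> ('a, 'e) tfun \<Rightarrow> bool" where
  "geodesics_contained A F F' \<longleftrightarrow> (\<forall>I c. forward_geodesic A F I c \<longrightarrow>
     (\<exists>J \<tau>. increasing_reparam J I \<tau> \<and>
        (forward_geodesic A F' J (c \<circ> \<tau>) \<or> backward_geodesic A F' J (c \<circ> \<tau>))))"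

definition pointwise_projectively_related ::
    "('a::topological_space, 'e::euclidean_space) chart set \<Rightarrow> ('a, 'e) tfun \<Rightarrow> ('a, 'e) tfun
    \<Rightarrow> bool" where
  "pointwise_projectively_related A F F' \<longleftrightarrow>
     geodesics_contained A F F' \<and> geodesics_contained A F' F"

end

theory Submission
  imports Defs "HOL-Computational_Algebra.Fundamental_Theorem_Algebra"
begin

text \<open>
The Euler-Lagrange equation of a Randers metric \<open>sqrt (g(\<xi>,\<xi>)) + \<omega>(\<xi>)\<close> says that the covariant
acceleration of a geodesic with velocity \<open>\<xi>\<close> is \<open>|\<xi>| B \<xi>\<close> up to a multiple of \<open>\<xi>\<close>, where \<open>B\<close> is the
\<open>g\<close>-skew operator with \<open>g(B \<xi>, \<eta>) = d\<omega>(\<eta>, \<xi>)\<close>. For a backward geodesic the sign of \<open>B\<close> is reversed.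
There is a geodesic in every direction (\<open>geodesic_exists\<close>), and so a projective relation between two
Randers metrics is a relation between tangent vectors at each point: with \<open>D\<close> the difference of the two Levi-Civita
connections, \<open>D(\<xi>,\<xi>) + |\<xi>| B \<xi>\<close> and \<open>|\<xi>|' B' \<xi>\<close> agree modulo \<open>\<xi>\<close> up to a sign that may depend on
\<open>\<xi>\<close> (\<open>related_if_geodesics_contained\<close>).

The pointwise part is algebra. Comparing \<open>\<xi>\<close> with \<open>- \<xi>\<close> separates the even term \<open>D(\<xi>,\<xi>)\<close> from the odd
ones: where \<open>B\<close> is not zero, \<open>D(\<xi>,\<xi>)\<close> is parallel to \<open>\<xi>\<close> and \<open>|\<xi>| B \<xi> = \<plusminus> |\<xi>|' B' \<xi>\<close> modulo \<open>\<xi>\<close>.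
Squaring turns the second statement into \<open>g P\<^sup>2 = g' P'\<^sup>2\<close> with quadratic polynomials \<open>P\<close> and \<open>P'\<close>. A
complex root of the positive quadratic \<open>g\<close> on a line is simple, so it must be a root of \<open>g'\<close> as well,
since all other factors have even multiplicity. Hence \<open>g\<close> is a multiple \<open>c\<^sup>2 g'\<close>, and then \<open>B' = \<plusminus> c B\<close>,
which is the assertion on \<open>d\<omega>\<close> and \<open>d\<omega>'\<close> (\<open>inner_pair.proportional\<close>). The relation is symmetric, so
\<open>d\<omega>\<close> and \<open>d\<omega>'\<close> vanish at the same points. In all cases \<open>D(\<xi>,\<xi>)\<close> is parallel to \<open>\<xi>\<close>: the metrics \<open>g\<close>
and \<open>g'\<close> are projectively equivalent on the whole manifold.

It remains to see that \<open>c\<close> is one constant and that \<open>g = c\<^sup>2 g'\<close> also holds where \<open>d\<omega> = 0\<close>. Projectively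
equivalent metrics that are conformal have a constant ratio (\<open>conformal_factor_constant\<close>), which
settles a neighbourhood of a point where \<open>d\<omega>\<close> does not vanish. For the rest, \<open>g'\<close> multiplied by the
power \<open>2 / (n + 1)\<close> of \<open>det g / det g'\<close> is a Killing tensor of \<open>g\<close>, and so is its difference with a
constant multiple of \<open>g\<close>. A Killing tensor satisfies a linear differential equation along straight
lines of a chart, which forces it to vanish on a neighbourhood of any ball on which it vanishes
(\<open>killing_zero_step\<close>). The set where \<open>g = c\<^sup>2 g'\<close> holds locally is therefore open and closed.
\<close>

section \<open>Calculus of maps of class \<open>C\<^sup>k\<close>\<close>

lemma Ck_on_SucD:
  "Ck_on (Suc k) f S \<Longrightarrow> Ck_on k f S"
proof (induction k arbitrary: f)
  case 0
  then obtain D where D: "\<And>x. x \<in> S \<Longrightarrow> (f has_derivative D x) (at x within S)" by auto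
  then show ?case by (simp, intro has_derivative_continuous_on)
next
  case (Suc k)
  from Suc.prems obtain D where D: "\<forall>x\<in>S. (f has_derivative D x) (at x within S)"
    "\<forall>h. Ck_on (Suc k) (\<lambda>x. D x h) S" unfolding Ck_on.simps(2)[of "Suc k"] by blast
  then have "\<forall>h. Ck_on k (\<lambda>x. D x h) S" using Suc.IH by blast
  with D(1) show ?case unfolding Ck_on.simps(2) by blast
qed

lemma Ck_on_antimono: "Ck_on k f S \<Longrightarrow> j \<le> k \<Longrightarrow> Ck_on j f S"
proof (induction k)
  case (Suc k)
  then show ?case using Ck_on_SucD[of k f S] by (cases "j = Suc k") (simp_all del: Ck_on.simps)
qed simp

lemma Ck_on_continuous: "Ck_on k f S \<Longrightarrow> continuous_on S f"
  using Ck_on_antimono[of k f S 0] by simp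

lemma Ck_on_subset: "Ck_on k f S \<Longrightarrow> T \<subseteq> S \<Longrightarrow> Ck_on k f T"
proof (induction k arbitrary: f)
  case 0 then show ?case by (auto intro: continuous_on_subset)
next
  case (Suc k)
  then obtain D where D: "\<forall>x\<in>S. (f has_derivative D x) (at x within S)" "\<forall>h. Ck_on k (\<lambda>x. D x h) S"
    by auto
  have "\<forall>x\<in>T. (f has_derivative D x) (at x within T)"
    using D(1) Suc.prems(2) by (blast intro: has_derivative_subset)
  moreover have "\<forall>h. Ck_on k (\<lambda>x. D x h) T" using D(2) Suc.IH Suc.prems(2) by blast
  ultimately show ?case unfolding Ck_on.simps by blast
qed

lemma Ck_on_cong: "Ck_on k f S \<Longrightarrow> (\<And>x. x \<in> S \<Longrightarrow> f x = g x) \<Longrightarrow> Ck_on k g S"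
proof (cases k)
  case 0
  assume "Ck_on k f S" "\<And>x. x \<in> S \<Longrightarrow> f x = g x"
  then show ?thesis using 0 continuous_on_cong[of S S f g] by simp
next
  case (Suc j)
  assume "Ck_on k f S" and eq: "\<And>x. x \<in> S \<Longrightarrow> f x = g x"
  then obtain D where D: "\<forall>x\<in>S. (f has_derivative D x) (at x within S)" "\<forall>h. Ck_on j (\<lambda>x. D x h) S"
    using Suc by auto
  have "\<forall>x\<in>S. (g has_derivative D x) (at x within S)"
    using D(1) eq by (metis has_derivative_transform)
  then have "Ck_on (Suc j) g S" unfolding Ck_on.simps using D(2) by blast
  then show ?thesis by (simp add: Suc)
qed

lemma Ck_on_const: "Ck_on k (\<lambda>x. c) S"
proof (induction k arbitrary: c)
  case (Suc k)
  then show ?case unfolding Ck_on.simps by (intro exI[of _ "\<lambda>x h. 0"]) simp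
qed simp

lemma Ck_on_add:
  "Ck_on k f S \<Longrightarrow> Ck_on k g S \<Longrightarrow> Ck_on k (\<lambda>x. f x + g x) S"
proof (induction k arbitrary: f g)
  case 0 then show ?case by (auto intro: continuous_intros)
next
  case (Suc k)
  obtain D where D: "\<forall>x\<in>S. (f has_derivative D x) (at x within S)" "\<forall>h. Ck_on k (\<lambda>x. D x h) S"
    using Suc.prems(1) by auto
  obtain E where E: "\<forall>x\<in>S. (g has_derivative E x) (at x within S)" "\<forall>h. Ck_on k (\<lambda>x. E x h) S"
    using Suc.prems(2) by auto
  show ?case unfolding Ck_on.simps
    by (rule exI[of _ "\<lambda>x h. D x h + E x h"]) (simp add: D E Suc.IH has_derivative_add)
qed

lemma Ck_on_sum:
  "finite I \<Longrightarrow> (\<And>i. i \<in> I \<Longrightarrow> Ck_on k (f i) S) \<Longrightarrow> Ck_on k (\<lambda>x. \<Sum>i\<in>I. f i x) S"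
proof (induction rule: finite_induct)
  case (insert i I)
  then show ?case by (simp add: Ck_on_add)
qed (simp add: Ck_on_const)

lemma Ck_on_bounded_linear:
  assumes L: "bounded_linear L" 
  shows "Ck_on k f S \<Longrightarrow> Ck_on k (\<lambda>x. L (f x)) S"
proof (induction k arbitrary: f)
  case 0 then show ?case by (auto intro: bounded_linear.continuous_on[OF L])
next
  case (Suc k)
  obtain D where D: "\<forall>x\<in>S. (f has_derivative D x) (at x within S)" "\<forall>h. Ck_on k (\<lambda>x. D x h) S"
    using Suc.prems(1) by auto
  show ?case unfolding Ck_on.simps
    by (rule exI[of _ "\<lambda>x h. L (D x h)"]) (simp add: D Suc.IH bounded_linear.has_derivative[OF L])
qed

lemma Ck_on_ident: "Ck_on k (\<lambda>x. x) S"
proof (cases k)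
  case 0 then show ?thesis by simp
next
  case (Suc j)
  show ?thesis unfolding Suc Ck_on.simps by (intro exI[of _ "\<lambda>x h. h"]) (simp add: Ck_on_const)
qed

lemma Ck_on_scaleR:
  fixes f :: "'b::euclidean_space \<Rightarrow> real" and g :: "'b \<Rightarrow> 'c::euclidean_space"
  shows "Ck_on k f S \<Longrightarrow> Ck_on k g S \<Longrightarrow> Ck_on k (\<lambda>x. f x *\<^sub>R g x) S"
proof (induction k arbitrary: f g)
  case 0 then show ?case by (auto intro: continuous_intros)
next
  case (Suc k)
  obtain D where D: "\<forall>x\<in>S. (f has_derivative D x) (at x within S)" "\<forall>h. Ck_on k (\<lambda>x. D x h) S"
    using Suc.prems(1) by auto
  obtain E where E: "\<forall>x\<in>S. (g has_derivative E x) (at x within S)" "\<forall>h. Ck_on k (\<lambda>x. E x h) S"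
    using Suc.prems(2) by auto
  note fg = Suc.prems[THEN Ck_on_SucD]
  show ?case unfolding Ck_on.simps
    by (rule exI[of _ "\<lambda>x h. f x *\<^sub>R E x h + D x h *\<^sub>R g x"])
      (simp add: D E fg Suc.IH has_derivative_scaleR Ck_on_add)
qed

lemma Ck_on_mult:
  fixes f g :: "'b::euclidean_space \<Rightarrow> real"
  shows "Ck_on k f S \<Longrightarrow> Ck_on k g S \<Longrightarrow> Ck_on k (\<lambda>x. f x * g x) S"
  using Ck_on_scaleR[of k f S g] by simp

text \<open>The definition differentiates \<open>D x h\<close> further only for a fixed direction \<open>h\<close>. The derivative of a
  composition contains a direction that varies with the point, which is therefore expanded in the
  basis.\<close>

lemma Ck_on_compose:
  "Ck_on k f T \<Longrightarrow> Ck_on k g S \<Longrightarrow> g ` S \<subseteq> T \<Longrightarrow> Ck_on k (\<lambda>x. f (g x)) S"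
proof (induction k arbitrary: f)
  case 0 then show ?case by (auto intro: continuous_on_compose2)
next
  case (Suc k)
  obtain D where D: "\<forall>x\<in>T. (f has_derivative D x) (at x within T)" "\<forall>h. Ck_on k (\<lambda>x. D x h) T"
    using Suc.prems(1) by auto
  obtain E where E: "\<forall>x\<in>S. (g has_derivative E x) (at x within S)" "\<forall>h. Ck_on k (\<lambda>x. E x h) S"
    using Suc.prems(2) by auto
  have g: "Ck_on k g S" using Suc.prems(2) by (rule Ck_on_SucD)
  have 1: "((\<lambda>x. f (g x)) has_derivative (\<lambda>h. D (g x) (E x h))) (at x within S)" if "x \<in> S" for x
  proof -
    have "(f has_derivative D (g x)) (at (g x) within g ` S)"
      using D(1) that Suc.prems(3) by (auto intro: has_derivative_subset)
    then show ?thesis using E(1) that by (metis has_derivative_in_compose)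
  qed
  have exp: "D (g x) (E x h) = (\<Sum>b\<in>Basis. (E x h \<bullet> b) *\<^sub>R D (g x) b)" if "x \<in> S" for x h
  proof -
    have "g x \<in> T" using that Suc.prems(3) by auto
    then interpret bounded_linear "D (g x)" using D(1) by (auto dest: has_derivative_bounded_linear)
    have "D (g x) (E x h) = D (g x) (\<Sum>b\<in>Basis. (E x h \<bullet> b) *\<^sub>R b)"
      by (simp only: euclidean_representation)
    then show ?thesis by (simp only: sum scaleR)
  qed
  have Dg: "Ck_on k (\<lambda>x. D (g x) b) S" for b
    using Suc.IH[of "\<lambda>y. D y b"] D(2) g Suc.prems(3) by blast
  have "Ck_on k (\<lambda>x. \<Sum>b\<in>Basis. (E x h \<bullet> b) *\<^sub>R D (g x) b) S" for h
    by (intro Ck_on_sum Ck_on_scaleR Ck_on_bounded_linear[OF bounded_linear_inner_left] finite_Basis)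
      (simp_all add: E Dg)
  then have "Ck_on k (\<lambda>x. D (g x) (E x h)) S" for h
    by (rule Ck_on_cong) (simp add: exp)
  with 1 show ?case unfolding Ck_on.simps by (intro exI[of _ "\<lambda>x h. D (g x) (E x h)"]) blast
qed

lemma Ck_on_fst: "Ck_on k f S \<Longrightarrow> Ck_on k (\<lambda>x. fst (f x)) S"
  by (rule Ck_on_bounded_linear[OF bounded_linear_fst])

lemma Ck_on_snd: "Ck_on k f S \<Longrightarrow> Ck_on k (\<lambda>x. snd (f x)) S"
  by (rule Ck_on_bounded_linear[OF bounded_linear_snd])

lemma Ck_on_inner_left: "Ck_on k f S \<Longrightarrow> Ck_on k (\<lambda>x. f x \<bullet> c) S"
  by (rule Ck_on_bounded_linear[OF bounded_linear_inner_left])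

text \<open>On an open set derivatives are unique, so that the existentially quantified derivative of the
  definition can be replaced by a term.\<close>

lemma Ck_on_open_Suc_iff:
  assumes "open S"
  shows "Ck_on (Suc k) f S \<longleftrightarrow> (\<forall>x\<in>S. f differentiable at x) \<and>
           (\<forall>h. Ck_on k (\<lambda>x. frechet_derivative f (at x) h) S)" (is "_ \<longleftrightarrow> ?R")
proof
  assume "Ck_on (Suc k) f S"
  then obtain D where D: "\<forall>x\<in>S. (f has_derivative D x) (at x within S)" "\<forall>h. Ck_on k (\<lambda>x. D x h) S"
    by auto
  have *: "(f has_derivative D x) (at x)" if "x \<in> S" for x
    using D(1) that at_within_open[OF that assms] by metis
  have **: "f differentiable at x" "D x = frechet_derivative f (at x)" if "x \<in> S" for x
    using differentiableI[OF *[OF that]] frechet_derivative_at[OF *[OF that]] by auto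
  have "Ck_on k (\<lambda>x. frechet_derivative f (at x) h) S" for h
    using D(2)[rule_format, of h] by (rule Ck_on_cong) (simp add: **)
  with ** show ?R by blast
next
  assume R: ?R
  have "\<forall>x\<in>S. (f has_derivative frechet_derivative f (at x)) (at x within S)"
    using R has_derivative_at_withinI unfolding frechet_derivative_works by metis
  with R show "Ck_on (Suc k) f S" unfolding Ck_on.simps
    by (intro exI[of _ "\<lambda>x. frechet_derivative f (at x)"]) blast
qed

lemma Ck_on_real_field:
  fixes f f' :: "real \<Rightarrow> real"
  assumes "\<And>x. x \<in> T \<Longrightarrow> (f has_real_derivative f' x) (at x)" "Ck_on k f' T"
  shows "Ck_on (Suc k) f T"
  unfolding Ck_on.simps
proof (intro exI[of _ "\<lambda>x h. f' x * h"] conjI ballI allI)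
  show "(f has_derivative (\<lambda>h. f' x * h)) (at x within T)" if "x \<in> T" for x
    using assms(1)[OF that] by (simp add: has_field_derivative_def has_derivative_at_withinI)
  show "Ck_on k (\<lambda>x. f' x * h) T" for h by (rule Ck_on_mult[OF assms(2) Ck_on_const])
qed

lemma Ck_on_sqrt_pos: "Ck_on k sqrt {0<..}"
proof -
  have inv: "Ck_on k inverse ({0<..} :: real set)" for k
  proof (induction k)
    case 0 then show ?case by (auto intro!: continuous_intros)
  next
    case (Suc k)
    have "Ck_on k (\<lambda>x. - 1 * (inverse x * inverse x)) ({0<..} :: real set)"
      by (intro Ck_on_mult Ck_on_const Suc)
    then show ?case
      by (rule Ck_on_real_field[rotated])
        (auto intro!: derivative_eq_intros simp: field_simps)
  qed
  show ?thesis
  proof (induction k)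
    case 0 then show ?case by (auto intro!: continuous_intros)
  next
    case (Suc k)
    have "Ck_on k (\<lambda>x. inverse (sqrt x) * (1/2)) ({0<..} :: real set)"
      by (intro Ck_on_mult Ck_on_const Ck_on_compose[OF inv Suc]) auto
    then show ?case
      by (rule Ck_on_real_field[rotated]) (auto intro!: derivative_eq_intros simp: field_simps)
  qed
qed

lemma Ck_on_sqrt:
  fixes f :: "'b::euclidean_space \<Rightarrow> real"
  shows "Ck_on k f S \<Longrightarrow> (\<And>x. x \<in> S \<Longrightarrow> f x > 0) \<Longrightarrow> Ck_on k (\<lambda>x. sqrt (f x)) S"
  by (rule Ck_on_compose[OF Ck_on_sqrt_pos]) auto

lemma Ck_on_minus:
  fixes f :: "'b::euclidean_space \<Rightarrow> 'c::euclidean_space"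
  shows "Ck_on k f S \<Longrightarrow> Ck_on k (\<lambda>x. - f x) S"
  by (rule Ck_on_bounded_linear[OF bounded_linear_minus[OF bounded_linear_ident]])

text \<open>This provides the Lipschitz bounds that the Picard iteration for geodesics needs.\<close>

lemma Ck_on_1_lipschitz_on_compact:
  fixes f :: "'b::euclidean_space \<Rightarrow> 'c::euclidean_space"
  assumes f: "Ck_on 1 f S" and S: "open S" and K: "compact K" "convex K" "K \<subseteq> S"
  obtains L where "L-lipschitz_on K f"
proof -
  have d: "\<And>x. x \<in> S \<Longrightarrow> f differentiable at x"
    and c: "\<And>h. continuous_on S (\<lambda>x. frechet_derivative f (at x) h)"
    using f unfolding One_nat_def Ck_on_open_Suc_iff[OF S] Ck_on.simps(1) by blast+
  define M where "M x = (\<Sum>b\<in>Basis. norm (frechet_derivative f (at x) b))" for x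
  have "continuous_on K M" unfolding M_def
    using continuous_on_subset[OF c K(3)] by (intro continuous_intros) auto
  then have "bounded (M ` K)" using K(1) compact_continuous_image compact_imp_bounded by blast
  then obtain L where L: "L > 0" "\<forall>y\<in>M ` K. norm y \<le> L"
    unfolding bounded_pos by blast
  have "L-lipschitz_on K f"
  proof (rule bounded_derivative_imp_lipschitz)
    fix x assume x: "x \<in> K"
    then have D: "(f has_derivative frechet_derivative f (at x)) (at x)"
      using d K(3) frechet_derivative_works by blast
    then show "(f has_derivative frechet_derivative f (at x)) (at x within K)"
      by (rule has_derivative_at_withinI)
    interpret bounded_linear "frechet_derivative f (at x)" using D by (rule has_derivative_bounded_linear)
    show "onorm (frechet_derivative f (at x)) \<le> L"
    proof (rule onorm_bound)
      fix h :: 'b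
      have "norm (frechet_derivative f (at x) h) = norm (frechet_derivative f (at x) (\<Sum>b\<in>Basis. (h \<bullet> b) *\<^sub>R b))"
        by (simp only: euclidean_representation)
      also have "\<dots> = norm (\<Sum>b\<in>Basis. (h \<bullet> b) *\<^sub>R frechet_derivative f (at x) b)"
        by (simp only: sum scaleR)
      also have "\<dots> \<le> (\<Sum>b\<in>Basis. norm h * norm (frechet_derivative f (at x) b))"
        by (rule sum_norm_le) (auto intro!: mult_right_mono simp: Basis_le_norm)
      also have "\<dots> = M x * norm h" by (simp add: M_def sum_distrib_left mult.commute)
      also have "\<dots> \<le> L * norm h" using bspec[OF L(2) imageI[OF x]] by (intro mult_right_mono) (simp_all add: abs_le_iff)
      finally show "norm (frechet_derivative f (at x) h) \<le> L * norm h" .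
    qed (use L(1) in simp)
  qed (use K L(1) in simp_all)
  then show ?thesis by (rule that)
qed

section \<open>Metrics and forms in a chart\<close>

lemmas linear_simps = linear_add linear_cmul

lemma linear_real_expand:
  fixes f :: "'e::euclidean_space \<Rightarrow> real"
  assumes "linear f" shows "f h = (\<Sum>i\<in>Basis. (h \<bullet> i) * f i)"
proof -
  have "f h = f (\<Sum>i\<in>Basis. (h \<bullet> i) *\<^sub>R i)" by (simp only: euclidean_representation)
  also have "\<dots> = (\<Sum>i\<in>Basis. (h \<bullet> i) * f i)" by (simp add: linear_sum[OF assms] linear_cmul[OF assms])
  finally show ?thesis .
qed

definition form_deriv :: "('e::euclidean_space \<Rightarrow> 'e \<Rightarrow> real) \<Rightarrow> 'e \<Rightarrow> 'e \<Rightarrow> 'e \<Rightarrow> real" where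
  "form_deriv W u k h = frechet_derivative (\<lambda>v. W v h) (at u) k"

definition metric_deriv ::
    "('e::euclidean_space \<Rightarrow> 'e \<Rightarrow> 'e \<Rightarrow> real) \<Rightarrow> 'e \<Rightarrow> 'e \<Rightarrow> 'e \<Rightarrow> 'e \<Rightarrow> real" where
  "metric_deriv G u k h l = frechet_derivative (\<lambda>v. G v h l) (at u) k"

text \<open>The exterior derivative of a 1-form in a chart, in the sign convention of \<open>ext_deriv\<close>.\<close>

definition curl :: "('e::euclidean_space \<Rightarrow> 'e \<Rightarrow> real) \<Rightarrow> 'e \<Rightarrow> 'e \<Rightarrow> 'e \<Rightarrow> real" where
  "curl W u k h = form_deriv W u k h - form_deriv W u h k"

text \<open>The Christoffel symbols of the first kind, contracted twice with \<open>h\<close>.\<close>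

definition christoffel ::
    "('e::euclidean_space \<Rightarrow> 'e \<Rightarrow> 'e \<Rightarrow> real) \<Rightarrow> 'e \<Rightarrow> 'e \<Rightarrow> 'e \<Rightarrow> real" where
  "christoffel G u h l = metric_deriv G u h h l - metric_deriv G u l h h / 2"

locale local_form =
  fixes U :: "'e::euclidean_space set" and W :: "'e \<Rightarrow> 'e \<Rightarrow> real"
  assumes open_U: "open U"
    and linear_W: "u \<in> U \<Longrightarrow> linear (W u)"
    and Ck_W: "Ck_on 2 (\<lambda>u. W u h) U"
begin

lemma W_expand: "u \<in> U \<Longrightarrow> W u h = (\<Sum>i\<in>Basis. (h \<bullet> i) * W u i)"
  by (rule linear_real_expand[OF linear_W])

lemma W_differentiable: "u \<in> U \<Longrightarrow> (\<lambda>v. W v h) differentiable (at u)"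
  using Ck_W[of h] unfolding numeral_2_eq_2 Ck_on_open_Suc_iff[OF open_U] by blast

lemma W_has_derivative:
  "u \<in> U \<Longrightarrow> ((\<lambda>v. W v h) has_derivative (\<lambda>k. form_deriv W u k h)) (at u)"
  using W_differentiable unfolding form_deriv_def frechet_derivative_works by blast

lemma linear_form_deriv: "u \<in> U \<Longrightarrow> linear (\<lambda>k. form_deriv W u k h)"
  using has_derivative_linear[OF W_has_derivative] .

lemma form_deriv_expand:
  assumes u: "u \<in> U" shows "form_deriv W u k h = (\<Sum>i\<in>Basis. (h \<bullet> i) * form_deriv W u k i)"
proof -
  have "((\<lambda>v. \<Sum>i\<in>Basis. (h \<bullet> i) * W v i) has_derivative
      (\<lambda>k. \<Sum>i\<in>Basis. (h \<bullet> i) * form_deriv W u k i)) (at u)"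
    by (intro has_derivative_sum has_derivative_mult_right W_has_derivative u)
  then have "((\<lambda>v. W v h) has_derivative
      (\<lambda>k. \<Sum>i\<in>Basis. (h \<bullet> i) * form_deriv W u k i)) (at u)"
    by (rule has_derivative_transform_within_open[OF _ open_U u]) (simp add: W_expand[of _ h])
  from has_derivative_unique[OF W_has_derivative[OF u] this] show ?thesis by metis
qed

lemma linear_form_deriv_right:
  assumes "u \<in> U" shows "linear (form_deriv W u k)"
proof -
  have "form_deriv W u k = (\<lambda>h. \<Sum>i\<in>Basis. (h \<bullet> i) * form_deriv W u k i)"
    using form_deriv_expand[OF assms] by blast
  moreover have "linear (\<lambda>h. \<Sum>i\<in>Basis. (h \<bullet> i) * form_deriv W u k i)"
    by (intro linearI) (simp_all add: inner_add_left distrib_right sum.distrib sum_distrib_left mult.assoc)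
  ultimately show ?thesis by simp
qed

lemma form_deriv_expand2:
  assumes u: "u \<in> U"
  shows "form_deriv W u k h = (\<Sum>i\<in>Basis. (h \<bullet> i) * (\<Sum>j\<in>Basis. (k \<bullet> j) * form_deriv W u j i))"
proof -
  have "form_deriv W u k i = (\<Sum>j\<in>Basis. (k \<bullet> j) * form_deriv W u j i)" for i
    by (rule linear_real_expand[OF linear_form_deriv[OF u]])
  then show ?thesis using form_deriv_expand[OF u, of k h] by simp
qed

text \<open>Everything below differentiates along curves and variations, where the point and the vector
  vary together.\<close>

lemma W_chain:
  assumes u: "(u has_derivative u') (at z within S)" and h: "(h has_derivative h') (at z within S)"
    and S: "z \<in> S" "u ` S \<subseteq> U"
  shows "((\<lambda>z. W (u z) (h z)) has_derivative
      (\<lambda>k. form_deriv W (u z) (u' k) (h z) + W (u z) (h' k))) (at z within S)"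
proof -
  have uz: "u z \<in> U" using S by auto
  have d: "((\<lambda>z. W (u z) i) has_derivative (\<lambda>k. form_deriv W (u z) (u' k) i)) (at z within S)" for i
    using has_derivative_compose[OF u W_has_derivative[OF uz]] .
  have "((\<lambda>z. \<Sum>i\<in>Basis. (h z \<bullet> i) * W (u z) i) has_derivative
     (\<lambda>k. \<Sum>i\<in>Basis. (h z \<bullet> i) * form_deriv W (u z) (u' k) i + (h' k \<bullet> i) * W (u z) i)) (at z within S)"
    by (intro has_derivative_sum has_derivative_mult has_derivative_inner_left h d)
  moreover have "(\<Sum>i\<in>Basis. (h z \<bullet> i) * form_deriv W (u z) (u' k) i + (h' k \<bullet> i) * W (u z) i)
      = form_deriv W (u z) (u' k) (h z) + W (u z) (h' k)" for k
    using form_deriv_expand[OF uz, of "u' k" "h z"] W_expand[OF uz, of "h' k"]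
    by (simp add: sum.distrib)
  ultimately have "((\<lambda>z. \<Sum>i\<in>Basis. (h z \<bullet> i) * W (u z) i) has_derivative
     (\<lambda>k. form_deriv W (u z) (u' k) (h z) + W (u z) (h' k))) (at z within S)" by simp
  then show ?thesis
    by (rule has_derivative_transform[OF S(1), rotated]) (use S W_expand in auto)
qed

lemma W_Ck:
  fixes u h :: "'b::euclidean_space \<Rightarrow> 'e"
  assumes "Ck_on k u S" "Ck_on k h S" "u ` S \<subseteq> U" "k \<le> 2"
  shows "Ck_on k (\<lambda>z. W (u z) (h z)) S"
proof -
  have "Ck_on k (\<lambda>z. \<Sum>i\<in>Basis. (h z \<bullet> i) * W (u z) i) S"
    by (intro Ck_on_sum Ck_on_mult Ck_on_inner_left Ck_on_compose[OF Ck_on_antimono[OF Ck_W]] assms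
        finite_Basis)
  then show ?thesis by (rule Ck_on_cong) (use assms(3) W_expand in auto)
qed

lemma form_deriv_Ck:
  fixes u h :: "'b::euclidean_space \<Rightarrow> 'e"
  assumes "Ck_on k u S" "Ck_on k p S" "Ck_on k h S" "u ` S \<subseteq> U" "k \<le> 1"
  shows "Ck_on k (\<lambda>z. form_deriv W (u z) (p z) (h z)) S"
proof -
  have C1: "Ck_on 1 (\<lambda>v. form_deriv W v j i) U" for i j
    using Ck_W[of i] unfolding numeral_2_eq_2 Ck_on_open_Suc_iff[OF open_U] form_deriv_def One_nat_def
    by blast
  have "Ck_on k (\<lambda>z. \<Sum>i\<in>Basis. (h z \<bullet> i) * (\<Sum>j\<in>Basis. (p z \<bullet> j) * form_deriv W (u z) j i)) S"
    by (intro Ck_on_sum Ck_on_mult Ck_on_inner_left Ck_on_compose[OF Ck_on_antimono[OF C1]] assms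
        finite_Basis)
  then show ?thesis by (rule Ck_on_cong) (use assms(4) form_deriv_expand2 in auto)
qed

lemma curl_Ck:
  fixes u h :: "'b::euclidean_space \<Rightarrow> 'e"
  assumes "Ck_on k u S" "Ck_on k p S" "Ck_on k h S" "u ` S \<subseteq> U" "k \<le> 1"
  shows "Ck_on k (\<lambda>z. curl W (u z) (p z) (h z)) S"
proof -
  have "Ck_on k (\<lambda>z. form_deriv W (u z) (p z) (h z) + - form_deriv W (u z) (h z) (p z)) S"
    by (intro Ck_on_add Ck_on_minus form_deriv_Ck assms)
  then show ?thesis by (simp add: curl_def)
qed

lemma linear_curl_left: "u \<in> U \<Longrightarrow> linear (\<lambda>k. curl W u k h)"
  unfolding curl_def by (intro linear_compose_sub linear_form_deriv linear_form_deriv_right)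

lemma linear_curl_right: "u \<in> U \<Longrightarrow> linear (curl W u k)"
  unfolding curl_def by (intro linear_compose_sub linear_form_deriv linear_form_deriv_right)

end

lemma curl_same [simp]: "curl W u h h = 0"
  by (simp add: curl_def)

lemma local_form_uminus:
  assumes "local_form U W" shows "local_form U (\<lambda>u h. - W u h)"
proof -
  interpret local_form U W by fact
  show ?thesis
  proof (rule local_form.intro)
    show "linear (\<lambda>h. - W u h)" if "u \<in> U" for u
      by (rule linear_compose_neg[OF linear_W[OF that]])
  qed (intro open_U Ck_on_minus Ck_W)+
qed

lemma (in local_form) curl_uminus: "u \<in> U \<Longrightarrow> curl (\<lambda>u h. - W u h) u k h = - curl W u k h"
proof -
  assume u: "u \<in> U"
  have "form_deriv (\<lambda>u h. - W u h) u k h = - form_deriv W u k h" for k h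
    using frechet_derivative_at[OF has_derivative_minus[OF W_has_derivative[OF u]]]
    unfolding form_deriv_def[of "\<lambda>u h. - W u h"] by metis
  then show ?thesis by (simp add: curl_def)
qed

locale local_metric =
  fixes U :: "'e::euclidean_space set" and G :: "'e \<Rightarrow> 'e \<Rightarrow> 'e \<Rightarrow> real"
  assumes open_U: "open U"
    and bilinear_G: "u \<in> U \<Longrightarrow> bilinear (G u)"
    and G_sym: "u \<in> U \<Longrightarrow> G u h k = G u k h"
    and G_pos: "u \<in> U \<Longrightarrow> h \<noteq> 0 \<Longrightarrow> G u h h > 0"
    and Ck_G: "Ck_on 2 (\<lambda>u. G u h k) U"
begin

lemma form_of_metric: "local_form U (\<lambda>u h. G u h l)"
  using bilinear_G open_U Ck_G by (intro local_form.intro) (auto simp: bilinear_def)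

lemma metric_deriv_form: "metric_deriv G u k h l = form_deriv (\<lambda>u h. G u h l) u k h"
  by (simp add: metric_deriv_def form_deriv_def)

lemma G_expand: "u \<in> U \<Longrightarrow> G u h l = (\<Sum>j\<in>Basis. (l \<bullet> j) * G u h j)"
  using local_form.W_expand[OF form_of_metric, of u l h] G_sym by simp

lemma G_has_derivative:
  "u \<in> U \<Longrightarrow> ((\<lambda>v. G v h l) has_derivative (\<lambda>k. metric_deriv G u k h l)) (at u)"
  unfolding metric_deriv_form by (rule local_form.W_has_derivative[OF form_of_metric])

lemma metric_deriv_sym: 
  assumes u: "u \<in> U" shows "metric_deriv G u k h l = metric_deriv G u k l h"
proof -
  have "((\<lambda>v. G v l h) has_derivative (\<lambda>k. metric_deriv G u k h l)) (at u)"
    by (rule has_derivative_transform_within_open[OF G_has_derivative[OF u] open_U u]) (rule G_sym)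
  from has_derivative_unique[OF G_has_derivative[OF u] this]
  show ?thesis by metis
qed

lemma metric_deriv_expand:
  assumes u: "u \<in> U"
  shows "metric_deriv G u k h l = (\<Sum>j\<in>Basis. (l \<bullet> j) * metric_deriv G u k h j)"
  unfolding metric_deriv_sym[OF u, of k h] unfolding metric_deriv_form
  by (rule local_form.form_deriv_expand[OF form_of_metric u])

lemma linear_metric_deriv: 
  assumes "u \<in> U" 
  shows "linear (\<lambda>k. metric_deriv G u k h l)" "linear (\<lambda>h. metric_deriv G u k h l)"
        "linear (\<lambda>l. metric_deriv G u k h l)"
proof -
  show 2: "linear (\<lambda>h. metric_deriv G u k h l)" for k l
    unfolding metric_deriv_form using local_form.linear_form_deriv_right[OF form_of_metric assms] .
  show "linear (\<lambda>l. metric_deriv G u k h l)"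
    unfolding metric_deriv_sym[OF assms, of k h] by (rule 2)
  show "linear (\<lambda>k. metric_deriv G u k h l)"
    unfolding metric_deriv_form using local_form.linear_form_deriv[OF form_of_metric assms] .
qed

lemma G_chain:
  assumes u: "(u has_derivative u') (at z within S)" and h: "(h has_derivative h') (at z within S)"
    and l: "(l has_derivative l') (at z within S)"
    and S: "z \<in> S" "u ` S \<subseteq> U"
  shows "((\<lambda>z. G (u z) (h z) (l z)) has_derivative
      (\<lambda>k. metric_deriv G (u z) (u' k) (h z) (l z) + G (u z) (h' k) (l z) + G (u z) (h z) (l' k)))
      (at z within S)"
proof -
  have uz: "u z \<in> U" using S by auto
  have d: "((\<lambda>z. G (u z) (h z) j) has_derivative
      (\<lambda>k. metric_deriv G (u z) (u' k) (h z) j + G (u z) (h' k) j)) (at z within S)" for j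
    using local_form.W_chain[OF form_of_metric u h S] by (simp add: metric_deriv_form)
  have "((\<lambda>z. \<Sum>j\<in>Basis. (l z \<bullet> j) * G (u z) (h z) j) has_derivative
     (\<lambda>k. \<Sum>j\<in>Basis. (l z \<bullet> j) * (metric_deriv G (u z) (u' k) (h z) j + G (u z) (h' k) j)
          + (l' k \<bullet> j) * G (u z) (h z) j)) (at z within S)"
    by (intro has_derivative_sum has_derivative_mult has_derivative_inner_left l d)
  moreover have "(\<Sum>j\<in>Basis. (l z \<bullet> j) * (metric_deriv G (u z) (u' k) (h z) j + G (u z) (h' k) j)
          + (l' k \<bullet> j) * G (u z) (h z) j)
     = metric_deriv G (u z) (u' k) (h z) (l z) + G (u z) (h' k) (l z) + G (u z) (h z) (l' k)" for k
    using metric_deriv_expand[OF uz, of "u' k" "h z" "l z"] G_expand[OF uz, of "h' k" "l z"]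
       G_expand[OF uz, of "h z" "l' k"]
    by (simp add: sum.distrib distrib_left)
  ultimately have "((\<lambda>z. \<Sum>j\<in>Basis. (l z \<bullet> j) * G (u z) (h z) j) has_derivative
     (\<lambda>k. metric_deriv G (u z) (u' k) (h z) (l z) + G (u z) (h' k) (l z) + G (u z) (h z) (l' k)))
      (at z within S)" by simp
  then show ?thesis
    by (rule has_derivative_transform[OF S(1), rotated]) (use S G_expand in auto)
qed

lemma G_Ck:
  fixes u h l :: "'b::euclidean_space \<Rightarrow> 'e"
  assumes "Ck_on k u S" "Ck_on k h S" "Ck_on k l S" "u ` S \<subseteq> U" "k \<le> 2"
  shows "Ck_on k (\<lambda>z. G (u z) (h z) (l z)) S"
proof -
  have "Ck_on k (\<lambda>z. \<Sum>j\<in>Basis. (l z \<bullet> j) * G (u z) (h z) j) S"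
    by (intro Ck_on_sum Ck_on_mult Ck_on_inner_left local_form.W_Ck[OF form_of_metric] assms finite_Basis)
  then show ?thesis by (rule Ck_on_cong) (use assms(4) G_expand in auto)
qed

lemma metric_deriv_Ck:
  fixes u h l :: "'b::euclidean_space \<Rightarrow> 'e"
  assumes "Ck_on k u S" "Ck_on k p S" "Ck_on k h S" "Ck_on k l S" "u ` S \<subseteq> U" "k \<le> 1"
  shows "Ck_on k (\<lambda>z. metric_deriv G (u z) (p z) (h z) (l z)) S"
proof -
  have "Ck_on k (\<lambda>z. \<Sum>j\<in>Basis. (l z \<bullet> j) * metric_deriv G (u z) (p z) (h z) j) S"
    unfolding metric_deriv_form
    by (intro Ck_on_sum Ck_on_mult Ck_on_inner_left local_form.form_deriv_Ck[OF form_of_metric] assms finite_Basis)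
  then show ?thesis by (rule Ck_on_cong) (use assms(5) metric_deriv_expand in auto)
qed

lemma christoffel_Ck:
  fixes u h l :: "'b::euclidean_space \<Rightarrow> 'e"
  assumes "Ck_on k u S" "Ck_on k h S" "Ck_on k l S" "u ` S \<subseteq> U" "k \<le> 1"
  shows "Ck_on k (\<lambda>z. christoffel G (u z) (h z) (l z)) S"
proof -
  have "Ck_on k (\<lambda>z. metric_deriv G (u z) (h z) (h z) (l z) + (-1/2) * metric_deriv G (u z) (l z) (h z) (h z)) S"
    by (intro Ck_on_add Ck_on_mult Ck_on_const metric_deriv_Ck assms)
  then show ?thesis by (simp add: christoffel_def)
qed

lemma linear_christoffel:
  assumes "u \<in> U" shows "linear (christoffel G u h)"
  by (intro linearI)
    (simp_all add: christoffel_def algebra_simps add_divide_distrib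
      linear_simps[OF linear_metric_deriv(1)[OF assms]]
      linear_simps[OF linear_metric_deriv(3)[OF assms]])

lemma G_linear: "u \<in> U \<Longrightarrow> linear (G u h)" "u \<in> U \<Longrightarrow> linear (\<lambda>h. G u h l)"
  using bilinear_G by (auto simp: bilinear_def)

lemma G_nonneg: "u \<in> U \<Longrightarrow> 0 \<le> G u h h"
  using G_pos[of u h] bilinear_lzero[OF bilinear_G, of u 0] by (cases "h = 0") (auto simp: less_imp_le)

end

section \<open>The first variation and the Euler-Lagrange equation\<close>

text \<open>The covector \<open>d/dt (\<partial>F/\<partial>\<xi>) - \<partial>F/\<partial>x\<close> of \<open>F = sqrt (G \<xi> \<xi>) + W \<xi>\<close> along a curve with velocity \<open>h\<close> and
  acceleration \<open>a\<close>, applied to \<open>e\<close> and multiplied by the cube of the length of \<open>h\<close>. The factor clears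
  all denominators.\<close>

definition euler_lagrange :: "('e::euclidean_space \<Rightarrow> 'e \<Rightarrow> 'e \<Rightarrow> real) \<Rightarrow> ('e \<Rightarrow> 'e \<Rightarrow> real)
    \<Rightarrow> 'e \<Rightarrow> 'e \<Rightarrow> 'e \<Rightarrow> 'e \<Rightarrow> real" where
  "euler_lagrange G W u h a e =
     G u h h * (G u a e + christoffel G u h e) - G u h e * (G u a h + christoffel G u h h)
       - sqrt (G u h h) ^ 3 * curl W u e h"

text \<open>Compactness of \<open>{a..b}\<close> makes an open condition on the central curve of a variation hold for all
  curves with small parameter.\<close>

lemma tube_around_zero:
  fixes f :: "real \<times> real \<Rightarrow> 'z::topological_space"
  assumes f: "continuous_on ({-\<epsilon><..<\<epsilon>} \<times> {a..b}) f" and V: "open V" "\<epsilon> > 0"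
    and 0: "\<And>t. t \<in> {a..b} \<Longrightarrow> f (0, t) \<in> V"
  obtains \<delta> where "\<delta> > 0" "\<delta> \<le> \<epsilon>" "\<And>s t. s \<in> {-\<delta><..<\<delta>} \<Longrightarrow> t \<in> {a..b} \<Longrightarrow> f (s, t) \<in> V"
proof -
  let ?S = "{-\<epsilon><..<\<epsilon>} \<times> {a..b}"
  obtain T where T: "open T" "T \<inter> ?S = f -` V \<inter> ?S"
    using f V(1) unfolding continuous_on_open_invariant by metis
  have "{0} \<times> {a..b} \<subseteq> T"
  proof
    fix z assume "z \<in> {0::real} \<times> {a..b}"
    then have "z \<in> f -` V \<inter> ?S" using 0 V(2) by auto
    then show "z \<in> T" using T(2) by blast
  qed
  then obtain X where X: "0 \<in> X" "open X" "X \<times> {a..b} \<subseteq> T"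
    using compact_Icc T(1) by (metis tube_lemma open_subset subtopology_UNIV
        openin_subtopology_self Elementary_Topology.tube_lemma)
  then obtain e where e: "e > 0" "ball 0 e \<subseteq> X" using openE by blast
  show thesis
  proof (rule that[of "min e \<epsilon>"])
    fix s t assume s: "s \<in> {- min e \<epsilon><..<min e \<epsilon>}" and t: "t \<in> {a..b}"
    then have "s \<in> ball 0 e" by (auto simp: dist_real_def)
    then have "(s, t) \<in> T" using e(2) X(3) t by blast
    moreover have "(s, t) \<in> ?S" using s t by auto
    ultimately show "f (s, t) \<in> V" using T(2) by blast
  qed (use e V in auto)
qed

lemma strip_partial_derivatives:
  fixes f :: "real \<times> real \<Rightarrow> 'e::euclidean_space"
  assumes F: "\<forall>z\<in>{-\<epsilon><..<\<epsilon>} \<times> {a..b}. (f has_derivative F z) (at z within {-\<epsilon><..<\<epsilon>} \<times> {a..b})"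
    and st: "s \<in> {-\<epsilon><..<\<epsilon>}" "t \<in> {a..b}"
  shows "((\<lambda>t. f (s, t)) has_vector_derivative F (s, t) (0, 1)) (at t within {a..b})"
    and "((\<lambda>s. f (s, t)) has_vector_derivative F (s, t) (1, 0)) (at s within {-\<epsilon><..<\<epsilon>})"
proof -
  have scale: "F (s, t) (k * p, k * q) = k *\<^sub>R F (s, t) (p, q)" for k p q
  proof -
    have "linear (F (s, t))" using F st by (intro has_derivative_linear) blast
    from linear_cmul[OF this, of k "(p, q)"] show ?thesis by (simp only: scaleR_Pair real_scaleR_def)
  qed
  have Q: "(f has_derivative F (s, t)) (at (s, t) within (Pair s) ` {a..b})"
    by (rule has_derivative_subset[OF F[rule_format]]) (use st in auto)
  have P: "(Pair s has_derivative (\<lambda>k. (0, k))) (at t within {a..b})"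
    by (auto intro!: derivative_eq_intros)
  from P Q have "((\<lambda>t. f (s, t)) has_derivative (\<lambda>k. F (s, t) (0, k))) (at t within {a..b})"
    by (rule has_derivative_in_compose)
  then show "((\<lambda>t. f (s, t)) has_vector_derivative F (s, t) (0, 1)) (at t within {a..b})"
    unfolding has_vector_derivative_def
    by (rule has_derivative_eq_rhs, intro ext) (rule scale[of _ 0 1, unfolded mult_zero_right mult_1_right])
  have Q: "(f has_derivative F (s, t)) (at (s, t) within (\<lambda>s. (s, t)) ` {-\<epsilon><..<\<epsilon>})"
    by (rule has_derivative_subset[OF F[rule_format]]) (use st in auto)
  have P: "((\<lambda>s. (s, t)) has_derivative (\<lambda>k. (k, 0))) (at s within {-\<epsilon><..<\<epsilon>})"
    by (auto intro!: derivative_eq_intros)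
  from P Q have "((\<lambda>s. f (s, t)) has_derivative (\<lambda>k. F (s, t) (k, 0))) (at s within {-\<epsilon><..<\<epsilon>})"
    by (rule has_derivative_in_compose)
  then show "((\<lambda>s. f (s, t)) has_vector_derivative F (s, t) (1, 0)) (at s within {-\<epsilon><..<\<epsilon>})"
    unfolding has_vector_derivative_def
    by (rule has_derivative_eq_rhs, intro ext) (rule scale[of _ 1 0, unfolded mult_zero_right mult_1_right])
qed

lemma at_0_within_open_interval: "(e::real) > 0 \<Longrightarrow> at 0 within {-e<..<e} = at 0"
  by (rule at_within_open) auto

context local_form begin

lemma W_chain_real:
  assumes "(x has_vector_derivative x') (at t within S)" "(h has_vector_derivative h') (at t within S)"
    and S: "t \<in> S" "x ` S \<subseteq> U"
  shows "((\<lambda>t. W (x t) (h t)) has_real_derivative form_deriv W (x t) x' (h t) + W (x t) h') (at t within S)"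
proof -
  have xt: "x t \<in> U" using S by auto
  have "((\<lambda>z. W (x z) (h z)) has_derivative
      (\<lambda>k. form_deriv W (x t) (k *\<^sub>R x') (h t) + W (x t) (k *\<^sub>R h'))) (at t within S)"
    using assms unfolding has_vector_derivative_def by (intro W_chain)
  moreover have "form_deriv W (x t) (k *\<^sub>R x') (h t) + W (x t) (k *\<^sub>R h')
      = (form_deriv W (x t) x' (h t) + W (x t) h') * k" for k
    by (simp add: linear_cmul[OF linear_form_deriv[OF xt]] linear_cmul[OF linear_W[OF xt]] algebra_simps)
  ultimately show ?thesis unfolding has_field_derivative_def by (simp add: fun_eq_iff)
qed

lemmas W_continuous = W_Ck[of 0, simplified]
lemmas form_deriv_continuous = form_deriv_Ck[of 0, simplified]
lemmas curl_continuous = curl_Ck[of 0, simplified]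

end

context local_metric begin

lemma G_chain_real:
  assumes "(x has_vector_derivative x') (at t within S)" "(h has_vector_derivative h') (at t within S)"
    "(l has_vector_derivative l') (at t within S)"
    and S: "t \<in> S" "x ` S \<subseteq> U"
  shows "((\<lambda>t. G (x t) (h t) (l t)) has_real_derivative
    metric_deriv G (x t) x' (h t) (l t) + G (x t) h' (l t) + G (x t) (h t) l') (at t within S)"
proof -
  have xt: "x t \<in> U" using S by auto
  have "((\<lambda>z. G (x z) (h z) (l z)) has_derivative
      (\<lambda>k. metric_deriv G (x t) (k *\<^sub>R x') (h t) (l t) + G (x t) (k *\<^sub>R h') (l t) + G (x t) (h t) (k *\<^sub>R l')))
     (at t within S)"
    using assms unfolding has_vector_derivative_def by (intro G_chain)
  moreover have "metric_deriv G (x t) (k *\<^sub>R x') (h t) (l t) + G (x t) (k *\<^sub>R h') (l t) + G (x t) (h t) (k *\<^sub>R l')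
      = (metric_deriv G (x t) x' (h t) (l t) + G (x t) h' (l t) + G (x t) (h t) l') * k" for k
    by (simp add: linear_cmul[OF linear_metric_deriv(1)[OF xt]] linear_cmul[OF G_linear(1)[OF xt]]
        linear_cmul[OF G_linear(2)[OF xt]] algebra_simps)
  ultimately show ?thesis unfolding has_field_derivative_def by (simp add: fun_eq_iff)
qed

lemmas G_continuous = G_Ck[of 0, simplified]
lemmas metric_deriv_continuous = metric_deriv_Ck[of 0, simplified]
lemmas christoffel_continuous = christoffel_Ck[of 0, simplified]

end

locale local_randers = local_metric U G + local_form U W
  for U :: "'e::euclidean_space set" and G :: "'e \<Rightarrow> 'e \<Rightarrow> 'e \<Rightarrow> real" and W :: "'e \<Rightarrow> 'e \<Rightarrow> real"
begin

lemma linear_euler_lagrange: "u \<in> U \<Longrightarrow> linear (euler_lagrange G W u h a)"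
  by (intro linearI)
    (simp_all add: euler_lagrange_def algebra_simps linear_simps[OF G_linear(1)]
      linear_simps[OF linear_christoffel]
      linear_simps[OF linear_curl_left])

lemma euler_lagrange_continuous:
  fixes u h a e :: "'b::euclidean_space \<Rightarrow> 'e"
  assumes "continuous_on S u" "continuous_on S h" "continuous_on S a" "continuous_on S e" "u ` S \<subseteq> U"
  shows "continuous_on S (\<lambda>z. euler_lagrange G W (u z) (h z) (a z) (e z))"
  unfolding euler_lagrange_def
  by (intro continuous_intros G_continuous christoffel_continuous curl_continuous assms)

text \<open>Differentiation under the integral produces the mixed derivative of \<open>y\<close>, contracted with the
  momentum \<open>p\<close> of the central curve. That term is the \<open>s\<close>-derivative of the integral of \<open>p(\<partial>\<^sub>t y)\<close>. For
  each fixed \<open>s\<close> this integral is integrated by parts in \<open>t\<close>; the boundary terms do not depend on \<open>s\<close>, and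
  only \<open>y\<close> itself remains to be differentiated in \<open>s\<close>.\<close>

lemma first_variation:
  fixes y :: "real \<times> real \<Rightarrow> 'e"
  assumes ab: "a < b" and eps: "\<epsilon> > 0"
    and C2: "Ck_on 2 y ({-\<epsilon><..<\<epsilon>} \<times> {a..b})" and yU: "y ` ({-\<epsilon><..<\<epsilon>} \<times> {a..b}) \<subseteq> U"
    and ends: "\<And>s. s \<in> {-\<epsilon><..<\<epsilon>} \<Longrightarrow> y (s, a) = y (0, a)" "\<And>s. s \<in> {-\<epsilon><..<\<epsilon>} \<Longrightarrow> y (s, b) = y (0, b)"
    and x': "\<And>t. t \<in> {a..b} \<Longrightarrow> ((\<lambda>t. y (0, t)) has_vector_derivative x' t) (at t within {a..b})"
    and x'': "\<And>t. t \<in> {a..b} \<Longrightarrow> (x' has_vector_derivative x'' t) (at t within {a..b})"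
    and reg: "\<And>t. t \<in> {a..b} \<Longrightarrow> x' t \<noteq> 0"
    and \<eta>: "\<And>t. t \<in> {a..b} \<Longrightarrow> ((\<lambda>s. y (s, t)) has_vector_derivative \<eta> t) (at 0)"
  defines "q \<equiv> \<lambda>s t. vector_derivative (\<lambda>t. y (s, t)) (at t within {a..b})"
  shows "((\<lambda>s. integral {a..b} (\<lambda>t. sqrt (G (y (s, t)) (q s t) (q s t)) + W (y (s, t)) (q s t)))
      has_real_derivative
      - integral {a..b} (\<lambda>t. euler_lagrange G W (y (0, t)) (x' t) (x'' t) (\<eta> t)
           / sqrt (G (y (0, t)) (x' t) (x' t)) ^ 3)) (at 0)"
proof -
  let ?S = "{-\<epsilon><..<\<epsilon>} \<times> {a..b}"
  obtain D where D: "\<forall>z\<in>?S. (y has_derivative D z) (at z within ?S)" "\<forall>h. Ck_on 1 (\<lambda>z. D z h) ?S"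
    using C2 unfolding numeral_2_eq_2 Ck_on.simps(2)[of "Suc 0"] One_nat_def by blast
  obtain E where E: "\<forall>z\<in>?S. ((\<lambda>z. D z (0, 1)) has_derivative E z) (at z within ?S)"
    "\<forall>h. continuous_on ?S (\<lambda>z. E z h)"
    using D(2)[rule_format, of "(0, 1)"] unfolding One_nat_def Ck_on.simps by blast
  have Dcont: "continuous_on ?S (\<lambda>z. D z h)" for h
    using D(2) by (intro Ck_on_continuous) blast
  have ycont: "continuous_on ?S y" using C2 by (rule Ck_on_continuous)
  note t_deriv = strip_partial_derivatives(1)
  note s_deriv = strip_partial_derivatives(2)
  have uniq: "X = Y" if "(f has_vector_derivative X) (at t within {a..b})"
      "(f has_vector_derivative Y) (at t within {a..b})" "t \<in> {a..b}" for f :: "real \<Rightarrow> 'e" and X Y t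
    using vector_derivative_unique_within_closed_interval[OF ab, of t f X Y] that by simp
  have q: "q s t = D (s, t) (0, 1)" if "s \<in> {-\<epsilon><..<\<epsilon>}" "t \<in> {a..b}" for s t
    unfolding q_def using vector_derivative_within_cbox[OF ab, of t] t_deriv[OF D(1) that] that(2)
    by simp
  have x'_eq: "x' t = D (0, t) (0, 1)" if "t \<in> {a..b}" for t
    using uniq[OF x' t_deriv[OF D(1)]] that eps by auto
  have x''_eq: "x'' t = E (0, t) (0, 1)" if "t \<in> {a..b}" for t
  proof (rule uniq[OF x''])
    have "((\<lambda>t. D (0, t) (0, 1)) has_vector_derivative E (0, t) (0, 1)) (at t within {a..b})"
      using t_deriv[OF E(1)] that eps by auto
    then show "(x' has_vector_derivative E (0, t) (0, 1)) (at t within {a..b})"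
      by (rule has_vector_derivative_transform[OF that, rotated]) (simp add: x'_eq)
  qed (use that in auto)
  note at_0 = at_0_within_open_interval
  have \<eta>_eq: "\<eta> t = D (0, t) (1, 0)" if "t \<in> {a..b}" for t
  proof -
    have "((\<lambda>s. y (s, t)) has_vector_derivative D (0, t) (1, 0)) (at 0)"
      using s_deriv[OF D(1), of 0 t] that eps at_0[OF eps] by simp
    from vector_derivative_unique_at[OF \<eta>[OF that] this] show ?thesis .
  qed
  obtain \<delta> where \<delta>: "\<delta> > 0" "\<delta> \<le> \<epsilon>"
      "\<And>s t. s \<in> {-\<delta><..<\<delta>} \<Longrightarrow> t \<in> {a..b} \<Longrightarrow> D (s, t) (0, 1) \<in> - {0}"
    using tube_around_zero[OF Dcont[of "(0, 1)"], of "- {0}"] eps reg x'_eq by (metis ComplI open_delete open_UNIV Compl_eq_Diff_UNIV singletonD)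
  let ?I = "{-\<delta><..<\<delta>}" and ?T = "{-\<delta><..<\<delta>} \<times> {a..b}"
  have TS: "?T \<subseteq> ?S" using \<delta> by auto
  have IS: "?I \<subseteq> {-\<epsilon><..<\<epsilon>}" using \<delta> by auto
  have 0: "0 \<in> ?I" using \<delta> by auto
  define x where "x t = y (0, t)" for t
  define v where "v z = D z (0, 1)" for z
  define ys where "ys z = D z (1, 0)" for z
  define vs where "vs z = E z (1, 0)" for z
  note sub = continuous_on_subset[OF _ TS]
  have cT: "continuous_on ?T y" "continuous_on ?T v" "continuous_on ?T ys" "continuous_on ?T vs"
    unfolding v_def ys_def vs_def using Dcont E(2) ycont by (blast intro: sub)+
  have c0: "continuous_on ?T (\<lambda>z. f (0, snd z))" if "continuous_on ?T f" for f :: "real \<times> real \<Rightarrow> 'e"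
    by (rule continuous_on_compose2[OF that]) (use 0 in \<open>auto intro!: continuous_intros\<close>)
  have cTx: "continuous_on ?T (\<lambda>z. x (snd z))" "continuous_on ?T (\<lambda>z. x' (snd z))"
      "continuous_on ?T (\<lambda>z. x'' (snd z))"
  proof -
    show "continuous_on ?T (\<lambda>z. x (snd z))" unfolding x_def by (rule c0[OF cT(1)])
    have "continuous_on ?T (\<lambda>z. v (0, snd z))" by (rule c0[OF cT(2)])
    then show "continuous_on ?T (\<lambda>z. x' (snd z))"
      by (rule continuous_on_eq) (auto simp: x'_eq v_def)
    have "continuous_on ?T (\<lambda>z. E (0, snd z) (0, 1))"
      by (rule c0, rule sub) (use E(2) in blast)
    then show "continuous_on ?T (\<lambda>z. x'' (snd z))"
      by (rule continuous_on_eq) (auto simp: x''_eq)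
  qed
  have yT: "y ` ?T \<subseteq> U" using yU TS by auto
  have xT: "(\<lambda>z. x (snd z)) ` ?T \<subseteq> U" using yT 0 unfolding x_def by force
  have xab: "x ` {a..b} \<subseteq> U" using xT 0 by force
  have v0: "v z \<noteq> 0" if "z \<in> ?T" for z using \<delta>(3) that unfolding v_def by (cases z) auto
  have slice: "continuous_on {a..b} (\<lambda>t. f (s, t))" if "continuous_on ?T f" "s \<in> ?I"
    for f :: "real \<times> real \<Rightarrow> real" and s
    by (rule continuous_on_compose2[OF that(1)]) (use that(2) in \<open>auto intro!: continuous_intros\<close>)
  have leibniz: "((\<lambda>s. integral {a..b} (\<lambda>t. f (s, t))) has_real_derivative integral {a..b} (\<lambda>t. f' (0, t))) (at 0)"
    if "\<And>s t. s \<in> ?I \<Longrightarrow> t \<in> {a..b} \<Longrightarrow> ((\<lambda>s. f (s, t)) has_real_derivative f' (s, t)) (at s within ?I)"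
      "continuous_on ?T f" "continuous_on ?T f'" for f f' :: "real \<times> real \<Rightarrow> real"
  proof -
    have "((\<lambda>s. integral (cbox a b) (\<lambda>t. f (s, t))) has_real_derivative integral (cbox a b) (\<lambda>t. f' (0, t))) (at 0 within ?I)"
      by (rule leibniz_rule_field_derivative[where fx = "\<lambda>s t. f' (s, t)"])
        (use that 0 slice[OF that(2)] in \<open>auto intro: integrable_continuous_real simp: box_real\<close>)
    then show ?thesis using at_0[OF \<delta>(1)] by simp
  qed
  define N where "N z = sqrt (G (y z) (v z) (v z))" for z
  have Gpos: "G (y z) (v z) (v z) > 0" if "z \<in> ?T" for z
    using G_pos[of "y z" "v z"] v0[OF that] yT that by auto
  define n where "n t = sqrt (G (x t) (x' t) (x' t))" for t
  have n_eq: "n t = N (0, t)" if "t \<in> {a..b}" for t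
    using that by (simp add: n_def N_def x_def v_def x'_eq)
  have Gx: "G (x t) (x' t) (x' t) > 0" if "t \<in> {a..b}" for t
    using Gpos[of "(0, t)"] that 0 by (simp add: x_def v_def x'_eq)
  have npos: "n t > 0" if "t \<in> {a..b}" for t
    using Gx[OF that] by (simp add: n_def)
  have n2: "G (x t) (x' t) (x' t) = n t ^ 2" if "t \<in> {a..b}" for t
    using Gx[OF that] by (simp add: n_def)
  define L' where "L' z = (metric_deriv G (y z) (ys z) (v z) (v z) + 2 * G (y z) (v z) (vs z)) / (2 * N z)
      + form_deriv W (y z) (ys z) (v z) + W (y z) (vs z)" for z
  have cN: "continuous_on ?T N" unfolding N_def
    by (intro continuous_intros G_continuous cT yT)
  have Npos: "N z > 0" if "z \<in> ?T" for z using Gpos[OF that] by (simp add: N_def)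
  have d1: "((\<lambda>s. y (s, t)) has_vector_derivative ys (s, t)) (at s within ?I)"
     "((\<lambda>s. v (s, t)) has_vector_derivative vs (s, t)) (at s within ?I)"
     if "s \<in> ?I" "t \<in> {a..b}" for s t
  proof -
    have s: "s \<in> {-\<epsilon><..<\<epsilon>}" using that IS by blast
    show "((\<lambda>s. y (s, t)) has_vector_derivative ys (s, t)) (at s within ?I)"
      "((\<lambda>s. v (s, t)) has_vector_derivative vs (s, t)) (at s within ?I)"
      unfolding ys_def v_def vs_def
      by (rule has_vector_derivative_within_subset[OF s_deriv[OF D(1) s that(2)] IS],
          rule has_vector_derivative_within_subset[OF s_deriv[OF E(1) s that(2)] IS])
  qed
  have var1: "((\<lambda>s. integral {a..b} (\<lambda>t. N (s, t) + W (y (s, t)) (v (s, t)))) has_real_derivative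
      integral {a..b} (\<lambda>t. L' (0, t))) (at 0)"
  proof (rule leibniz)
    fix s t assume st: "s \<in> ?I" "t \<in> {a..b}"
    have yI: "(\<lambda>s. y (s, t)) ` ?I \<subseteq> U" using yT st by auto
    have "((\<lambda>s. G (y (s, t)) (v (s, t)) (v (s, t))) has_real_derivative
        metric_deriv G (y (s, t)) (ys (s, t)) (v (s, t)) (v (s, t)) + G (y (s, t)) (vs (s, t)) (v (s, t))
        + G (y (s, t)) (v (s, t)) (vs (s, t))) (at s within ?I)"
      by (intro G_chain_real d1 st yI)
    moreover have "y (s, t) \<in> U" using yT st by auto
    ultimately have g: "((\<lambda>s. G (y (s, t)) (v (s, t)) (v (s, t))) has_real_derivative
        metric_deriv G (y (s, t)) (ys (s, t)) (v (s, t)) (v (s, t)) + 2 * G (y (s, t)) (v (s, t)) (vs (s, t))) (at s within ?I)"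
      using G_sym[of "y (s, t)" "vs (s, t)"] by (simp add: add.commute)
    have "((\<lambda>s. N (s, t)) has_real_derivative
        (metric_deriv G (y (s, t)) (ys (s, t)) (v (s, t)) (v (s, t)) + 2 * G (y (s, t)) (v (s, t)) (vs (s, t))) / (2 * N (s, t))) (at s within ?I)"
      unfolding N_def
      by (rule DERIV_chain2[OF DERIV_real_sqrt g, THEN DERIV_cong]) (use Gpos st in \<open>auto simp: field_simps\<close>)
    then show "((\<lambda>s. N (s, t) + W (y (s, t)) (v (s, t))) has_real_derivative L' (s, t)) (at s within ?I)"
      unfolding L'_def add.assoc by (intro DERIV_add W_chain_real d1 st yI)
  next
    show "continuous_on ?T (\<lambda>z. N z + W (y z) (v z))"
      by (intro continuous_intros cN W_continuous cT yT)
    show "continuous_on ?T L'" unfolding L'_def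
      by (intro continuous_intros cN W_continuous form_deriv_continuous metric_deriv_continuous
          G_continuous cT yT) (use Npos in force)
  qed
  \<comment> \<open>the momentum along the curve and its derivative\<close>
  define p where "p t e = G (x t) (x' t) e / n t + W (x t) e" for t e
  define p' where "p' t e = (metric_deriv G (x t) (x' t) (x' t) e + G (x t) (x'' t) e) / n t
     - G (x t) (x' t) e * (metric_deriv G (x t) (x' t) (x' t) (x' t) + 2 * G (x t) (x'' t) (x' t)) / (2 * n t ^ 3)
     + form_deriv W (x t) (x' t) e" for t e
  have cn: "continuous_on ?T (\<lambda>z. n (snd z))" unfolding n_def
    by (intro continuous_intros G_continuous cTx xT)
  have nT: "\<forall>z\<in>?T. n (snd z) \<noteq> 0" using npos by force
  have cp: "continuous_on ?T (\<lambda>z. p (snd z) (f z))" "continuous_on ?T (\<lambda>z. p' (snd z) (f z))"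
    if "continuous_on ?T f" for f
    unfolding p_def p'_def using nT
    by (intro continuous_intros cn W_continuous form_deriv_continuous metric_deriv_continuous
          G_continuous cTx xT that; force)+
  have xt: "x t \<in> U" if "t \<in> {a..b}" for t using xab that by auto
  have var2: "((\<lambda>s. integral {a..b} (\<lambda>t. p t (v (s, t)))) has_real_derivative
      integral {a..b} (\<lambda>t. p t (vs (0, t)))) (at 0)"
  proof -
    have "((\<lambda>s. p t (v (s, t))) has_real_derivative p t (vs (s, t))) (at s within ?I)"
      if "s \<in> ?I" "t \<in> {a..b}" for s t
    proof -
      have "linear (p t)" unfolding p_def
        by (intro linearI) (simp_all add: linear_add[OF G_linear(1)[OF xt[OF that(2)]]] linear_cmul[OF G_linear(1)[OF xt[OF that(2)]]]
           linear_add[OF linear_W[OF xt[OF that(2)]]] linear_cmul[OF linear_W[OF xt[OF that(2)]]] add_divide_distrib algebra_simps)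
      then have "bounded_linear (p t)" by (simp add: linear_conv_bounded_linear)
      from bounded_linear.has_vector_derivative[OF this d1(2)[OF that]]
      show ?thesis by (simp add: has_real_derivative_iff_has_vector_derivative)
    qed
    from leibniz[of "\<lambda>z. p (snd z) (v z)" "\<lambda>z. p (snd z) (vs z)"] this cp cT show ?thesis by simp
  qed
  have var3: "((\<lambda>s. integral {a..b} (\<lambda>t. p' t (y (s, t)))) has_real_derivative
      integral {a..b} (\<lambda>t. p' t (ys (0, t)))) (at 0)"
  proof -
    have "((\<lambda>s. p' t (y (s, t))) has_real_derivative p' t (ys (s, t))) (at s within ?I)"
      if "s \<in> ?I" "t \<in> {a..b}" for s t
    proof -
      note u = xt[OF that(2)]
      have "linear (p' t)" unfolding p'_def
        by (intro linearI) (simp_all add: linear_simps[OF G_linear(1)[OF u]]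
            linear_simps[OF linear_form_deriv_right[OF u]] 
            linear_simps[OF linear_metric_deriv(3)[OF u]] 
            add_divide_distrib diff_divide_distrib algebra_simps)
      then have "bounded_linear (p' t)" by (simp add: linear_conv_bounded_linear)
      from bounded_linear.has_vector_derivative[OF this d1(1)[OF that]]
      show ?thesis by (simp add: has_real_derivative_iff_has_vector_derivative)
    qed
    from leibniz[of "\<lambda>z. p' (snd z) (y z)" "\<lambda>z. p' (snd z) (ys z)"] this cp cT show ?thesis by simp
  qed
  have parts: "integral {a..b} (\<lambda>t. p t (v (s, t))) = p b (y (0, b)) - p a (y (0, a)) - integral {a..b} (\<lambda>t. p' t (y (s, t)))"
    if s: "s \<in> ?I" for s
  proof -
    have "((\<lambda>t. p t (y (s, t))) has_real_derivative p' t (y (s, t)) + p t (v (s, t))) (at t within {a..b})"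
      if t: "t \<in> {a..b}" for t
    proof -
      have dx: "(x has_vector_derivative x' t) (at t within {a..b})"
        using x'[OF t] by (simp add: x_def[abs_def])
      have dy: "((\<lambda>t. y (s, t)) has_vector_derivative v (s, t)) (at t within {a..b})"
        using t_deriv[OF D(1), of s t] s t IS unfolding v_def by auto
      have g1: "((\<lambda>t. G (x t) (x' t) (y (s, t))) has_real_derivative
          metric_deriv G (x t) (x' t) (x' t) (y (s, t)) + G (x t) (x'' t) (y (s, t)) + G (x t) (x' t) (v (s, t))) (at t within {a..b})"
        by (intro G_chain_real dx x'' dy t xab)
      have "((\<lambda>t. G (x t) (x' t) (x' t)) has_real_derivative
          metric_deriv G (x t) (x' t) (x' t) (x' t) + G (x t) (x'' t) (x' t) + G (x t) (x' t) (x'' t)) (at t within {a..b})"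
        by (intro G_chain_real dx x'' dy t xab)
      then have g2: "((\<lambda>t. G (x t) (x' t) (x' t)) has_real_derivative
          metric_deriv G (x t) (x' t) (x' t) (x' t) + 2 * G (x t) (x'' t) (x' t)) (at t within {a..b})"
        using G_sym[OF xt[OF t], of "x' t" "x'' t"] by (simp add: add.commute)
      have g3: "(n has_real_derivative (metric_deriv G (x t) (x' t) (x' t) (x' t) + 2 * G (x t) (x'' t) (x' t)) / (2 * n t)) (at t within {a..b})"
        unfolding n_def
        by (rule DERIV_chain2[OF DERIV_real_sqrt g2, THEN DERIV_cong]) (use Gx t in \<open>auto simp: field_simps\<close>)
      have g4: "((\<lambda>t. W (x t) (y (s, t))) has_real_derivative form_deriv W (x t) (x' t) (y (s, t)) + W (x t) (v (s, t))) (at t within {a..b})"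
        by (intro W_chain_real dx dy t xab)
      show ?thesis unfolding p_def p'_def
        by (rule DERIV_add[OF DERIV_divide[OF g1 g3] g4, THEN DERIV_cong])
          (use npos[OF t] in \<open>auto simp: field_simps power2_eq_square power3_eq_cube\<close>)
    qed
    then have "((\<lambda>t. p' t (y (s, t)) + p t (v (s, t))) has_integral p b (y (s, b)) - p a (y (s, a))) {a..b}"
      using ab by (intro fundamental_theorem_of_calculus) (auto simp: has_real_derivative_iff_has_vector_derivative)
    then have "integral {a..b} (\<lambda>t. p' t (y (s, t)) + p t (v (s, t))) = p b (y (0, b)) - p a (y (0, a))"
      unfolding ends[OF subsetD[OF IS s]] by (rule integral_unique)
    moreover have "integral {a..b} (\<lambda>t. p' t (y (s, t)) + p t (v (s, t)))
        = integral {a..b} (\<lambda>t. p' t (y (s, t))) + integral {a..b} (\<lambda>t. p t (v (s, t)))"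
      using slice[OF cp(2)[OF cT(1)] s] slice[OF cp(1)[OF cT(2)] s]
      by (intro integral_add integrable_continuous_real) auto
    ultimately show ?thesis by simp
  qed
  have "((\<lambda>s. integral {a..b} (\<lambda>t. p t (v (s, t)))) has_real_derivative
      - integral {a..b} (\<lambda>t. p' t (ys (0, t)))) (at 0)"
  proof -
    have "((\<lambda>s. p b (y (0, b)) - p a (y (0, a)) - integral {a..b} (\<lambda>t. p' t (y (s, t)))) has_real_derivative
      - integral {a..b} (\<lambda>t. p' t (ys (0, t)))) (at 0)"
      by (rule DERIV_diff[OF DERIV_const var3, THEN DERIV_cong]) simp
    then show ?thesis
      by (rule has_field_derivative_transform_within_open[of _ _ _ ?I]) (use 0 parts in auto)
  qed
  from DERIV_unique[OF this var2]
  have zero: "integral {a..b} (\<lambda>t. p t (vs (0, t))) = - integral {a..b} (\<lambda>t. p' t (ys (0, t)))" by simp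
  have cL': "continuous_on ?T L'" unfolding L'_def
      by (intro continuous_intros cN W_continuous form_deriv_continuous metric_deriv_continuous
          G_continuous cT yT) (use Npos in force)
  have "integral {a..b} (\<lambda>t. L' (0, t)) =
      integral {a..b} (\<lambda>t. L' (0, t)) - integral {a..b} (\<lambda>t. p t (vs (0, t))) - integral {a..b} (\<lambda>t. p' t (ys (0, t)))"
    using zero by simp
  also have "\<dots> = integral {a..b} (\<lambda>t. L' (0, t) - p t (vs (0, t)) - p' t (ys (0, t)))"
    using slice[OF cL' 0] slice[OF cp(1)[OF cT(4)] 0] slice[OF cp(2)[OF cT(3)] 0]
    by (subst integral_diff, (auto intro!: integrable_continuous_real continuous_intros)[2],
        subst integral_diff) (auto intro!: integrable_continuous_real)
  also have "\<dots> = integral {a..b} (\<lambda>t. - (euler_lagrange G W (x t) (x' t) (x'' t) (\<eta> t) / n t ^ 3))"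
  proof (rule integral_cong)
    fix t assume t: "t \<in> {a..b}"
    have e: "y (0, t) = x t" "v (0, t) = x' t" "ys (0, t) = \<eta> t" "N (0, t) = n t"
      using t by (simp_all add: x_def v_def ys_def x'_eq \<eta>_eq n_eq)
    show "L' (0, t) - p t (vs (0, t)) - p' t (ys (0, t))
        = - (euler_lagrange G W (x t) (x' t) (x'' t) (\<eta> t) / n t ^ 3)"
      unfolding L'_def p_def p'_def e euler_lagrange_def n_def[of t, symmetric] n2[OF t] christoffel_def curl_def
      using npos[OF t] by (simp add: divide_simps) (simp add: algebra_simps power2_eq_square power3_eq_cube)
  qed
  finally have fin: "integral {a..b} (\<lambda>t. L' (0, t)) = - integral {a..b} (\<lambda>t. euler_lagrange G W (x t) (x' t) (x'' t) (\<eta> t) / n t ^ 3)"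
    by simp
  have "((\<lambda>s. integral {a..b} (\<lambda>t. sqrt (G (y (s, t)) (q s t) (q s t)) + W (y (s, t)) (q s t)))
      has_real_derivative integral {a..b} (\<lambda>t. L' (0, t))) (at 0)"
  proof (rule has_field_derivative_transform_within_open[OF var1, of ?I])
    fix s assume s: "s \<in> ?I"
    show "integral {a..b} (\<lambda>t. N (s, t) + W (y (s, t)) (v (s, t)))
       = integral {a..b} (\<lambda>t. sqrt (G (y (s, t)) (q s t) (q s t)) + W (y (s, t)) (q s t))"
      by (rule integral_cong) (use s IS in \<open>auto simp: N_def v_def q subset_iff\<close>)
  qed (use 0 in auto)
  then show ?thesis unfolding fin n_def x_def .
qed

end

section \<open>Testing with polynomial variations\<close>

lemma real_polynomial_function_Ck:
  assumes "real_polynomial_function (p :: real \<Rightarrow> real)" shows "Ck_on k p S"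
proof -
  have "Ck_on k p UNIV" using assms
  proof (induction k arbitrary: p)
    case 0
    then show ?case
      by (simp add: continuous_on_polymonial_function real_polynomial_function_eq)
  next
    case (Suc k)
    then obtain p' where "real_polynomial_function p'" "\<And>x. (p has_real_derivative p' x) (at x)"
      using has_real_derivative_polynomial_function by blast
    then show ?case using Suc.IH by (intro Ck_on_real_field) auto
  qed
  then show ?thesis by (rule Ck_on_subset) simp
qed

text \<open>Polynomial test functions are of class \<open>C\<^sup>2\<close> for free, and Weierstrass approximation provides enough of
  them: with \<open>p\<close> close to \<open>f\<close>, the integral of the weight times \<open>f\<^sup>2\<close> is arbitrarily small.\<close>

lemma fundamental_lemma_polynomial:
  fixes f :: "real \<Rightarrow> real"
  assumes ab: "a < b" and f: "continuous_on {a..b} f"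
    and test: "\<And>p. real_polynomial_function p \<Longrightarrow>
      integral {a..b} (\<lambda>t. f t * ((t - a) * (b - t) * p t)) = 0"
    and t: "t \<in> {a..b}"
  shows "f t = 0"
proof -
  define w where "w t = (t - a) * (b - t)" for t
  have w: "continuous_on {a..b} w" "\<And>t. t \<in> {a..b} \<Longrightarrow> 0 \<le> w t"
    unfolding w_def by (auto intro!: continuous_intros)
  define J where "J = integral {a..b} (\<lambda>t. w t * \<bar>f t\<bar>)"
  have J0: "0 \<le> J" unfolding J_def
    by (intro integral_nonneg integrable_continuous_real continuous_intros w f) (use w in auto)
  have cts: "continuous_on {a..b} (\<lambda>t. w t * (f t)\<^sup>2)"
    by (intro continuous_intros w f)
  have nonneg: "0 \<le> integral {a..b} (\<lambda>t. w t * (f t)\<^sup>2)"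
    by (intro integral_nonneg integrable_continuous_real cts) (use w in auto)
  have bound: "integral {a..b} (\<lambda>t. w t * (f t)\<^sup>2) \<le> e * J" if e: "e > 0" for e
  proof -
    obtain p where p: "real_polynomial_function p" "\<And>x. x \<in> {a..b} \<Longrightarrow> \<bar>f x - p x\<bar> < e"
      using Stone_Weierstrass_real_polynomial_function[OF compact_Icc f e] by blast
    have cp: "continuous_on {a..b} p"
      using Ck_on_continuous[OF real_polynomial_function_Ck[OF p(1), of 0]] .
    have "integral {a..b} (\<lambda>t. w t * (f t)\<^sup>2) =
        integral {a..b} (\<lambda>t. w t * (f t)\<^sup>2) - integral {a..b} (\<lambda>t. f t * (w t * p t))"
      using test[OF p(1)] by (simp add: w_def)
    also have "\<dots> = integral {a..b} (\<lambda>t. w t * (f t)\<^sup>2 - f t * (w t * p t))"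
      by (intro integral_diff[symmetric] integrable_continuous_real continuous_intros w f cp)
    also have "\<dots> \<le> integral {a..b} (\<lambda>t. e * (w t * \<bar>f t\<bar>))"
    proof (intro integral_le integrable_continuous_real continuous_intros w f cp)
      fix t assume t: "t \<in> {a..b}"
      have "w t * (f t)\<^sup>2 - f t * (w t * p t) = w t * (f t * (f t - p t))"
        by (simp add: algebra_simps power2_eq_square)
      also have "\<dots> \<le> w t * (\<bar>f t\<bar> * e)"
      proof (rule mult_left_mono[OF _ w(2)[OF t]])
        have "f t * (f t - p t) \<le> \<bar>f t * (f t - p t)\<bar>" by (rule abs_ge_self)
        also have "\<dots> \<le> \<bar>f t\<bar> * e"
          unfolding abs_mult using p(2)[OF t] by (intro mult_left_mono) auto
        finally show "f t * (f t - p t) \<le> \<bar>f t\<bar> * e" .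
      qed
      finally show "w t * (f t)\<^sup>2 - f t * (w t * p t) \<le> e * (w t * \<bar>f t\<bar>)" by (simp add: mult_ac)
    qed
    finally show ?thesis by (simp add: J_def)
  qed
  have "integral {a..b} (\<lambda>t. w t * (f t)\<^sup>2) \<le> 0"
  proof (rule field_le_epsilon)
    fix e :: real assume e: "e > 0"
    have "integral {a..b} (\<lambda>t. w t * (f t)\<^sup>2) \<le> (e / (J + 1)) * J"
      using e J0 by (intro bound) auto
    also have "\<dots> \<le> e" using e J0 by (simp add: field_simps)
    finally show "integral {a..b} (\<lambda>t. w t * (f t)\<^sup>2) \<le> 0 + e" by simp
  qed
  with nonneg have "integral {a..b} (\<lambda>t. w t * (f t)\<^sup>2) = 0" by simp
  then have zero: "w t * (f t)\<^sup>2 = 0" if "t \<in> {a..b}" for t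
    using integral_eq_0_iff[OF cts ab] w(2) that by auto
  have inner: "f t = 0" if "t \<in> {a<..<b}" for t
    using zero[of t] that by (simp add: w_def)
  have cl: "closure {a<..<b} = {a..b}" using ab by (rule closure_greaterThanLessThan)
  show ?thesis
    by (rule continuous_constant_on_closure[of "{a<..<b}" f 0 t]) (use f t inner cl in simp_all)
qed

section \<open>Local existence of geodesics\<close>

text \<open>Composition with the nearest point projection of the ball makes \<open>f\<close> bounded and Lipschitz on the
  whole space, so that the Picard operator is a contraction on the space of bounded continuous curves. On the
  short interval chosen the fixed point stays in the ball, where the projection does nothing.\<close>

lemma picard_local_solution:
  fixes f :: "'s::euclidean_space \<Rightarrow> 's"
  assumes r: "r > 0" and L: "L-lipschitz_on (cball z0 r) f"
  obtains T z where "T > 0" "z 0 = z0" "\<And>t. t \<in> {0..T} \<Longrightarrow> z t \<in> cball z0 r"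
    "\<And>t. t \<in> {0..T} \<Longrightarrow> (z has_vector_derivative f (z t)) (at t within {0..T})"
proof -
  let ?B = "cball z0 r"
  define F where "F z = f (closest_point ?B z)" for z
  have B: "closed ?B" "convex ?B" "?B \<noteq> {}" using r by auto
  have cp: "closest_point ?B z \<in> ?B" for z using B by (intro closest_point_in_set) auto
  have F_lip: "dist (F y) (F z) \<le> L * dist y z" for y z
  proof -
    have "dist (F y) (F z) \<le> L * dist (closest_point ?B y) (closest_point ?B z)"
      unfolding F_def by (rule lipschitz_onD[OF L cp cp])
    also have "\<dots> \<le> L * dist y z"
      using lipschitz_on_nonneg[OF L] closest_point_lipschitz[OF B(2,1,3)] by (intro mult_left_mono) auto
    finally show ?thesis .
  qed
  have "L-lipschitz_on UNIV F" using F_lip lipschitz_on_nonneg[OF L] by (intro lipschitz_onI) auto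
  then have F_cont: "continuous_on UNIV F" by (rule lipschitz_on_continuous_on)
  define M where "M = norm (f z0) + L * r"
  have L0: "0 \<le> L" by (rule lipschitz_on_nonneg[OF L])
  have M0: "0 \<le> M" using L0 r by (simp add: M_def)
  have F_bound: "norm (F z) \<le> M" for z
  proof -
    have "dist (F z) (f z0) \<le> L * dist (closest_point ?B z) z0"
      unfolding F_def using r by (intro lipschitz_onD[OF L cp]) auto
    also have "\<dots> \<le> L * r" using cp[of z] L0 by (intro mult_left_mono) (auto simp: dist_commute)
    finally have "norm (F z - f z0) \<le> L * r" by (simp add: dist_norm)
    then show ?thesis unfolding M_def using norm_triangle_ineq2[of "F z" "f z0"] by linarith
  qed
  \<comment> \<open>The first bound makes the operator contract by one half, the second confines the solution to the ball.\<close>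
  define T where "T = min (1 / (2 * (L + 1))) (r / (M + 1))"
  have T: "T > 0" "T * L \<le> 1/2" "T * M \<le> r"
  proof -
    show "T > 0" using L0 M0 r by (simp add: T_def)
    have "T * L \<le> 1 / (2 * (L + 1)) * L" using L0 by (intro mult_right_mono) (auto simp: T_def)
    also have "\<dots> \<le> 1/2" using L0 by (simp add: field_simps)
    finally show "T * L \<le> 1/2" .
    have "T * M \<le> r / (M + 1) * M" using M0 by (intro mult_right_mono) (auto simp: T_def)
    also have "\<dots> \<le> r" using M0 r by (simp add: field_simps)
    finally show "T * M \<le> r" .
  qed
  define c where "c t = max 0 (min T t)" for t :: real
  have c: "c t \<in> {0..T}" "continuous_on UNIV c" for t
    unfolding c_def using T(1) by (auto intro!: continuous_intros)
  define \<Phi> where "\<Phi> z t = z0 + integral {0..c t} (\<lambda>s. F (z s))" for z :: "real \<Rightarrow> 's" and t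
  have Fz: "continuous_on S (\<lambda>s. F (z s))" if "continuous_on UNIV z" for z :: "real \<Rightarrow> 's" and S
    by (rule continuous_on_compose2[OF F_cont]) (use that in \<open>auto intro: continuous_on_subset\<close>)
  have int: "(\<lambda>s. F (z s)) integrable_on {0..d}" if "continuous_on UNIV z" for z :: "real \<Rightarrow> 's" and d
    by (intro integrable_continuous_real Fz that)
  have int_bound: "norm (integral {0..d} g) \<le> T * C"
    if "d \<in> {0..T}" "\<And>s. norm (g s) \<le> C" "g integrable_on {0..d}" "0 \<le> C" for d C and g :: "real \<Rightarrow> 's"
  proof -
    have "norm (integral {0..d} g) \<le> integral {0..d} (\<lambda>s. C)"
      using that by (intro integral_norm_bound_integral) auto
    also have "\<dots> = d * C" using that by simp
    also have "\<dots> \<le> T * C" using that by (intro mult_right_mono) auto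
    finally show ?thesis .
  qed
  have \<Phi>_bcont: "\<Phi> z \<in> bcontfun" if z: "continuous_on UNIV z" for z
  proof -
    have "continuous_on {0..T} (\<lambda>t. integral {0..t} (\<lambda>s. F (z s)))"
      by (intro indefinite_integral_continuous_1 int z)
    then have "continuous_on UNIV (\<lambda>t. integral {0..c t} (\<lambda>s. F (z s)))"
      by (rule continuous_on_compose2) (use c in auto)
    then have "continuous_on UNIV (\<Phi> z)" unfolding \<Phi>_def by (intro continuous_intros)
    moreover have "bounded (range (\<Phi> z))"
    proof -
      have "dist z0 (\<Phi> z t) \<le> T * M" for t
        using int_bound[OF c(1) F_bound int[OF z] M0, of t] by (simp add: \<Phi>_def dist_norm)
      then show ?thesis unfolding bounded_def by blast
    qed
    ultimately show ?thesis by (simp add: bcontfun_def)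
  qed
  define P where "P z = Bcontfun (\<Phi> (apply_bcontfun z))" for z :: "real \<Rightarrow>\<^sub>C 's"
  have P: "apply_bcontfun (P z) = \<Phi> (apply_bcontfun z)" for z
    unfolding P_def by (intro Bcontfun_inverse \<Phi>_bcont) (rule continuous_on_apply_bcontfun)
  have "\<exists>!z. P z = z"
  proof (rule banach_fix_type[of "1/2"])
    show "\<forall>y z. dist (P y) (P z) \<le> 1 / 2 * dist y z"
    proof (intro allI)
      fix y z :: "real \<Rightarrow>\<^sub>C 's"
      note cy = continuous_on_apply_bcontfun[of UNIV y] and cz = continuous_on_apply_bcontfun[of UNIV z]
      show "dist (P y) (P z) \<le> 1 / 2 * dist y z"
      proof (rule dist_bound)
        fix t
        have "dist (\<Phi> y t) (\<Phi> z t) = norm (integral {0..c t} (\<lambda>s. F (y s) - F (z s)))"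
          using integral_diff[OF int[OF cy] int[OF cz], of "c t"] by (simp add: \<Phi>_def dist_norm)
        also have "\<dots> \<le> T * (L * dist y z)"
        proof (rule int_bound[OF c(1)])
          fix s
          have "norm (F (y s) - F (z s)) \<le> L * dist (y s) (z s)" using F_lip by (simp add: dist_norm)
          also have "\<dots> \<le> L * dist y z" using L0 dist_bounded by (intro mult_left_mono) auto
          finally show "norm (F (y s) - F (z s)) \<le> L * dist y z" .
        qed (use L0 in \<open>auto intro!: integrable_diff int cy cz\<close>)
        also have "\<dots> \<le> 1/2 * dist y z"
          using mult_right_mono[OF T(2), of "dist y z"] by (simp add: mult.assoc)
        finally show "dist (apply_bcontfun (P y) t) (apply_bcontfun (P z) t) \<le> 1/2 * dist y z" by (simp add: P)
      qed
    qed
  qed auto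
  then obtain z where "P z = z" by blast
  then have z: "apply_bcontfun z t = \<Phi> z t" for t using P[of z] by metis
  note cz = continuous_on_apply_bcontfun[of UNIV z]
  have in_ball: "z t \<in> ?B" for t
    using int_bound[OF c(1) F_bound int[OF cz] M0, of t] T(3) z[of t] by (simp add: \<Phi>_def dist_norm)
  show thesis
  proof (rule that[OF T(1), of "apply_bcontfun z"])
    show "z 0 = z0" using z[of 0] T(1) by (simp add: \<Phi>_def c_def)
    fix t assume t: "t \<in> {0..T}"
    have "((\<lambda>t. integral {0..t} (\<lambda>s. F (z s))) has_vector_derivative F (z t)) (at t within {0..T})"
      using Fz[OF cz] t by (rule integral_has_vector_derivative)
    then have "((\<lambda>t. z0 + integral {0..t} (\<lambda>s. F (z s))) has_vector_derivative F (z t)) (at t within {0..T})"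
      using has_vector_derivative_add[OF has_vector_derivative_const[of z0]] by fastforce
    then have "(z has_vector_derivative F (z t)) (at t within {0..T})"
      by (rule has_vector_derivative_transform[OF t, rotated]) (subst z, auto simp: \<Phi>_def c_def)
    moreover have "F (z t) = f (z t)" unfolding F_def using in_ball[of t] by (simp add: closest_point_self)
    ultimately show "(z has_vector_derivative f (z t)) (at t within {0..T})" by simp
  qed (rule in_ball)
qed

lemma linear_real_bound:
  fixes f :: "'e::euclidean_space \<Rightarrow> real"
  assumes "linear f" shows "\<bar>f h\<bar> \<le> norm h * (\<Sum>i\<in>Basis. \<bar>f i\<bar>)"
proof -
  have "\<bar>f h\<bar> = \<bar>\<Sum>i\<in>Basis. (h \<bullet> i) * f i\<bar>" by (subst linear_real_expand[OF assms]) simp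
  also have "\<dots> \<le> (\<Sum>i\<in>Basis. norm h * \<bar>f i\<bar>)"
    by (rule sum_abs[THEN order.trans], rule sum_mono)
      (auto simp: abs_mult Basis_le_norm intro!: mult_right_mono)
  finally show ?thesis by (simp add: sum_distrib_left)
qed

text \<open>Used to raise an index: it turns the covectors of the Euler-Lagrange equation into vectors.\<close>

lemma riesz_bilinear:
  fixes B :: "'e::euclidean_space \<Rightarrow> 'e \<Rightarrow> real"
  assumes B: "bilinear B" and pos: "\<And>h. h \<noteq> 0 \<Longrightarrow> B h h > 0" and f: "linear f"
  obtains a where "\<And>e. B a e = f e"
proof -
  define l where "l a = (\<Sum>i\<in>Basis. B a i *\<^sub>R i)" for a
  have Bl: "linear (\<lambda>a. B a e)" "linear (B e)" for e using B by (auto simp: bilinear_def)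
  have lin: "linear l" unfolding l_def
    by (intro linearI) (simp_all add: linear_simps[OF Bl(1)] scaleR_add_left sum.distrib
        scaleR_sum_right)
  have inner: "l a \<bullet> e = B a e" for a e
    using linear_real_expand[OF Bl(2), of a e] by (simp add: l_def inner_sum_left inner_sum_right inner_commute mult.commute)
  have "inj l"
  proof (rule injI)
    fix a b assume eq: "l a = l b"
    have "B a (a - b) = B b (a - b)" using inner[of a "a - b"] inner[of b "a - b"] eq by simp
    then have "B (a - b) (a - b) = 0" using linear_diff[OF Bl(1)[of "a - b"], of a b] by simp
    then show "a = b" using pos[of "a - b"] by force
  qed
  then obtain a where a: "l a = (\<Sum>i\<in>Basis. f i *\<^sub>R i)"
    using linear_injective_imp_surjective[OF lin] by (metis surjD)
  have "B a e = f e" for e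
    using inner[of a e] a linear_real_expand[OF f, of e]
    by (simp add: inner_sum_left inner_sum_right inner_commute mult.commute)
  then show thesis using that by blast
qed

context local_metric begin

lemma coercive_on_compact:
  assumes K: "compact K" "K \<subseteq> U"
  obtains m where "m > 0" "\<And>u h. u \<in> K \<Longrightarrow> G u h h \<ge> m * (norm h)\<^sup>2"
proof (cases "K = {}")
  case True
  then show ?thesis using that[of 1] by auto
next
  case False
  let ?S = "K \<times> sphere (0::'e) 1"
  have S: "compact ?S" "?S \<noteq> {}" using K False by (auto intro!: compact_Times)
  have "continuous_on ?S (\<lambda>z. G (fst z) (snd z) (snd z))"
    using K(2) by (intro G_continuous continuous_intros) auto
  from continuous_attains_inf[OF S this] obtain z where z: "z \<in> ?S"
    "\<forall>y\<in>?S. G (fst z) (snd z) (snd z) \<le> G (fst y) (snd y) (snd y)" by blast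
  let ?m = "G (fst z) (snd z) (snd z)"
  show ?thesis
  proof (rule that[of ?m])
    show "?m > 0" using z(1) K(2) by (intro G_pos) auto
    fix u h assume u: "u \<in> K"
    show "G u h h \<ge> ?m * (norm h)\<^sup>2"
    proof (cases "h = 0")
      case True
      then show ?thesis using G_nonneg[of u h] u K(2) by auto
    next
      case h: False
      have uU: "u \<in> U" using u K by auto
      have "?m \<le> G u (h /\<^sub>R norm h) (h /\<^sub>R norm h)"
        using z(2)[rule_format, of "(u, h /\<^sub>R norm h)"] u h by auto
      also have "\<dots> = G u h h / (norm h)\<^sup>2"
        by (simp add: linear_cmul[OF G_linear(1)[OF uU]] linear_cmul[OF G_linear(2)[OF uU]]
            power2_eq_square field_simps)
      finally show ?thesis using h by (simp add: field_simps)
    qed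
  qed
qed

end

context local_randers begin

text \<open>The Euler-Lagrange equation fixes the acceleration only modulo the velocity. This choice keeps
  the \<open>G\<close>-length of the velocity constant.\<close>

definition accel :: "'e \<Rightarrow> 'e \<Rightarrow> 'e" where
  "accel u h = (SOME a. \<forall>e. G u a e = - christoffel G u h e + sqrt (G u h h) * curl W u e h)"

lemma accel:
  assumes "u \<in> U"
  shows "G u (accel u h) e = - christoffel G u h e + sqrt (G u h h) * curl W u e h"
proof -
  have "linear (\<lambda>e. - christoffel G u h e + sqrt (G u h h) * curl W u e h)"
    by (intro linearI) (simp_all add: algebra_simps
      linear_simps[OF linear_christoffel[OF assms]]
      linear_simps[OF linear_curl_left[OF assms]])
  from riesz_bilinear[OF bilinear_G[OF assms] G_pos[OF assms] this]
  have "\<exists>a. \<forall>e. G u a e = - christoffel G u h e + sqrt (G u h h) * curl W u e h" by metis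
  from someI_ex[OF this] show ?thesis unfolding accel_def by blast
qed

lemma euler_lagrange_accel: "u \<in> U \<Longrightarrow> euler_lagrange G W u h (accel u h) e = 0"
  using G_nonneg[of u h]
  by (simp add: euler_lagrange_def accel power3_eq_cube)

text \<open>The acceleration \<open>a\<close> solves a linear system \<open>G u a = \<beta>\<close> with Lipschitz data. For two systems, \<open>G\<close> applied to
  the difference \<open>d\<close> of the solutions is controlled by the differences of the data, and coercivity of
  \<open>G\<close> bounds \<open>d\<close> itself.\<close>

lemma accel_lipschitz:
  assumes K: "compact K" "convex K" "K \<subseteq> U \<times> (- {0})"
  obtains L where "L-lipschitz_on K (\<lambda>z. accel (fst z) (snd z))"
proof -
  let ?O = "U \<times> (- {0::'e})"
  have O: "open ?O" using open_U by (intro open_Times) auto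
  define \<beta> where "\<beta> z e = - christoffel G (fst z) (snd z) e
      + sqrt (G (fst z) (snd z) (snd z)) * curl W (fst z) e (snd z)" for z :: "'e \<times> 'e" and e
  have fs: "Ck_on k fst S" "Ck_on k snd S" "Ck_on k (\<lambda>z. e) S"
    for k and S :: "('e \<times> 'e) set" and e :: 'e
    using Ck_on_fst[OF Ck_on_ident] Ck_on_snd[OF Ck_on_ident] Ck_on_const by auto
  have "Ck_on 1 (\<lambda>z. \<beta> z e) ?O" for e unfolding \<beta>_def
    by (intro Ck_on_add Ck_on_minus Ck_on_mult Ck_on_sqrt christoffel_Ck G_Ck curl_Ck fs)
      (auto intro: G_pos)
  then have "\<exists>L. L-lipschitz_on K (\<lambda>z. \<beta> z e)" for e
    using Ck_on_1_lipschitz_on_compact[OF _ O K] by metis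
  then obtain L\<beta> where L\<beta>: "\<And>e. (L\<beta> e)-lipschitz_on K (\<lambda>z. \<beta> z e)" by metis
  have "Ck_on 1 (\<lambda>z. G (fst z) i j) ?O" for i j
    by (intro G_Ck fs) auto
  then have "\<exists>L. L-lipschitz_on K (\<lambda>z. G (fst z) i j)" for i j
    using Ck_on_1_lipschitz_on_compact[OF _ O K] by metis
  then obtain LG where LG: "\<And>i j. (LG i j)-lipschitz_on K (\<lambda>z. G (fst z) i j)" by metis
  have "compact (fst ` K)" "fst ` K \<subseteq> U" using K by (auto intro!: compact_continuous_image continuous_intros)
  from coercive_on_compact[OF this] obtain m where m: "m > 0"
    "\<And>u h. u \<in> fst ` K \<Longrightarrow> G u h h \<ge> m * (norm h)\<^sup>2" by blast
  have "continuous_on K (\<lambda>z. \<Sum>e\<in>Basis. \<bar>\<beta> z e\<bar>)"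
    using lipschitz_on_continuous_on[OF L\<beta>] by (intro continuous_intros) auto
  then have "bounded ((\<lambda>z. \<Sum>e\<in>Basis. \<bar>\<beta> z e\<bar>) ` K)"
    using K(1) compact_continuous_image compact_imp_bounded by blast
  then obtain M where M: "M > 0" "\<forall>y\<in>(\<lambda>z. \<Sum>e\<in>Basis. \<bar>\<beta> z e\<bar>) ` K. norm y \<le> M"
    unfolding bounded_pos by blast
  let ?S = "\<lambda>z. accel (fst z) (snd z)"
  have uU: "fst z \<in> U" if "z \<in> K" for z using K(3) that by auto
  have S: "G (fst z) (?S z) e = \<beta> z e" if "z \<in> K" for z e
    using accel[OF uU[OF that]] by (simp add: \<beta>_def)
  have \<beta>_lin: "linear (\<beta> z)" if "z \<in> K" for z
    using G_linear(1)[OF uU[OF that], of "?S z"] S[OF that] by (simp add: linear_iff)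
  have cancel: "X \<le> Y" if "m * X\<^sup>2 \<le> X * (m * Y)" "0 \<le> X" "0 \<le> Y" for X Y
  proof (cases "X = 0")
    case False
    then have "X * (m * X) \<le> X * (m * Y)" "X > 0" using that by (auto simp: power2_eq_square mult_ac)
    then show ?thesis using m(1) by (simp add: mult_le_cancel_left_pos)
  qed (use that in simp)
  have S_bound: "norm (?S z) \<le> M / m" if z: "z \<in> K" for z
  proof (rule cancel)
    have "m * (norm (?S z))\<^sup>2 \<le> \<beta> z (?S z)" using m(2)[of "fst z" "?S z"] S[OF z] z by auto
    also have "\<dots> \<le> norm (?S z) * (\<Sum>e\<in>Basis. \<bar>\<beta> z e\<bar>)"
      using linear_real_bound[OF \<beta>_lin[OF z], of "?S z"] by linarith
    also have "\<dots> \<le> norm (?S z) * M" using M(2) z by (intro mult_left_mono) auto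
    finally show "m * (norm (?S z))\<^sup>2 \<le> norm (?S z) * (m * (M / m))" using m(1) by simp
  qed (use m M in auto)
  define C where "C = (\<Sum>e\<in>Basis. L\<beta> e) + M / m * (\<Sum>j\<in>Basis. \<Sum>i\<in>Basis. LG i j)"
  have L0: "0 \<le> L\<beta> e" "0 \<le> LG i j" for e i j
    using lipschitz_on_nonneg[OF L\<beta>] lipschitz_on_nonneg[OF LG] by auto
  have C0: "0 \<le> C" unfolding C_def using L0 m M by (intro add_nonneg_nonneg mult_nonneg_nonneg sum_nonneg) auto
  have "(C / m)-lipschitz_on K ?S"
  proof (rule lipschitz_onI)
    fix z y assume z: "z \<in> K" and y: "y \<in> K"
    define d where "d = ?S z - ?S y"
    have "G (fst z) d d = G (fst z) (?S z) d - G (fst z) (?S y) d"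
      using linear_diff[OF G_linear(2)[OF uU[OF z], of d], of "?S z" "?S y"] d_def by metis
    also have "\<dots> = (\<beta> z d - \<beta> y d) - (G (fst z) (?S y) d - G (fst y) (?S y) d)"
      using S[OF z] S[OF y] by simp
    finally have Gd: "G (fst z) d d = (\<beta> z d - \<beta> y d) - (G (fst z) (?S y) d - G (fst y) (?S y) d)" .
    have "\<bar>\<beta> z d - \<beta> y d\<bar> \<le> norm d * (\<Sum>i\<in>Basis. \<bar>\<beta> z i - \<beta> y i\<bar>)"
      using linear_real_bound[OF linear_compose_sub[OF \<beta>_lin[OF z] \<beta>_lin[OF y]]] .
    also have "\<dots> \<le> norm d * (\<Sum>i\<in>Basis. L\<beta> i * dist z y)"
      using lipschitz_onD[OF L\<beta> z y] by (intro mult_left_mono sum_mono) (auto simp: dist_real_def)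
    finally have 1: "\<bar>\<beta> z d - \<beta> y d\<bar> \<le> norm d * ((\<Sum>i\<in>Basis. L\<beta> i) * dist z y)"
      by (simp add: sum_distrib_right)
    have lin1: "linear (\<lambda>d. G (fst z) a d - G (fst y) a d)" for a
      using linear_compose_sub[OF G_linear(1)[OF uU[OF z]] G_linear(1)[OF uU[OF y]]] .
    have lin2: "linear (\<lambda>a. G (fst z) a j - G (fst y) a j)" for j
      using linear_compose_sub[OF G_linear(2)[OF uU[OF z]] G_linear(2)[OF uU[OF y]]] .
    have "\<bar>G (fst z) (?S y) d - G (fst y) (?S y) d\<bar>
        \<le> norm d * (\<Sum>j\<in>Basis. \<bar>G (fst z) (?S y) j - G (fst y) (?S y) j\<bar>)"
      by (rule linear_real_bound[OF lin1])
    also have "\<dots> \<le> norm d * (\<Sum>j\<in>Basis. norm (?S y) * (\<Sum>i\<in>Basis. \<bar>G (fst z) i j - G (fst y) i j\<bar>))"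
      by (intro mult_left_mono sum_mono linear_real_bound[OF lin2]) auto
    also have "\<dots> \<le> norm d * (\<Sum>j\<in>Basis. M / m * (\<Sum>i\<in>Basis. LG i j * dist z y))"
      using lipschitz_onD[OF LG z y] S_bound[OF y] M m
      by (intro mult_left_mono sum_mono mult_mono sum_nonneg) (auto simp: dist_real_def)
    also have "\<dots> = norm d * (M / m * (\<Sum>j\<in>Basis. \<Sum>i\<in>Basis. LG i j) * dist z y)"
      by (simp add: sum_distrib_left sum_distrib_right mult.assoc)
    finally have 2: "\<bar>G (fst z) (?S y) d - G (fst y) (?S y) d\<bar>
       \<le> norm d * (M / m * (\<Sum>j\<in>Basis. \<Sum>i\<in>Basis. LG i j) * dist z y)" .
    have 3: "m * (norm d)\<^sup>2 \<le> G (fst z) d d" using m(2) z by auto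
    have "G (fst z) d d \<le> norm d * (C * dist z y)" unfolding Gd
      using 1 2 by (simp add: C_def distrib_right distrib_left)
    then have 4: "G (fst z) d d \<le> norm d * (m * (C / m * dist z y))" using m(1) by simp
    have "norm d \<le> C / m * dist z y"
      by (rule cancel[OF order.trans[OF 3 4]]) (use C0 m(1) in simp_all)
    then show "dist (?S z) (?S y) \<le> C / m * dist z y" by (simp add: d_def dist_norm)
  qed (use C0 m(1) in simp)
  then show thesis by (rule that)
qed

lemma geodesic_exists:
  assumes u: "u \<in> U" and h: "h \<noteq> 0"
  obtains T x v a where "T > 0" "x 0 = u" "v 0 = h"
    "\<And>t. t \<in> {0..T} \<Longrightarrow> x t \<in> U" "\<And>t. t \<in> {0..T} \<Longrightarrow> v t \<noteq> 0"
    "\<And>t. t \<in> {0..T} \<Longrightarrow> (x has_vector_derivative v t) (at t within {0..T})"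
    "\<And>t. t \<in> {0..T} \<Longrightarrow> (v has_vector_derivative a t) (at t within {0..T})"
    "continuous_on {0..T} a"
    "\<And>t e. t \<in> {0..T} \<Longrightarrow> euler_lagrange G W (x t) (v t) (a t) e = 0"
proof -
  have "open (U \<times> (- {0::'e}))" using open_U by (intro open_Times) auto
  then obtain r where r: "r > 0" "cball (u, h) r \<subseteq> U \<times> (- {0})"
    using u h open_contains_cball by (metis ComplI SigmaI singletonD)
  obtain L where L: "L-lipschitz_on (cball (u, h) r) (\<lambda>z. accel (fst z) (snd z))"
    using accel_lipschitz[OF _ _ r(2)] by auto
  have "(1 + L)-lipschitz_on (cball (u, h) r) (\<lambda>z. (snd z, accel (fst z) (snd z)))"
  proof (rule lipschitz_onI)
    fix z y assume zy: "z \<in> cball (u, h) r" "y \<in> cball (u, h) r"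
    have "dist (snd z, accel (fst z) (snd z)) (snd y, accel (fst y) (snd y))
       \<le> dist (snd z) (snd y) + dist (accel (fst z) (snd z)) (accel (fst y) (snd y))"
      unfolding dist_Pair_Pair by (rule sqrt_sum_squares_le_sum) auto
    also have "\<dots> \<le> dist z y + L * dist z y"
      using lipschitz_onD[OF L zy] dist_snd_le[of z y] by (intro add_mono)
    finally show "dist (snd z, accel (fst z) (snd z)) (snd y, accel (fst y) (snd y)) \<le> (1 + L) * dist z y"
      by (simp add: distrib_right)
  qed (use lipschitz_on_nonneg[OF L] in simp)
  then obtain T z where z: "T > 0" "z 0 = (u, h)" "\<And>t. t \<in> {0..T} \<Longrightarrow> z t \<in> cball (u, h) r"
    "\<And>t. t \<in> {0..T} \<Longrightarrow> (z has_vector_derivative (snd (z t), accel (fst (z t)) (snd (z t)))) (at t within {0..T})"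
    using picard_local_solution[OF r(1)] by (metis (no_types, lifting))
  have zO: "z t \<in> U \<times> (- {0})" if "t \<in> {0..T}" for t using z(3)[OF that] r(2) by blast
  show thesis
  proof (rule that[of T "\<lambda>t. fst (z t)" "\<lambda>t. snd (z t)" "\<lambda>t. accel (fst (z t)) (snd (z t))"])
    fix t assume t: "t \<in> {0..T}"
    show "fst (z t) \<in> U" "snd (z t) \<noteq> 0" using zO[OF t] by auto
    show "((\<lambda>t. fst (z t)) has_vector_derivative snd (z t)) (at t within {0..T})"
      using bounded_linear.has_vector_derivative[OF bounded_linear_fst z(4)[OF t]] by simp
    show "((\<lambda>t. snd (z t)) has_vector_derivative accel (fst (z t)) (snd (z t))) (at t within {0..T})"
      using bounded_linear.has_vector_derivative[OF bounded_linear_snd z(4)[OF t]] by simp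
    show "euler_lagrange G W (fst (z t)) (snd (z t)) (accel (fst (z t)) (snd (z t))) e = 0" for e
      by (rule euler_lagrange_accel) (use zO[OF t] in auto)
  next
    have "continuous_on {0..T} z"
      unfolding continuous_on_eq_continuous_within
      using has_vector_derivative_continuous[OF z(4)] by blast
    then show "continuous_on {0..T} (\<lambda>t. accel (fst (z t)) (snd (z t)))"
      by (rule continuous_on_compose2[OF lipschitz_on_continuous_on[OF L]]) (use z(3) in auto)
  qed (use z in auto)
qed

end

section \<open>Linear algebra at a point\<close>

lemma poly_eq_on_reals:
  fixes p q :: "complex poly"
  assumes "\<And>t::real. poly p (of_real t) = poly q (of_real t)"
  shows "p = q"
proof (rule ccontr)
  assume "p \<noteq> q"
  then have "finite {x. poly (p - q) x = 0}" by (intro poly_roots_finite) auto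
  moreover have "range complex_of_real \<subseteq> {x. poly (p - q) x = 0}" using assms by auto
  moreover have "infinite (range complex_of_real)"
    by (simp add: finite_image_iff infinite_UNIV_char_0 inj_on_def)
  ultimately show False using finite_subset by blast
qed

text \<open>The first quadratic is positive on the real line, so it has a simple nonreal root \<open>z\<close>. If \<open>z\<close> were not
  a root of the second one, then \<open>z\<close> would have odd multiplicity on the left hand side of the identity
  and even multiplicity on the right. Two real quadratics with a common nonreal root are
  proportional.\<close>

lemma quadratics_with_square_ratio:
  fixes a b c a' b' c' :: real and P Q :: "complex poly"
  assumes eq: "[:of_real a, of_real b, of_real c:] * P\<^sup>2 = [:of_real a', of_real b', of_real c':] * Q\<^sup>2"
    and P: "P \<noteq> 0" and c: "c > 0" and pos: "\<And>t. a + b * t + c * t\<^sup>2 > 0"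
  shows "a' * c = a * c'"
proof -
  let ?g = "[:complex_of_real a, of_real b, of_real c:]"
  let ?h = "[:complex_of_real a', of_real b', of_real c':]"
  have g0: "?g \<noteq> 0" using c by auto
  have "\<not> constant (poly ?g)"
  proof
    assume "constant (poly ?g)"
    then have "poly ?g 1 = poly ?g 0" "poly ?g (- 1) = poly ?g 0" unfolding constant_def by blast+
    then have "b + c = 0" "c - b = 0" by (simp_all add: complex_eq_iff)
    then show False using c by simp
  qed
  then obtain z where z: "poly ?g z = 0" using fundamental_theorem_of_algebra by blast
  have nonreal: "z \<noteq> of_real t" for t
  proof
    assume "z = of_real t"
    then have "complex_of_real (a + b * t + c * t\<^sup>2) = 0"
      using z by (simp add: algebra_simps power2_eq_square)
    then have "a + b * t + c * t\<^sup>2 = 0" by (rule of_real_eq_0_iff[THEN iffD1])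
    then show False using pos[of t] by simp
  qed
  have "poly ?h z = 0"
  proof (rule ccontr)
    assume h: "poly ?h z \<noteq> 0"
    have "?h * Q\<^sup>2 \<noteq> 0" using eq g0 P by (metis mult_eq_0_iff power_eq_0_iff)
    then have Q: "Q \<noteq> 0" and h0: "?h \<noteq> 0" by auto
    have ord1: "order z ?g \<noteq> 0" using order_root[of ?g z] z g0 by blast
    have "\<not> [:- z, 1:] ^ 2 dvd ?g"
    proof
      assume "[:- z, 1:] ^ 2 dvd ?g"
      then obtain k where k: "?g = [:- z, 1:] * ([:- z, 1:] * k)" 
        by (auto simp only: dvd_def power2_eq_square mult.assoc)
      have "poly (pderiv ?g) z = 0" unfolding k pderiv_mult poly_add poly_mult by simp
      then have "of_real b + 2 * of_real c * z = 0" by (simp add: pderiv_pCons algebra_simps)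
      then have "z = of_real (- b / (2 * c))" using c by (simp add: field_simps add_eq_0_iff)
      then show False using nonreal by blast
    qed
    then have "\<not> 2 \<le> order z ?g" using order_divides[of z 2 ?g] g0 by auto
    with ord1 have "order z ?g = 1" by linarith
    then have "order z (?g * P\<^sup>2) = 1 + 2 * order z P"
      using g0 P by (simp add: order_mult power2_eq_square del: mult_pCons_left)
    moreover have "order z (?h * Q\<^sup>2) = 2 * order z Q"
      using h0 Q order_0I[OF h] by (simp add: order_mult power2_eq_square del: mult_pCons_left)
    ultimately have "1 + 2 * order z P = 2 * order z Q" using eq by metis
    then show False by presburger
  qed
  then have h: "of_real a' + of_real b' * z + of_real c' * z\<^sup>2 = 0" 
    by (simp add: algebra_simps power2_eq_square)
  have g: "of_real a + of_real b * z + of_real c * z\<^sup>2 = 0" 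
    using z by (simp add: algebra_simps power2_eq_square)
  have "of_real c * (of_real a' + of_real b' * z + of_real c' * z\<^sup>2)
     - of_real c' * (of_real a + of_real b * z + of_real c * z\<^sup>2) = 0" using g h by simp
  then have lin: "of_real (a' * c - a * c') + of_real (b' * c - b * c') * z = 0"
    by (simp add: algebra_simps)
  then have "(b' * c - b * c') * Im z = 0" by (simp add: complex_eq_iff)
  moreover have "Im z \<noteq> 0" using nonreal[of "Re z"] by (auto simp: complex_eq_iff)
  ultimately have "b' * c - b * c' = 0" by simp
  then show ?thesis using lin by (simp add: complex_eq_iff)
qed

lemma sym_bilinear_polarization:
  fixes B :: "'e::euclidean_space \<Rightarrow> 'e \<Rightarrow> real"
  assumes "bilinear B" "\<And>h k. B h k = B k h"
  shows "B h k = (B (h + k) (h + k) - B h h - B k k) / 2"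
  using assms(2)[of h k] by (simp add: bilinear_ladd[OF assms(1)] bilinear_radd[OF assms(1)])

text \<open>The complement of a proper subspace is dense.\<close>

lemma zero_where_linear_nonzero:
  fixes f :: "'e::euclidean_space \<Rightarrow> 'c::real_normed_vector"
  assumes B: "linear B" "B k \<noteq> 0" and f: "continuous_on UNIV f"
    and 0: "\<And>h. B h \<noteq> 0 \<Longrightarrow> f h = 0"
  shows "f h = 0"
proof (cases "B h = 0")
  case True
  let ?x = "\<lambda>n. h + (1 / real (Suc n)) *\<^sub>R k"
  have lim: "(\<lambda>n. 1 / real (Suc n)) \<longlonglongrightarrow> 0"
    using LIMSEQ_inverse_real_of_nat by (simp add: inverse_eq_divide)
  have "?x \<longlonglongrightarrow> h + 0 *\<^sub>R k" by (intro tendsto_intros lim)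
  then have "(\<lambda>n. f (?x n)) \<longlonglongrightarrow> f h"
    using f by (intro continuous_on_tendsto_compose[OF f]) auto
  moreover have "f (?x n) = 0" for n
    by (rule 0) (use True B(2) in \<open>simp add: linear_simps[OF B(1)]\<close>)
  ultimately have "(\<lambda>n. 0) \<longlonglongrightarrow> f h" by simp
  then show ?thesis by (simp add: LIMSEQ_const_iff)
qed (rule 0)

lemma continuous_on_bilinear_compose:
  fixes B :: "'a::euclidean_space \<Rightarrow> 'b::euclidean_space \<Rightarrow> 'c::real_normed_vector"
  assumes "bilinear B" "continuous_on S f" "continuous_on S g"
  shows "continuous_on S (\<lambda>x. B (f x) (g x))"
  using bilinear_conv_bounded_bilinear assms by (metis bounded_bilinear.continuous_on)

text \<open>The coordinates of the bivector spanned by \<open>v\<close> and \<open>h\<close>. They test whether \<open>v\<close> and \<open>h\<close> are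
  parallel by equations that are polynomial in the data.\<close>

definition wedge :: "('e \<Rightarrow> real) \<Rightarrow> ('e \<Rightarrow> real) \<Rightarrow> 'e \<Rightarrow> 'e \<Rightarrow> real" where
  "wedge e f v h = e v * f h - f v * e h"

lemma wedge_span:
  fixes e f :: "'e::euclidean_space \<Rightarrow> real"
  assumes "linear e" "linear f" "v \<in> span {h}" shows "wedge e f v h = 0"
  using assms by (auto simp: span_singleton wedge_def linear_cmul)

text \<open>The situation at one point: two inner products, the operators \<open>B\<close> and \<open>B'\<close> of the exterior
  derivatives, the difference \<open>D\<close> of the connections on the diagonal, and the equality modulo \<open>h\<close> of the
  accelerations of the two geodesics with velocity \<open>h\<close>. The sign tells forward from backward
  geodesics.\<close>

locale inner_pair =
  fixes g :: "'e::euclidean_space \<Rightarrow> 'e \<Rightarrow> real" and g' :: "'e \<Rightarrow> 'e \<Rightarrow> real"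
    and B B' D :: "'e \<Rightarrow> 'e"
  assumes bil: "bilinear g" "bilinear g'"
    and sym: "\<And>h k. g h k = g k h" "\<And>h k. g' h k = g' k h"
    and pos: "\<And>h. h \<noteq> 0 \<Longrightarrow> g h h > 0" "\<And>h. h \<noteq> 0 \<Longrightarrow> g' h h > 0"
    and lin: "linear B" "linear B'"
    and skew: "\<And>h. g (B h) h = 0" "\<And>h. g' (B' h) h = 0"
    and D_even: "\<And>h. D (- h) = D h" and D_cont: "continuous_on UNIV D"
    and rel: "\<And>h. h \<noteq> 0 \<Longrightarrow> \<exists>\<sigma>\<in>{1, -1}.
       D h + sqrt (g h h) *\<^sub>R B h - (\<sigma> * sqrt (g' h h)) *\<^sub>R B' h \<in> span {h}"
begin

lemma lin_g: "linear (g h)" "linear (\<lambda>k. g k h)" "linear (g' h)" "linear (\<lambda>k. g' k h)"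
  using bil by (auto simp: bilinear_def)

lemma nonneg: "0 \<le> g h h" "0 \<le> g' h h"
  using pos[of h] bilinear_lzero[OF bil(1), of 0] bilinear_lzero[OF bil(2), of 0]
  by (cases "h = 0"; simp add: less_imp_le)+

text \<open>Compare the relation at \<open>h\<close> and at \<open>- h\<close>. If the signs agree then \<open>D h\<close> and the difference of
  the magnetic terms are parallel to \<open>h\<close> separately; if they differ then \<open>B h\<close> is parallel to \<open>h\<close>,
  which skew symmetry excludes unless \<open>B h = 0\<close>.\<close>

lemma generic_direction:
  assumes Bh: "B h \<noteq> 0"
  shows "D h \<in> span {h}"
    "\<exists>\<sigma>\<in>{1, -1}. sqrt (g h h) *\<^sub>R B h - (\<sigma> * sqrt (g' h h)) *\<^sub>R B' h \<in> span {h}"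
proof -
  have h: "h \<noteq> 0" using Bh linear_0[OF lin(1)] by auto
  define u where "u = sqrt (g h h) *\<^sub>R B h"
  define w where "w = sqrt (g' h h) *\<^sub>R B' h"
  obtain s where s: "s \<in> {1, -1}" "D h + u - s *\<^sub>R w \<in> span {h}"
    using rel[OF h] unfolding u_def w_def scaleR_scaleR by blast
  have m: "g (- h) (- h) = g h h" "g' (- h) (- h) = g' h h"
    using bil by (simp_all add: bilinear_lneg bilinear_rneg)
  obtain s' where s': "s' \<in> {1, -1}" "D (- h) + sqrt (g (- h) (- h)) *\<^sub>R B (- h)
      - (s' * sqrt (g' (- h) (- h))) *\<^sub>R B' (- h) \<in> span {- h}"
    using rel[of "- h"] h by (metis neg_equal_0_iff_equal)
  from s'(2) have "D h - u + s' *\<^sub>R w \<in> span {- h}"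
    by (simp add: m D_even linear_neg[OF lin(1)] linear_neg[OF lin(2)] u_def w_def)
  then obtain r where "D h - u + s' *\<^sub>R w = r *\<^sub>R (- h)" by (auto simp: span_singleton)
  then have "D h - u + s' *\<^sub>R w = (- r) *\<^sub>R h" by simp
  then have s'h: "D h - u + s' *\<^sub>R w \<in> span {h}" by (metis span_base span_scale singletonI)
  have "s = s'"
  proof (rule ccontr)
    assume "s \<noteq> s'"
    then have "s' = - s" using s s' by auto
    then have "(D h + u - s *\<^sub>R w) - (D h - u + s' *\<^sub>R w) = 2 *\<^sub>R u" by (simp add: scaleR_2)
    then have "2 *\<^sub>R u \<in> span {h}" using span_diff[OF s(2) s'h] by simp
    then have "(1 / (2 * sqrt (g h h))) *\<^sub>R (2 *\<^sub>R u) \<in> span {h}" by (rule span_scale)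
    then have "B h \<in> span {h}" using pos(1)[OF h] by (simp add: u_def)
    then obtain r where r: "B h = r *\<^sub>R h" by (auto simp: span_singleton)
    have "r * g h h = 0" using skew(1)[of h] by (simp add: r linear_cmul[OF lin_g(2)])
    then show False using pos(1)[OF h] r Bh by simp
  qed
  have "(D h + u - s *\<^sub>R w) + (D h - u + s' *\<^sub>R w) = 2 *\<^sub>R D h" using \<open>s = s'\<close> by (simp add: scaleR_2)
  then have "2 *\<^sub>R D h \<in> span {h}" using span_add[OF s(2) s'h] by simp
  then have "(1/2) *\<^sub>R (2 *\<^sub>R D h) \<in> span {h}" by (rule span_scale)
  then show Dh: "D h \<in> span {h}" by simp
  have "(D h + u - s *\<^sub>R w) - D h \<in> span {h}" by (rule span_diff[OF s(2) Dh])
  then have "u - s *\<^sub>R w \<in> span {h}" by (simp add: algebra_simps)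
  then show "\<exists>\<sigma>\<in>{1, -1}. sqrt (g h h) *\<^sub>R B h - (\<sigma> * sqrt (g' h h)) *\<^sub>R B' h \<in> span {h}"
    using s(1) by (auto simp: u_def w_def)
qed

lemma D_parallel:
  assumes k: "B k \<noteq> 0" and h: "h \<noteq> 0"
  shows "D h \<in> span {h}"
proof -
  have "g h h *\<^sub>R D h - g h (D h) *\<^sub>R h = 0"
  proof (rule zero_where_linear_nonzero[OF lin(1) k, of "\<lambda>h. g h h *\<^sub>R D h - g h (D h) *\<^sub>R h"])
    show "continuous_on UNIV (\<lambda>h. g h h *\<^sub>R D h - g h (D h) *\<^sub>R h)"
      by (intro continuous_intros continuous_on_bilinear_compose[OF bil(1)] D_cont)
    fix h assume "B h \<noteq> 0"
    then obtain r where "D h = r *\<^sub>R h" using generic_direction(1) by (auto simp: span_singleton)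
    then show "g h h *\<^sub>R D h - g h (D h) *\<^sub>R h = 0" by (simp add: linear_cmul[OF lin_g(1)])
  qed
  then have "(1 / g h h) *\<^sub>R (g h h *\<^sub>R D h) = (1 / g h h) *\<^sub>R (g h (D h) *\<^sub>R h)" by simp
  then have "D h = (1 / g h h) *\<^sub>R (g h (D h) *\<^sub>R h)" using pos(1)[OF h] by simp
  then show ?thesis by (metis span_base span_scale singletonI)
qed

text \<open>Squaring removes the sign, which may jump from one direction to another, and leaves an identity of
  continuous functions that extends from the dense set where \<open>B h\<close> is not zero.\<close>

lemma wedge_square:
  assumes k: "B k \<noteq> 0" and e: "linear e" and f: "linear f"
  shows "g h h * (wedge e f (B h) h)\<^sup>2 = g' h h * (wedge e f (B' h) h)\<^sup>2"
proof -
  have c: "continuous_on S e" "continuous_on S f" "continuous_on S B" "continuous_on S B'" for S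
    using e f lin linear_continuous_on linear_conv_bounded_linear by blast+
  have cc: "continuous_on UNIV (\<lambda>h. e (B h))" "continuous_on UNIV (\<lambda>h. f (B h))"
     "continuous_on UNIV (\<lambda>h. e (B' h))" "continuous_on UNIV (\<lambda>h. f (B' h))"
    using continuous_on_compose2[OF c(1)[of UNIV] c(3)] continuous_on_compose2[OF c(2)[of UNIV] c(3)]
      continuous_on_compose2[OF c(1)[of UNIV] c(4)] continuous_on_compose2[OF c(2)[of UNIV] c(4)]
    by simp_all
  have "g h h * (wedge e f (B h) h)\<^sup>2 - g' h h * (wedge e f (B' h) h)\<^sup>2 = 0"
  proof (rule zero_where_linear_nonzero[OF lin(1) k, of "\<lambda>h. g h h * (wedge e f (B h) h)\<^sup>2 - g' h h * (wedge e f (B' h) h)\<^sup>2"])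
    show "continuous_on UNIV (\<lambda>h. g h h * (wedge e f (B h) h)\<^sup>2 - g' h h * (wedge e f (B' h) h)\<^sup>2)"
      unfolding wedge_def
      by (intro continuous_intros continuous_on_bilinear_compose[OF bil(1)] continuous_on_bilinear_compose[OF bil(2)] c cc)
    fix h assume "B h \<noteq> 0"
    then obtain s where s: "s \<in> {1, -1}"
      "sqrt (g h h) *\<^sub>R B h - (s * sqrt (g' h h)) *\<^sub>R B' h \<in> span {h}"
      using generic_direction(2) by blast
    have "sqrt (g h h) * wedge e f (B h) h - s * sqrt (g' h h) * wedge e f (B' h) h
      = wedge e f (sqrt (g h h) *\<^sub>R B h - (s * sqrt (g' h h)) *\<^sub>R B' h) h"
      by (simp add: wedge_def linear_diff[OF e] linear_cmul[OF e] linear_diff[OF f] linear_cmul[OF f] algebra_simps)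
    also have "\<dots> = 0" by (rule wedge_span[OF e f s(2)])
    finally have "sqrt (g h h) * wedge e f (B h) h = s * sqrt (g' h h) * wedge e f (B' h) h" by simp
    then have "(sqrt (g h h) * wedge e f (B h) h)\<^sup>2 = (s * sqrt (g' h h) * wedge e f (B' h) h)\<^sup>2" by simp
    then show "g h h * (wedge e f (B h) h)\<^sup>2 - g' h h * (wedge e f (B' h) h)\<^sup>2 = 0"
      using nonneg s(1) by (auto simp: power_mult_distrib)
  qed
  then show ?thesis by simp
qed

text \<open>On a line \<open>p + t q\<close> the relation of the previous lemma is an identity of polynomials in \<open>t\<close>, with
  squares multiplied by the quadratics \<open>g\<close> and \<open>g'\<close>.\<close>

lemma metrics_proportional:
  assumes p: "B p \<noteq> 0"
  shows "g h k = (g p p / g' p p) * g' h k"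
proof -
  have p0: "p \<noteq> 0" using p linear_0[OF lin(1)] by auto
  have diag: "g q q = (g p p / g' p p) * g' q q" for q
  proof (cases "\<exists>r. q = r *\<^sub>R p")
    case True
    then show ?thesis using pos(2)[OF p0]
      by (auto simp: linear_cmul[OF lin_g(1)] linear_cmul[OF lin_g(2)] linear_cmul[OF lin_g(3)] linear_cmul[OF lin_g(4)])
  next
    case False
    then have q0: "q \<noteq> 0" by (metis scaleR_zero_left)
    have line: "p + t *\<^sub>R q \<noteq> 0" for t
    proof
      assume *: "p + t *\<^sub>R q = 0"
      then have "t \<noteq> 0" using p0 by auto
      have "q = (1 / t) *\<^sub>R (t *\<^sub>R q)" using \<open>t \<noteq> 0\<close> by simp
      also have "t *\<^sub>R q = - p" using * by (simp add: add_eq_0_iff)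
      finally have "q = (- (1 / t)) *\<^sub>R p" by simp
      then show False using False by blast
    qed
    define e where "e v = g (B p) v" for v
    define f where "f v = g p v" for v
    have ef: "linear e" "linear f" unfolding e_def f_def by (rule lin_g)+
    let ?c = complex_of_real
    define l where "l e A = [:?c (e (A p)), ?c (e (A q)):]" for e :: "'e \<Rightarrow> real" and A :: "'e \<Rightarrow> 'e"
    define W where "W A = l e A * l f (\<lambda>x. x) - l f A * l e (\<lambda>x. x)" for A
    have l: "poly (l e A) (?c t) = ?c (e (A (p + t *\<^sub>R q)))" if "linear e" "linear A" for e A t
      using that by (simp add: l_def linear_simps[OF that(2)] linear_simps[OF that(1)])
    have W: "poly (W A) (?c t) = ?c (wedge e f (A (p + t *\<^sub>R q)) (p + t *\<^sub>R q))" if "linear A" for A t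
      by (simp add: W_def l ef that linear_ident wedge_def)
    have quad: "poly [:?c (g p p), ?c (2 * g p q), ?c (g q q):] (?c t) = ?c (g (p + t *\<^sub>R q) (p + t *\<^sub>R q))"
       "g (p + t *\<^sub>R q) (p + t *\<^sub>R q) = g p p + 2 * g p q * t + g q q * t\<^sup>2" for t
      using sym(1)[of q p] by (simp_all add: linear_simps[OF lin_g(1)] linear_simps[OF lin_g(2)]
         algebra_simps power2_eq_square)
    have quad': "poly [:?c (g' p p), ?c (2 * g' p q), ?c (g' q q):] (?c t) = ?c (g' (p + t *\<^sub>R q) (p + t *\<^sub>R q))" for t
      using sym(2)[of q p] by (simp add: linear_simps[OF lin_g(3)] linear_simps[OF lin_g(4)]
         algebra_simps power2_eq_square)
    have "[:?c (g p p), ?c (2 * g p q), ?c (g q q):] * (W B)\<^sup>2 = [:?c (g' p p), ?c (2 * g' p q), ?c (g' q q):] * (W B')\<^sup>2"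
      by (rule poly_eq_on_reals, unfold poly_mult poly_power quad(1) quad' W[OF lin(1)] W[OF lin(2)] 
          of_real_mult[symmetric] of_real_power[symmetric] wedge_square[OF p ef]) (rule refl)
    moreover have "W B \<noteq> 0"
    proof
      assume "W B = 0"
      then have "wedge e f (B p) p = 0" using W[OF lin(1), of 0] by simp
      moreover have "wedge e f (B p) p = g (B p) (B p) * g p p"
        by (simp add: wedge_def e_def f_def skew sym(1)[of p "B p"])
      ultimately show False using pos(1)[OF p] pos(1)[OF p0] by simp
    qed
    moreover have "g p p + 2 * g p q * t + g q q * t\<^sup>2 > 0" for t
      using pos(1)[OF line[of t]] quad(2)[of t] by simp
    ultimately have "g' p p * g q q = g p p * g' q q"
      using pos(1)[OF q0] by (intro quadratics_with_square_ratio)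
    then show ?thesis using pos(2)[OF p0] by (simp add: field_simps)
  qed
  show ?thesis
    unfolding sym_bilinear_polarization[OF bil(1) sym(1), of h k] sym_bilinear_polarization[OF bil(2) sym(2), of h k]
      diag[of h] diag[of k] diag[of "h + k"]
    using pos(2)[OF p0] by (simp add: field_simps)
qed

text \<open>Once the metrics are proportional, both operators are skew with respect to the same inner product.
  Equality modulo \<open>h\<close> is then equality, and each \<open>h\<close> lies in one of two subspaces. A vector space is not
  the union of two proper subspaces, so one sign serves all \<open>h\<close>.\<close>

lemma magnetic_terms_proportional:
  assumes p: "B p \<noteq> 0" and c: "c > 0" and cg: "\<And>h k. g h k = c\<^sup>2 * g' h k"
  shows "(\<forall>h. c *\<^sub>R B h = B' h) \<or> (\<forall>h. c *\<^sub>R B h = - B' h)"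
proof -
  have each: "c *\<^sub>R B h = B' h \<or> c *\<^sub>R B h = - B' h" for h
  proof (cases "B h = 0")
    case True
    have "B' h = 0"
    proof (cases "h = 0")
      case h: False
      have "g' h h * (wedge (g' (B' h)) (g' h) (B' h) h)\<^sup>2 = 0"
        using wedge_square[OF p lin_g(3) lin_g(3), of h "B' h" h] True
        by (simp add: wedge_def bilinear_rzero[OF bil(2)])
      moreover have "wedge (g' (B' h)) (g' h) (B' h) h = g' (B' h) (B' h) * g' h h"
        by (simp add: wedge_def skew sym(2)[of h "B' h"])
      ultimately show ?thesis using pos(2)[OF h] pos(2)[of "B' h"] by force
    qed (simp add: linear_0[OF lin(2)])
    then show ?thesis using True by simp
  next
    case False
    then have h: "h \<noteq> 0" using linear_0[OF lin(1)] by auto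
    obtain s where s: "s \<in> {1, -1}" "sqrt (g h h) *\<^sub>R B h - (s * sqrt (g' h h)) *\<^sub>R B' h \<in> span {h}"
      using generic_direction(2)[OF False] by blast
    have n: "sqrt (g h h) = c * sqrt (g' h h)" using c by (simp add: cg real_sqrt_mult)
    have n0: "sqrt (g' h h) > 0" using pos(2)[OF h] by simp
    obtain r where r: "sqrt (g h h) *\<^sub>R B h - (s * sqrt (g' h h)) *\<^sub>R B' h = r *\<^sub>R h"
      using s(2) by (auto simp: span_singleton)
    have "r * g' h h = g' (sqrt (g h h) *\<^sub>R B h - (s * sqrt (g' h h)) *\<^sub>R B' h) h"
      by (simp add: r linear_cmul[OF lin_g(4)])
    also have "\<dots> = 0"
      using skew(1)[of h] skew(2)[of h] c by (simp add: linear_diff[OF lin_g(4)] linear_cmul[OF lin_g(4)] cg)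
    finally have "r = 0" using pos(2)[OF h] by simp
    then have "sqrt (g' h h) *\<^sub>R (c *\<^sub>R B h - s *\<^sub>R B' h) = 0"
      using r by (simp add: n scaleR_right_diff_distrib mult.commute)
    then have "c *\<^sub>R B h = s *\<^sub>R B' h" using n0 by simp
    then show ?thesis using s(1) by auto
  qed
  show ?thesis
  proof (rule ccontr)
    assume "\<not> ?thesis"
    then obtain x y where xy: "c *\<^sub>R B x \<noteq> B' x" "c *\<^sub>R B y \<noteq> - B' y" by blast
    then have "c *\<^sub>R B x = - B' x" "c *\<^sub>R B y = B' y" using each by blast+
    moreover have "c *\<^sub>R B (x + y) = c *\<^sub>R B x + c *\<^sub>R B y" "B' (x + y) = B' x + B' y"
      by (simp_all add: linear_add[OF lin(1)] linear_add[OF lin(2)] scaleR_add_right)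
    ultimately have "- B' x + B' y = B' x + B' y \<or> - B' x + B' y = - B' x - B' y"
      using each[of "x + y"] by simp
    then have "B' x + B' x = 0 \<or> B' y + B' y = 0" by (auto simp: algebra_simps)
    then have "B' x = 0 \<or> B' y = 0" by (simp add: scaleR_2[symmetric])
    with xy \<open>c *\<^sub>R B x = - B' x\<close> \<open>c *\<^sub>R B y = B' y\<close> show False by auto
  qed
qed

lemma proportional:
  assumes p: "B p \<noteq> 0"
  obtains c where "c > 0" "\<And>h k. g h k = c\<^sup>2 * g' h k"
    "(\<forall>h. c *\<^sub>R B h = B' h) \<or> (\<forall>h. c *\<^sub>R B h = - B' h)" "B' p \<noteq> 0"
proof -
  have p0: "p \<noteq> 0" using p linear_0[OF lin(1)] by auto
  define c where "c = sqrt (g p p / g' p p)"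
  have c: "c > 0" "c\<^sup>2 = g p p / g' p p" using pos(1)[OF p0] pos(2)[OF p0] by (simp_all add: c_def)
  have cg: "g h k = c\<^sup>2 * g' h k" for h k
    unfolding c(2) by (rule metrics_proportional[OF p])
  note B = magnetic_terms_proportional[OF p c(1) cg]
  have "B' p \<noteq> 0" using B p c(1) by (metis neg_equal_0_iff_equal order_less_irrefl scaleR_eq_0_iff)
  with that c(1) cg B show thesis by blast
qed

end

text \<open>If \<open>B\<close> vanishes, then so does \<open>B'\<close> by symmetry, and the relation reads \<open>D h \<in> span {h}\<close>.\<close>

lemma inner_pair_dichotomy:
  assumes 1: "inner_pair g g' B B' D" and 2: "inner_pair g' g B' B (\<lambda>h. - D h)" and h: "h \<noteq> 0"
  shows "D h \<in> span {h}" "(\<exists>k. B' k \<noteq> 0) \<Longrightarrow> (\<exists>k. B k \<noteq> 0)"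
proof -
  show B: "(\<exists>k. B' k \<noteq> 0) \<Longrightarrow> (\<exists>k. B k \<noteq> 0)"
    using inner_pair.proportional[OF 2] by metis
  show "D h \<in> span {h}"
  proof (cases "\<exists>k. B k \<noteq> 0")
    case True
    then show ?thesis using inner_pair.D_parallel[OF 1 _ h] by blast
  next
    case False
    then have "B h = 0" "B' h = 0" using B by auto
    then show ?thesis using inner_pair.rel[OF 1 h] by auto
  qed
qed

section \<open>Projectively equivalent metrics\<close>

text \<open>Write \<open>D h h = r h *\<^sub>R h\<close>. For independent \<open>h\<close> and \<open>k\<close> the parallelogram identity of \<open>D\<close> at \<open>h + k\<close> and
  \<open>h - k\<close> shows that \<open>r\<close> is additive; for dependent vectors homogeneity is enough. Polarization gives the
  formula with \<open>\<psi> = r / 2\<close>.\<close>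

lemma parallel_bilinear_map:
  fixes D :: "'e::euclidean_space \<Rightarrow> 'e \<Rightarrow> 'e"
  assumes D: "bilinear D" and sym: "\<And>h k. D h k = D k h"
    and par: "\<And>h. h \<noteq> 0 \<Longrightarrow> D h h \<in> span {h}"
  obtains \<psi> where "linear \<psi>" "\<And>h k. D h k = \<psi> h *\<^sub>R k + \<psi> k *\<^sub>R h"
proof -
  define r where "r h = (D h h \<bullet> h) / (h \<bullet> h)" for h
  have r: "D h h = r h *\<^sub>R h" for h
  proof (cases "h = 0")
    case True
    then show ?thesis using bilinear_lzero[OF D] by simp
  next
    case False
    then obtain c where c: "D h h = c *\<^sub>R h" using par by (auto simp: span_singleton)
    then show ?thesis using False by (simp add: r_def)
  qed
  have r_scale: "r (c *\<^sub>R h) = c * r h" for c h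
    by (cases "c = 0") (simp_all add: r_def bilinear_lmul[OF D] bilinear_rmul[OF D])
  have r_add: "r (h + k) = r h + r k" for h k
  proof (cases "\<exists>a b. a *\<^sub>R h + b *\<^sub>R k = 0 \<and> (a \<noteq> 0 \<or> b \<noteq> 0)")
    case True
    then obtain a b where ab: "a *\<^sub>R h + b *\<^sub>R k = 0" "a \<noteq> 0 \<or> b \<noteq> 0" by blast
    consider c where "k = c *\<^sub>R h" | c where "h = c *\<^sub>R k"
    proof (cases "a = 0")
      case True
      then have "k = 0 *\<^sub>R h" using ab by simp
      then show ?thesis using that by blast
    next
      case False
      have "a *\<^sub>R h = (- b) *\<^sub>R k" using ab(1) by (simp add: add_eq_0_iff)
      then have "(1 / a) *\<^sub>R (a *\<^sub>R h) = (1 / a) *\<^sub>R ((- b) *\<^sub>R k)" by simp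
      then have "h = (1 / a * (- b)) *\<^sub>R k" using False by simp
      then show ?thesis using that by blast
    qed
    then show ?thesis
    proof cases
      case 1
      have "h + k = (1 + c) *\<^sub>R h" by (simp add: 1 scaleR_add_left)
      then show ?thesis unfolding 1 by (simp add: r_scale 1 distrib_right)
    next
      case 2
      have "h + k = (1 + c) *\<^sub>R k" by (simp add: 2 scaleR_add_left)
      then show ?thesis unfolding 2 by (simp add: r_scale 2 distrib_right)
    qed
  next
    case False
    have "D (h + k) (h + k) + D (h - k) (h - k) = 2 *\<^sub>R D h h + 2 *\<^sub>R D k k"
      by (simp add: bilinear_ladd[OF D] bilinear_radd[OF D] bilinear_lsub[OF D] bilinear_rsub[OF D] scaleR_2)
    then have "r (h + k) *\<^sub>R (h + k) + r (h - k) *\<^sub>R (h - k) = 2 *\<^sub>R (r h *\<^sub>R h) + 2 *\<^sub>R (r k *\<^sub>R k)"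
      unfolding r .
    then have "(r (h + k) + r (h - k) - 2 * r h) *\<^sub>R h + (r (h + k) - r (h - k) - 2 * r k) *\<^sub>R k = 0"
      by (simp add: algebra_simps)
    then have "r (h + k) + r (h - k) - 2 * r h = 0" "r (h + k) - r (h - k) - 2 * r k = 0"
      using False by blast+
    then show ?thesis by simp
  qed
  have "linear (\<lambda>h. r h / 2)" by (intro linearI) (simp_all add: r_add r_scale add_divide_distrib)
  moreover have "D h k = (r h / 2) *\<^sub>R k + (r k / 2) *\<^sub>R h" for h k
  proof -
    have "2 *\<^sub>R D h k = D (h + k) (h + k) - D h h - D k k"
      by (simp add: bilinear_ladd[OF D] bilinear_radd[OF D] sym[of k h] scaleR_2)
    also have "\<dots> = r h *\<^sub>R k + r k *\<^sub>R h" unfolding r r_add by (simp add: algebra_simps)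
    finally have "(1/2) *\<^sub>R (2 *\<^sub>R D h k) = (1/2) *\<^sub>R (r h *\<^sub>R k + r k *\<^sub>R h)" by simp
    then show ?thesis by (simp add: scaleR_add_right)
  qed
  ultimately show thesis by (rule that)
qed

text \<open>The Christoffel symbols of the second kind, as a bilinear map.\<close>

definition levi_civita ::
    "('e::euclidean_space \<Rightarrow> 'e \<Rightarrow> 'e \<Rightarrow> real) \<Rightarrow> 'e \<Rightarrow> 'e \<Rightarrow> 'e \<Rightarrow> 'e" where
  "levi_civita G u h k = (SOME a. \<forall>e. G u a e =
     (metric_deriv G u h k e + metric_deriv G u k h e - metric_deriv G u e h k) / 2)"

context local_metric begin

lemma levi_civita:
  assumes u: "u \<in> U"
  shows "G u (levi_civita G u h k) e =
     (metric_deriv G u h k e + metric_deriv G u k h e - metric_deriv G u e h k) / 2"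
proof -
  note m = linear_metric_deriv[OF u]
  have "linear (\<lambda>e. (metric_deriv G u h k e + metric_deriv G u k h e - metric_deriv G u e h k) / 2)"
    by (intro linearI) (simp_all add: linear_simps[OF m(1)] linear_simps[OF m(3)]
        algebra_simps add_divide_distrib diff_divide_distrib)
  from riesz_bilinear[OF bilinear_G[OF u] G_pos[OF u] this]
  have "\<exists>a. \<forall>e. G u a e = (metric_deriv G u h k e + metric_deriv G u k h e - metric_deriv G u e h k) / 2"
    by metis
  from someI_ex[OF this] show ?thesis unfolding levi_civita_def by blast
qed

lemma G_eqI:
  assumes u: "u \<in> U" and eq: "\<And>e. G u a e = G u b e" shows "a = b"
proof (rule ccontr)
  assume "a \<noteq> b"
  then have "G u (a - b) (a - b) > 0" using G_pos[OF u] by simp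
  moreover have "G u (a - b) (a - b) = G u a (a - b) - G u b (a - b)"
    by (rule linear_diff[OF G_linear(2)[OF u]])
  ultimately show False using eq by simp
qed

lemma bilinear_levi_civita: assumes u: "u \<in> U" shows "bilinear (levi_civita G u)"
proof -
  note m = linear_metric_deriv[OF u]
  note s = linear_simps[OF m(1)] linear_simps[OF m(2)] 
    linear_simps[OF m(3)] linear_simps[OF G_linear(2)[OF u]]
  show ?thesis unfolding bilinear_def
    by (intro conjI allI linearI; rule G_eqI[OF u]; simp add: s levi_civita[OF u] field_simps)
qed

lemma levi_civita_sym: assumes u: "u \<in> U" shows "levi_civita G u h k = levi_civita G u k h"
  by (rule G_eqI[OF u]) (simp add: levi_civita[OF u] metric_deriv_sym[OF u, of _ h k])

lemma G_levi_civita_same: "u \<in> U \<Longrightarrow> G u (levi_civita G u h h) e = christoffel G u h e"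
  by (simp add: levi_civita christoffel_def diff_divide_distrib)

text \<open>The metric is parallel for its connection.\<close>

lemma metric_deriv_levi_civita:
  assumes u: "u \<in> U"
  shows "metric_deriv G u k h l = G u (levi_civita G u k h) l + G u (levi_civita G u k l) h"
  by (simp add: levi_civita[OF u] metric_deriv_sym[OF u, of k h l] metric_deriv_sym[OF u, of h k l]
     metric_deriv_sym[OF u, of l k h] field_simps)

lemma levi_civita_bounded_on_compact:
  assumes K: "compact K" "K \<subseteq> U"
  obtains C where "C \<ge> 0" "\<And>u h. u \<in> K \<Longrightarrow> norm (levi_civita G u h h) \<le> C * (norm h)\<^sup>2"
proof (cases "K = {}")
  case True
  then show ?thesis using that[of 0] by auto
next
  case K0: False
  obtain m where m: "m > 0" "\<And>u h. u \<in> K \<Longrightarrow> G u h h \<ge> m * (norm h)\<^sup>2"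
    using coercive_on_compact[OF K] by metis
  let ?S = "K \<times> sphere (0::'e) 1"
  have S: "compact ?S" using K by (auto intro!: compact_Times)
  have "continuous_on ?S (\<lambda>z. \<Sum>i\<in>Basis. \<bar>christoffel G (fst z) (snd z) i\<bar>)"
    using K(2) by (intro christoffel_continuous continuous_intros) auto
  then have "bounded ((\<lambda>z. \<Sum>i\<in>Basis. \<bar>christoffel G (fst z) (snd z) i\<bar>) ` ?S)"
    using S compact_continuous_image compact_imp_bounded by blast
  then obtain M where M: "M > 0" "\<forall>y\<in>(\<lambda>z. \<Sum>i\<in>Basis. \<bar>christoffel G (fst z) (snd z) i\<bar>) ` ?S. norm y \<le> M"
    unfolding bounded_pos by blast
  have unit: "norm (levi_civita G u h h) \<le> M / m" if u: "u \<in> K" and h: "norm h = 1" for u h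
  proof -
    have uU: "u \<in> U" using u K by auto
    let ?a = "levi_civita G u h h"
    have "m * (norm ?a)\<^sup>2 \<le> G u ?a ?a" by (rule m(2)[OF u])
    also have "G u ?a ?a = christoffel G u h ?a" by (rule G_levi_civita_same[OF uU])
    also have "\<dots> \<le> norm ?a * (\<Sum>i\<in>Basis. \<bar>christoffel G u h i\<bar>)"
      using linear_real_bound[OF linear_christoffel[OF uU], of h ?a] by linarith
    also have "\<dots> \<le> norm ?a * M"
      using bspec[OF M(2) imageI[of "(u, h)"]] u h by (intro mult_left_mono) auto
    finally have *: "m * (norm ?a)\<^sup>2 \<le> norm ?a * M" .
    show ?thesis
    proof (cases "?a = 0")
      case False
      then have "norm ?a > 0" by simp
      moreover have "norm ?a * (m * norm ?a) \<le> norm ?a * M" using * by (simp add: power2_eq_square mult_ac)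
      ultimately have "m * norm ?a \<le> M" by (simp add: mult_le_cancel_left_pos)
      then show ?thesis using m(1) by (simp add: field_simps)
    qed (use M m(1) in simp)
  qed
  show ?thesis
  proof (rule that[of "M / m"])
    fix u h assume u: "u \<in> K"
    then have uU: "u \<in> U" using K by auto
    note b = bilinear_levi_civita[OF uU]
    show "norm (levi_civita G u h h) \<le> M / m * (norm h)\<^sup>2"
    proof (cases "h = 0")
      case True
      then show ?thesis using bilinear_lzero[OF b] by simp
    next
      case False
      define k where "k = h /\<^sub>R norm h"
      have k: "norm k = 1" "h = norm h *\<^sub>R k" using False by (simp_all add: k_def)
      have "levi_civita G u h h = levi_civita G u (norm h *\<^sub>R k) (norm h *\<^sub>R k)" using k(2) by simp
      also have "\<dots> = (norm h)\<^sup>2 *\<^sub>R levi_civita G u k k"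
        by (simp add: bilinear_lmul[OF b] bilinear_rmul[OF b] power2_eq_square)
      finally have "norm (levi_civita G u h h) = (norm h)\<^sup>2 * norm (levi_civita G u k k)" by simp
      also have "\<dots> \<le> (norm h)\<^sup>2 * (M / m)" by (intro mult_left_mono unit u k) auto
      finally show ?thesis by (simp add: mult.commute)
    qed
  qed (use M m(1) in simp)
qed

end

subsection \<open>The derivative of the determinant\<close>

text \<open>The standard basis of the model space as a finite type, to index Gram matrices.\<close>

typedef (overloaded) ('e::euclidean_space) basis_index = "Basis :: 'e set"
  using nonempty_Basis by blast

instance basis_index :: (euclidean_space) finite
proof
  have "(UNIV :: 'a basis_index set) = Abs_basis_index ` Basis"
    by (rule type_definition.Abs_image[OF type_definition_basis_index, symmetric])
  then show "finite (UNIV :: 'a basis_index set)" by (metis finite_Basis finite_imageI)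
qed

abbreviation basis_vec :: "'e::euclidean_space basis_index \<Rightarrow> 'e" where
  "basis_vec \<equiv> Rep_basis_index"

lemma sum_basis_vec: "(\<Sum>i\<in>UNIV. f (basis_vec i)) = (\<Sum>b\<in>(Basis :: 'e::euclidean_space set). f b)"
proof -
  have "bij_betw basis_vec UNIV (Basis :: 'e set)"
    using type_definition.Rep_range[OF type_definition_basis_index]
      type_definition.Rep_inject[OF type_definition_basis_index]
    unfolding bij_betw_def inj_on_def by blast
  then show ?thesis by (rule sum.reindex_bij_betw)
qed

text \<open>A permutation other than the identity moves at least two indices, so its product in the Leibniz
  formula contains two factors that vanish at the unit matrix.\<close>

lemma has_derivative_det_at_identity:
  fixes N :: "'a::real_normed_vector \<Rightarrow> real^'n^'n"
  assumes N: "\<And>i j. ((\<lambda>v. N v $ i $ j) has_derivative N' i j) (at u)" and id: "N u = mat 1"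
  shows "((\<lambda>v. det (N v)) has_derivative (\<lambda>k. \<Sum>i\<in>UNIV. N' i i k)) (at u)"
proof -
  let ?P = "{p. p permutes (UNIV :: 'n set)}"
  have fin: "finite ?P" by simp
  have der: "((\<lambda>v. det (N v)) has_derivative
     (\<lambda>k. \<Sum>p\<in>?P. of_int (sign p) * (\<Sum>i\<in>UNIV. N' i (p i) k * (\<Prod>j\<in>UNIV - {i}. N u $ j $ p j)))) (at u)"
    unfolding det_def
    by (intro has_derivative_sum has_derivative_mult_right has_derivative_prod N)
  have summand: "of_int (sign p) * (\<Sum>i\<in>UNIV. N' i (p i) k * (\<Prod>j\<in>UNIV - {i}. N u $ j $ p j))
      = (if p = id then \<Sum>i\<in>UNIV. N' i i k else 0)" if p: "p \<in> ?P" for p k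
  proof (cases "p = id")
    case True
    then show ?thesis by (simp add: id mat_def)
  next
    case False
    have "(\<Prod>j\<in>UNIV - {i}. N u $ j $ p j) = 0" for i
    proof -
      obtain a where a: "p a \<noteq> a" using False by (auto simp: fun_eq_iff)
      have inj: "inj p" using p permutes_inj by auto
      have "p (p a) \<noteq> p a" using a inj by (auto dest: injD)
      then obtain j where "j \<noteq> i" "p j \<noteq> j" using a by (cases "a = i") auto
      then show ?thesis by (intro prod_zero) (auto simp: id mat_def intro!: bexI[of _ j])
    qed
    then show ?thesis by (simp only: mult_zero_right sum.neutral_const False if_False)
  qed
  have "(\<Sum>p\<in>?P. of_int (sign p) * (\<Sum>i\<in>UNIV. N' i (p i) k * (\<Prod>j\<in>UNIV - {i}. N u $ j $ p j)))
     = (\<Sum>i\<in>UNIV. N' i i k)" for k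
  proof -
    have "(\<Sum>p\<in>?P. of_int (sign p) * (\<Sum>i\<in>UNIV. N' i (p i) k * (\<Prod>j\<in>UNIV - {i}. N u $ j $ p j)))
       = (\<Sum>p\<in>?P. if p = id then \<Sum>i\<in>UNIV. N' i i k else 0)" by (rule sum.cong) (simp_all add: summand)
    also have "\<dots> = (\<Sum>i\<in>UNIV. N' i i k)" by (simp add: sum.delta[OF fin] permutes_id)
    finally show ?thesis .
  qed
  with der show ?thesis by simp
qed

context local_metric begin

definition gram :: "'e \<Rightarrow> real^('e basis_index)^('e basis_index)" where
  "gram v = (\<chi> i j. G v (basis_vec i) (basis_vec j))"

lemma gram_invertible: assumes v: "v \<in> U" shows "invertible (gram v)"
proof -
  have "x = 0" if x: "gram v *v x = 0" for x
  proof -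
    define h where "h = (\<Sum>j\<in>UNIV. x $ j *\<^sub>R basis_vec j)"
    have "G v (basis_vec i) h = (gram v *v x) $ i" for i
      by (simp add: h_def matrix_vector_mult_def gram_def linear_sum[OF G_linear(1)[OF v]]
          linear_cmul[OF G_linear(1)[OF v]] mult.commute)
    then have *: "G v (basis_vec i) h = 0" for i by (simp add: x)
    have "G v h h = (\<Sum>i\<in>UNIV. x $ i * G v (basis_vec i) h)"
      by (subst h_def) (simp add: linear_sum[OF G_linear(2)[OF v]] linear_cmul[OF G_linear(2)[OF v]])
    then have "G v h h = 0" by (simp add: *)
    then have h0: "h = 0" using G_pos[OF v, of h] by force
    have "x $ i = h \<bullet> basis_vec i" for i
    proof -
      have b: "basis_vec j \<bullet> basis_vec i = (if j = i then 1 else 0)" for j :: "'e basis_index"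
        using Rep_basis_index[of i] Rep_basis_index[of j] by (simp add: inner_Basis Rep_basis_index_inject)
      have "h \<bullet> basis_vec i = (\<Sum>j\<in>UNIV. if j = i then x $ j else 0)"
        unfolding h_def inner_sum_left inner_scaleR_left b by (intro sum.cong) auto
      then show ?thesis by simp
    qed
    then show ?thesis by (simp add: h0 vec_eq_iff)
  qed
  then show ?thesis unfolding invertible_left_inverse matrix_left_invertible_ker by blast
qed

text \<open>Jacobi's formula, reduced to the derivative at the unit matrix by multiplying with the inverse of the
  Gram matrix at \<open>u\<close>. Compatibility of the metric with its connection writes the derivative of the Gram
  matrix as \<open>A ** M + M ** transpose A\<close>. Squaring the determinant makes its logarithm independent of
  the sign.\<close>

lemma log_det_gram_has_derivative:
  assumes u: "u \<in> U"
  shows "((\<lambda>v. ln ((det (gram v))\<^sup>2)) has_derivative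
      (\<lambda>k. 4 * (\<Sum>b\<in>Basis. levi_civita G u k b \<bullet> b))) (at u)"
proof -
  obtain J where J: "J ** gram u = mat 1" "gram u ** J = mat 1"
    using gram_invertible[OF u] unfolding invertible_def by blast
  have d0: "det (gram u) \<noteq> 0" using gram_invertible[OF u] invertible_det_nz by blast
  define dM where "dM k = (\<chi> i j. metric_deriv G u k (basis_vec i) (basis_vec j))" for k
  define A where "A k = (\<chi> i m. levi_civita G u k (basis_vec i) \<bullet> basis_vec m)" for k :: 'e
  have dM: "dM k = A k ** gram u + gram u ** transpose (A k)" for k
  proof -
    have e: "G u (levi_civita G u k (basis_vec i)) l
        = (\<Sum>m\<in>UNIV. (levi_civita G u k (basis_vec i) \<bullet> basis_vec m) * G u (basis_vec m) l)" for i l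
      unfolding sum_basis_vec[of "\<lambda>b. (levi_civita G u k (basis_vec i) \<bullet> b) * G u b l"]
      by (rule linear_real_expand[OF G_linear(2)[OF u]])
    have e': "G u (levi_civita G u k (basis_vec j)) (basis_vec i)
        = (\<Sum>m\<in>UNIV. G u (basis_vec i) (basis_vec m) * (levi_civita G u k (basis_vec j) \<bullet> basis_vec m))" for i j
      unfolding e by (intro sum.cong refl) (metis G_sym[OF u] mult.commute)
    show ?thesis
      unfolding vec_eq_iff dM_def A_def matrix_matrix_mult_def transpose_def gram_def
      by (simp add: metric_deriv_levi_civita[OF u]) (intro allI, simp only: e'[symmetric] e[symmetric])
  qed
  define N where "N v = J ** gram v" for v
  have "((\<lambda>v. N v $ i $ j) has_derivative (\<lambda>k. (J ** dM k) $ i $ j)) (at u)" for i j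
    unfolding N_def matrix_matrix_mult_def gram_def dM_def
    by (auto intro!: has_derivative_sum has_derivative_mult_right G_has_derivative[OF u])
  from has_derivative_det_at_identity[OF this]
  have "((\<lambda>v. det (N v)) has_derivative (\<lambda>k. trace (J ** dM k))) (at u)"
    by (simp add: N_def J trace_def)
  moreover have "trace (J ** dM k) = 2 * trace (A k)" for k
  proof -
    have "trace (J ** dM k) = trace (J ** (A k ** gram u)) + trace (J ** (gram u ** transpose (A k)))"
      by (simp add: dM matrix_add_ldistrib trace_add)
    also have "trace (J ** (A k ** gram u)) = trace (A k)"
      by (subst trace_mul_sym) (simp add: matrix_mul_assoc[symmetric] J)
    also have "trace (J ** (gram u ** transpose (A k))) = trace (transpose (A k))"
      by (simp add: matrix_mul_assoc J)
    also have "\<dots> = trace (A k)" by (simp add: trace_def transpose_def)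
    finally show ?thesis by simp
  qed
  moreover have "trace (A k) = (\<Sum>b\<in>Basis. levi_civita G u k b \<bullet> b)" for k
    by (simp add: trace_def A_def sum_basis_vec[of "\<lambda>b. levi_civita G u k b \<bullet> b"])
  ultimately have dN: "((\<lambda>v. det (N v)) has_derivative (\<lambda>k. 2 * (\<Sum>b\<in>Basis. levi_civita G u k b \<bullet> b))) (at u)"
    by simp
  have "det (gram v) = det (gram u) * det (N v)" for v
  proof -
    have "gram v = gram u ** N v" by (simp add: N_def matrix_mul_assoc J)
    then show ?thesis by (metis det_mul)
  qed
  then have split: "(\<lambda>v. ln ((det (gram v))\<^sup>2)) = (\<lambda>v. ln ((det (gram u) * det (N v))\<^sup>2))"
    by (intro ext arg_cong[where f = "\<lambda>x. ln (x\<^sup>2)"])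
  have N1: "det (N u) = 1" by (simp add: N_def J)
  have dd: "0 < det (gram u) * det (gram u)" using d0 not_real_square_gt_zero by blast
  have "((\<lambda>x. ln ((det (gram u) * x)\<^sup>2)) has_real_derivative 2) (at (det (N u)))"
    unfolding N1 using d0 dd
    by (auto intro!: derivative_eq_intros simp: power2_eq_square field_simps)
  from DERIV_compose_FDERIV[OF this dN] show ?thesis
    unfolding split by (rule has_derivative_eq_rhs) simp
qed

end

subsection \<open>Unique continuation of proportionality\<close>

text \<open>Equal unparametrized geodesics of \<open>G\<close> and \<open>G'\<close>, expressed by the difference of the connections.\<close>

locale projective_pair = M: local_metric U G + M': local_metric U G'
  for U :: "'e::euclidean_space set" and G G' :: "'e \<Rightarrow> 'e \<Rightarrow> 'e \<Rightarrow> real" +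
  assumes dim: "DIM('e) \<ge> 2"
    and par: "u \<in> U \<Longrightarrow> h \<noteq> 0 \<Longrightarrow> levi_civita G' u h h - levi_civita G u h h \<in> span {h}"
begin

definition weight :: "'e \<Rightarrow> 'e \<Rightarrow> real" where
  "weight u = (SOME \<psi>. linear \<psi> \<and>
     (\<forall>h k. levi_civita G' u h k - levi_civita G u h k = \<psi> h *\<^sub>R k + \<psi> k *\<^sub>R h))"

lemma weight:
  assumes u: "u \<in> U"
  shows "linear (weight u)"
    "levi_civita G' u h k = levi_civita G u h k + weight u h *\<^sub>R k + weight u k *\<^sub>R h"
proof -
  let ?D = "\<lambda>h k. levi_civita G' u h k - levi_civita G u h k"
  have b: "bilinear (levi_civita G u)" "bilinear (levi_civita G' u)"
    using M.bilinear_levi_civita[OF u] M'.bilinear_levi_civita[OF u] .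
  then have "bilinear ?D" unfolding bilinear_def by (auto intro: linear_compose_sub)
  moreover have "?D h k = ?D k h" for h k
    using M.levi_civita_sym[OF u, of h k] M'.levi_civita_sym[OF u, of h k] by simp
  moreover note par[OF u]
  ultimately obtain \<psi> where "linear \<psi>" "\<And>h k. ?D h k = \<psi> h *\<^sub>R k + \<psi> k *\<^sub>R h"
    using parallel_bilinear_map[of ?D] by metis
  then have ex: "\<exists>\<psi>. linear \<psi> \<and> (\<forall>h k. ?D h k = \<psi> h *\<^sub>R k + \<psi> k *\<^sub>R h)" by blast
  note w = someI_ex[OF ex, folded weight_def]
  show "linear (weight u)" using w by blast
  have "levi_civita G' u h k - levi_civita G u h k = weight u h *\<^sub>R k + weight u k *\<^sub>R h" using w by blast
  then show "levi_civita G' u h k = levi_civita G u h k + weight u h *\<^sub>R k + weight u k *\<^sub>R h"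
    by (simp add: algebra_simps)
qed

lemma trace_difference:
  assumes u: "u \<in> U"
  shows "(\<Sum>b\<in>Basis. levi_civita G' u k b \<bullet> b) = (\<Sum>b\<in>Basis. levi_civita G u k b \<bullet> b)
     + (real DIM('e) + 1) * weight u k"
proof -
  have "(\<Sum>b\<in>Basis. levi_civita G' u k b \<bullet> b)
     = (\<Sum>b\<in>Basis. levi_civita G u k b \<bullet> b + (weight u k + (k \<bullet> b) * weight u b))"
    by (intro sum.cong refl) (simp add: weight(2)[OF u] inner_add_left inner_Basis mult.commute)
  also have "\<dots> = (\<Sum>b\<in>Basis. levi_civita G u k b \<bullet> b) + (real DIM('e) * weight u k + weight u k)"
    by (simp add: sum.distrib linear_real_expand[OF weight(1)[OF u], of k, symmetric])
  finally show ?thesis by (simp add: algebra_simps)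
qed

text \<open>The power \<open>2 / (n + 1)\<close> of \<open>det G / det G'\<close>. By the trace formula its logarithm has the
  derivative \<open>- 4 weight\<close>, which is exactly what makes \<open>density * G'\<close> a Killing tensor of \<open>G\<close>.\<close>

definition density :: "'e \<Rightarrow> real" where
  "density v = exp ((ln ((det (M.gram v))\<^sup>2) - ln ((det (M'.gram v))\<^sup>2)) / (real DIM('e) + 1))"

lemma density_has_derivative:
  assumes u: "u \<in> U"
  shows "(density has_derivative (\<lambda>k. - 4 * weight u k * density u)) (at u)"
proof -
  let ?n = "real DIM('e) + 1"
  let ?f = "\<lambda>v. (ln ((det (M.gram v))\<^sup>2) - ln ((det (M'.gram v))\<^sup>2)) / ?n"
  have "((\<lambda>v. (ln ((det (M.gram v))\<^sup>2) - ln ((det (M'.gram v))\<^sup>2)) * (1 / ?n)) has_derivative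
     (\<lambda>k. (4 * (\<Sum>b\<in>Basis. levi_civita G u k b \<bullet> b) - 4 * (\<Sum>b\<in>Basis. levi_civita G' u k b \<bullet> b)) * (1 / ?n))) (at u)"
    by (intro has_derivative_mult_left has_derivative_diff M.log_det_gram_has_derivative[OF u]
        M'.log_det_gram_has_derivative[OF u])
  then have "(?f has_derivative (\<lambda>k. - 4 * weight u k)) (at u)"
    by (rule has_derivative_eq_rhs[THEN has_derivative_transform[rotated 2]])
       (auto simp: trace_difference[OF u] field_simps)
  from DERIV_compose_FDERIV[OF DERIV_exp this]
  show ?thesis by (simp add: density_def[abs_def])
qed

lemma density_pos: "density v > 0"
  by (simp add: density_def)

text \<open>This is where the dimension has to be at least two.\<close>

lemma ex_orthogonal:
  assumes u: "u \<in> U"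
  obtains h where "h \<noteq> 0" "G' u h k = 0"
proof -
  obtain h1 h2 :: 'e where h: "h1 \<in> Basis" "h2 \<in> Basis" "h1 \<noteq> h2"
  proof -
    have "\<not> card (Basis :: 'e set) \<le> 1" using dim by simp
    then show thesis using that by (auto simp: card_le_Suc0_iff_eq)
  qed
  define x where "x = G' u h2 k *\<^sub>R h1 - G' u h1 k *\<^sub>R h2"
  note l = M'.G_linear(2)[OF u, of k]
  have 0: "G' u x k = 0" by (simp add: x_def linear_diff[OF l] linear_cmul[OF l])
  show thesis
  proof (cases "x = 0")
    case False
    then show ?thesis using 0 that by blast
  next
    case True
    have "x \<bullet> h1 = G' u h2 k" using h by (simp add: x_def inner_diff_left inner_Basis)
    then have "G' u h2 k = 0" using True by simp
    then show ?thesis using that[of h2] h(2) nonzero_Basis by blast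
  qed
qed

text \<open>The derivative of the conformal factor along \<open>k\<close> can be read off from the values of the metrics
  on a vector orthogonal to \<open>k\<close> and on \<open>k\<close> itself. The results are \<open>- 2\<close> and \<open>- 4\<close> times the same
  quantity, so both vanish.\<close>

lemma conformal_factor_constant:
  assumes V: "open V" "connected V" "V \<subseteq> U"
    and conf: "\<And>v. v \<in> V \<Longrightarrow> \<exists>l. \<forall>h k. G v h k = l * G' v h k"
  shows "\<exists>l. \<forall>v\<in>V. (\<forall>h k. G v h k = l * G' v h k) \<and> weight v = (\<lambda>k. 0)"
proof -
  obtain e where e: "(e::'e) \<noteq> 0" using nonempty_Basis nonzero_Basis by blast
  define l where "l v = G v e e / G' v e e" for v
  have l: "G v h k = l v * G' v h k" if v: "v \<in> V" for v h k
  proof -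
    obtain m where m: "\<And>h k. G v h k = m * G' v h k" using conf[OF v] by blast
    have "G' v e e > 0" using M'.G_pos e v V by auto
    then have "l v = m" by (simp add: l_def m)
    then show ?thesis using m by simp
  qed
  have lpos: "l v > 0" if "v \<in> V" for v
    using M.G_pos[of v e] M'.G_pos[of v e] e that V by (auto simp: l_def)
  have key: "(l has_derivative (\<lambda>k. 0)) (at v) \<and> weight v = (\<lambda>k. 0)" if v: "v \<in> V" for v
  proof -
    have vU: "v \<in> U" using v V by auto
    have pe: "G' v e e > 0" using M'.G_pos e vU by auto
    have "l differentiable (at v)" unfolding l_def
      using differentiableI[OF M.G_has_derivative[OF vU]] differentiableI[OF M'.G_has_derivative[OF vU]] pe
      by (intro differentiable_divide) auto
    then obtain dl where dl: "(l has_derivative dl) (at v)" by (auto simp: differentiable_def)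
    have "((\<lambda>v. l v * G' v h m) has_derivative (\<lambda>k. l v * metric_deriv G' v k h m + dl k * G' v h m)) (at v)" for h m
      by (intro has_derivative_mult dl M'.G_has_derivative vU)
    then have "((\<lambda>v. G v h m) has_derivative (\<lambda>k. l v * metric_deriv G' v k h m + dl k * G' v h m)) (at v)" for h m
      by (rule has_derivative_transform_within_open[OF _ V(1) v]) (simp add: l)
    from has_derivative_unique[OF M.G_has_derivative[OF vU] this]
    have md: "metric_deriv G v k h m = l v * metric_deriv G' v k h m + dl k * G' v h m" for k h m by metis
    have rel: "dl k * G' v h h = - (2 * l v) * (weight v k * G' v h h + weight v h * G' v k h)" for k h
    proof -
      note lin = linear_simps[OF M'.G_linear(2)[OF vU]]
      have "metric_deriv G' v k h h = 2 * G' v (levi_civita G' v k h) h"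
        using M'.metric_deriv_levi_civita[OF vU, of k h h] by simp
      also have "\<dots> = 2 * (G' v (levi_civita G v k h) h + weight v k * G' v h h + weight v h * G' v k h)"
        by (simp add: weight(2)[OF vU] lin)
      finally have a: "metric_deriv G' v k h h = 2 * (G' v (levi_civita G v k h) h + weight v k * G' v h h + weight v h * G' v k h)" .
      have "metric_deriv G v k h h = 2 * (l v * G' v (levi_civita G v k h) h)"
        using M.metric_deriv_levi_civita[OF vU, of k h h] by (simp add: l[OF v])
      with md[of k h h] have "dl k * G' v h h = 2 * (l v * G' v (levi_civita G v k h) h) - l v * metric_deriv G' v k h h" by simp
      then show ?thesis unfolding a by (simp add: algebra_simps)
    qed
    have "dl k = 0 \<and> weight v k = 0" for k
    proof (cases "k = 0")
      case True
      then show ?thesis using linear_0[OF weight(1)[OF vU]] linear_0[OF has_derivative_linear[OF dl]] by simp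
    next
      case False
      then have pk: "G' v k k > 0" using M'.G_pos[OF vU] by simp
      obtain h where h: "h \<noteq> 0" "G' v h k = 0" by (rule ex_orthogonal[OF vU])
      have ph: "G' v h h > 0" using M'.G_pos[OF vU h(1)] .
      have "dl k * G' v h h = (- (2 * l v) * weight v k) * G' v h h"
        using rel[of k h] h(2) M'.G_sym[OF vU, of h k] by simp
      then have 1: "dl k = - (2 * l v) * weight v k" using ph by (metis mult_right_cancel less_irrefl)
      have "dl k * G' v k k = (- (4 * l v) * weight v k) * G' v k k" using rel[of k k] by (simp add: algebra_simps)
      then have 2: "dl k = - (4 * l v) * weight v k" using pk by (metis mult_right_cancel less_irrefl)
      have "- (2 * l v) * weight v k = - (4 * l v) * weight v k" using 1 2 by (rule subst)
      then have "2 * (l v * weight v k) = 4 * (l v * weight v k)" by (simp only: mult.assoc mult_minus_left neg_equal_iff_equal)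
      then have "l v * weight v k = 0" by linarith
      then have "weight v k = 0" using lpos[OF v] by simp
      then show ?thesis using 1 by simp
    qed
    then have "dl = (\<lambda>k. 0)" "weight v = (\<lambda>k. 0)" by auto
    then show ?thesis using dl by simp
  qed
  obtain c where "\<And>v. v \<in> V \<Longrightarrow> l v = c"
    using has_derivative_zero_unique_connected[OF V(1,2), of l] key by metis
  then show ?thesis using l key by (intro exI[of _ c]) auto
qed

text \<open>A combination of two Killing tensors of \<open>G\<close>. It vanishes where \<open>G'\<close> is the multiple \<open>C / density\<close> of
  \<open>G\<close>.\<close>

definition killing :: "real \<Rightarrow> 'e \<Rightarrow> 'e \<Rightarrow> 'e \<Rightarrow> real" where
  "killing C v h k = density v * G' v h k - C * G v h k"

lemma bilinear_killing: assumes v: "v \<in> U" shows "bilinear (killing C v)"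
proof -
  note s = linear_simps[OF M.G_linear(1)[OF v]]
    linear_simps[OF M'.G_linear(1)[OF v]]
    linear_simps[OF M.G_linear(2)[OF v]]
    linear_simps[OF M'.G_linear(2)[OF v]]
  show ?thesis unfolding bilinear_def killing_def
    by (intro conjI allI linearI) (simp_all add: s algebra_simps)
qed

lemma killing_sym: "v \<in> U \<Longrightarrow> killing C v h k = killing C v k h"
  using M.G_sym M'.G_sym by (simp add: killing_def)

text \<open>The Killing equation: along a straight line the derivative depends linearly on the value of the
  tensor, because the line differs from a geodesic only by its acceleration in the connection.\<close>

lemma killing_along_line:
  assumes v: "x + t *\<^sub>R h \<in> U"
  shows "((\<lambda>t. killing C (x + t *\<^sub>R h) h h) has_real_derivative
      2 * killing C (x + t *\<^sub>R h) (levi_civita G (x + t *\<^sub>R h) h h) h) (at t)"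
proof -
  let ?v = "x + t *\<^sub>R h"
  have line: "((\<lambda>t. x + t *\<^sub>R h) has_derivative (\<lambda>s. s *\<^sub>R h)) (at t)"
    by (auto intro!: derivative_eq_intros)
  have "((\<lambda>w. killing C w h h) has_derivative
     (\<lambda>k. density ?v * metric_deriv G' ?v k h h + (- 4 * weight ?v k * density ?v) * G' ?v h h - C * metric_deriv G ?v k h h)) (at ?v)"
    unfolding killing_def
    by (intro has_derivative_diff has_derivative_mult has_derivative_mult_right
        density_has_derivative[OF v] M.G_has_derivative[OF v] M'.G_has_derivative[OF v])
  from has_derivative_compose[OF line this]
  have d: "((\<lambda>t. killing C (x + t *\<^sub>R h) h h) has_derivative
     (\<lambda>s. density ?v * metric_deriv G' ?v (s *\<^sub>R h) h h + (- 4 * weight ?v (s *\<^sub>R h) * density ?v) * G' ?v h h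
        - C * metric_deriv G ?v (s *\<^sub>R h) h h)) (at t)" .
  note lin = linear_simps[OF M'.G_linear(2)[OF v]]
  have 1: "metric_deriv G' ?v h h h = 2 * G' ?v (levi_civita G ?v h h) h + 4 * weight ?v h * G' ?v h h"
    using M'.metric_deriv_levi_civita[OF v, of h h h] by (simp add: weight(2)[OF v] lin)
  have 2: "metric_deriv G ?v h h h = 2 * G ?v (levi_civita G ?v h h) h"
    using M.metric_deriv_levi_civita[OF v, of h h h] by simp
  show ?thesis unfolding has_field_derivative_def
    by (rule has_derivative_eq_rhs[OF d])
      (auto simp: linear_cmul[OF M.linear_metric_deriv(1)[OF v]] linear_cmul[OF M'.linear_metric_deriv(1)[OF v]]
         linear_cmul[OF weight(1)[OF v]] 1 2 killing_def algebra_simps)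
qed

lemma killing_continuous:
  assumes "S \<subseteq> U" shows "continuous_on (S \<times> T) (\<lambda>z. killing C (fst z) (snd z) (snd z))"
proof -
  have "continuous_on S density"
    using density_has_derivative assms
    by (intro continuous_at_imp_continuous_on) (auto intro: has_derivative_continuous)
  then have "continuous_on (S \<times> T) (\<lambda>z. density (fst z))"
    by (rule continuous_on_compose2) (auto intro!: continuous_intros)
  then show ?thesis unfolding killing_def
    using assms by (intro continuous_intros M.G_continuous M'.G_continuous) auto
qed

text \<open>At a point of the shell where its norm is maximal, the Killing tensor is controlled along an open
  cone of straight lines that reach the smaller ball after a time proportional to the width of the
  shell. Along them it changes by at most a small multiple of its maximum.\<close>

lemma killing_zero_step:
  assumes K: "cball w (R + \<epsilon>) \<subseteq> U" and \<epsilon>: "0 < \<epsilon>" "\<epsilon> \<le> R / 2" "256 * Q * \<epsilon> < 1"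
    and Q: "Q \<ge> 0" "\<And>v h. v \<in> cball w (R + \<epsilon>) \<Longrightarrow> norm (levi_civita G v h h) \<le> Q * (norm h)\<^sup>2"
    and zero: "\<And>v h. v \<in> ball w R \<Longrightarrow> killing C v h h = 0"
    and v: "v \<in> cball w (R + \<epsilon>)"
  shows "killing C v h h = 0"
proof -
  let ?N = "cball w (R + \<epsilon>)"
  let ?k = "killing C"
  let ?S = "?N \<times> sphere (0::'e) 1"
  have S: "compact ?S" "?S \<noteq> {}" using \<epsilon> by (auto intro!: compact_Times)
  have "continuous_on ?S (\<lambda>z. \<bar>?k (fst z) (snd z) (snd z)\<bar>)"
    by (intro continuous_intros killing_continuous K)
  from continuous_attains_sup[OF S this] obtain z where z: "z \<in> ?S"
    "\<forall>y\<in>?S. \<bar>?k (fst y) (snd y) (snd y)\<bar> \<le> \<bar>?k (fst z) (snd z) (snd z)\<bar>" by blast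
  define x where "x = fst z"
  define n where "n = snd z"
  define \<kappa> where "\<kappa> = \<bar>?k x n n\<bar>"
  have xn: "x \<in> ?N" "norm n = 1" using z(1) by (auto simp: x_def n_def)
  have xU: "x \<in> U" using xn K by auto
  have \<kappa>0: "\<kappa> \<ge> 0" by (simp add: \<kappa>_def)
  have quad: "\<bar>?k y h h\<bar> \<le> \<kappa> * (norm h)\<^sup>2" if y: "y \<in> ?N" for y h
  proof (cases "h = 0")
    case True
    have "y \<in> U" using y K by blast
    from bilinear_lzero[OF bilinear_killing[OF this], of C 0] show ?thesis by (simp add: True)
  next
    case False
    note b = bilinear_killing[of y C]
    have yU: "y \<in> U" using y K by auto
    have "\<bar>?k y (h /\<^sub>R norm h) (h /\<^sub>R norm h)\<bar> \<le> \<kappa>"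
      using z(2)[rule_format, of "(y, h /\<^sub>R norm h)"] y False by (auto simp: \<kappa>_def x_def n_def)
    moreover have "?k y (h /\<^sub>R norm h) (h /\<^sub>R norm h) = ?k y h h / (norm h)\<^sup>2"
      by (simp add: bilinear_lmul[OF b[OF yU]] bilinear_rmul[OF b[OF yU]] power2_eq_square field_simps)
    ultimately have "\<bar>?k y h h\<bar> / (norm h)\<^sup>2 \<le> \<kappa>" by simp
    then show ?thesis using False by (simp add: field_simps)
  qed
  have bil: "\<bar>?k y a b\<bar> \<le> \<kappa> * (norm a * norm b)" if y: "y \<in> ?N" for y a b
  proof (cases "a = 0 \<or> b = 0")
    case True
    have "y \<in> U" using y K by blast
    note bilinear_killing[OF this, of C]
    from True bilinear_lzero[OF this, of b] bilinear_rzero[OF this, of a] show ?thesis by auto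
  next
    case False
    have yU: "y \<in> U" using y K by auto
    note bl = bilinear_killing[OF yU, of C]
    define a' where "a' = a /\<^sub>R norm a"
    define b' where "b' = b /\<^sub>R norm b"
    have ab: "norm a' = 1" "norm b' = 1" "a = norm a *\<^sub>R a'" "b = norm b *\<^sub>R b'"
      using False by (simp_all add: a'_def b'_def)
    have "4 * ?k y a' b' = ?k y (a' + b') (a' + b') - ?k y (a' - b') (a' - b')"
      using killing_sym[OF yU, of C b' a']
      by (simp add: bilinear_ladd[OF bl] bilinear_radd[OF bl] bilinear_lsub[OF bl] bilinear_rsub[OF bl])
    then have "4 * \<bar>?k y a' b'\<bar> \<le> \<bar>?k y (a' + b') (a' + b')\<bar> + \<bar>?k y (a' - b') (a' - b')\<bar>" by linarith
    also have "\<dots> \<le> \<kappa> * (norm (a' + b'))\<^sup>2 + \<kappa> * (norm (a' - b'))\<^sup>2" by (intro add_mono quad y)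
    also have "\<dots> = \<kappa> * 4"
      using ab(1,2) by (simp add: power2_norm_eq_inner inner_add_left inner_add_right inner_diff_left inner_diff_right
          inner_commute distrib_left[symmetric] norm_eq_1)
    finally have "\<bar>?k y a' b'\<bar> \<le> \<kappa>" by simp
    then have "(norm a * norm b) * \<bar>?k y a' b'\<bar> \<le> (norm a * norm b) * \<kappa>" by (intro mult_left_mono) auto
    moreover have "?k y a b = (norm a * norm b) * ?k y a' b'"
      by (subst ab(3), subst ab(4)) (simp add: bilinear_lmul[OF bl] bilinear_rmul[OF bl])
    ultimately show ?thesis by (simp add: abs_mult mult.commute)
  qed
  have "\<kappa> = 0"
  proof (cases "x \<in> ball w R")
    case True
    then show ?thesis using zero by (simp add: \<kappa>_def)
  next
    case False
    define \<rho> where "\<rho> = dist w x"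
    have \<rho>: "R \<le> \<rho>" "\<rho> \<le> R + \<epsilon>" using False xn by (auto simp: \<rho>_def)
    have \<rho>0: "\<rho> > 0" using \<rho> \<epsilon> by linarith
    define e where "e = (w - x) /\<^sub>R \<rho>"
    have e: "norm e = 1" "w - x = \<rho> *\<^sub>R e" using \<rho>0 by (auto simp: e_def \<rho>_def dist_norm)
    \<comment> \<open>At time \<open>2 * \<epsilon>\<close> a line of the cone of aperture \<open>1/4\<close> around the inner normal has reached the ball.\<close>
    have cone: "\<bar>?k x h h\<bar> \<le> 8 * \<epsilon> * Q * \<kappa>" if h: "norm (h - e) \<le> 1/4" for h
    proof -
      define f where "f t = ?k (x + t *\<^sub>R h) h h" for t
      have "norm h \<le> norm (h - e) + norm e" by (metis diff_add_cancel norm_triangle_ineq)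
      then have nh: "norm h \<le> 5/4" using h e(1) by linarith
      have "w - (x + (2 * \<epsilon>) *\<^sub>R h) = (\<rho> - 2 * \<epsilon>) *\<^sub>R e - (2 * \<epsilon>) *\<^sub>R (h - e)"
        using e(2) by (simp add: algebra_simps)
      then have "norm (w - (x + (2 * \<epsilon>) *\<^sub>R h)) \<le> norm ((\<rho> - 2 * \<epsilon>) *\<^sub>R e) + norm ((2 * \<epsilon>) *\<^sub>R (h - e))"
        by (metis norm_triangle_ineq4)
      also have "\<dots> \<le> (\<rho> - 2 * \<epsilon>) + 2 * \<epsilon> * (1/4)"
        using e(1) h \<rho> \<epsilon> by (intro add_mono) (auto simp: mult_left_mono)
      also have "\<dots> < R" using \<rho> \<epsilon> by simp
      finally have end_in: "x + (2 * \<epsilon>) *\<^sub>R h \<in> ball w R" by (simp add: dist_norm)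
      have end_N: "x + (2 * \<epsilon>) *\<^sub>R h \<in> ?N" using end_in \<epsilon> by auto
      have seg: "x + t *\<^sub>R h \<in> ?N" if t: "t \<in> {0..2 * \<epsilon>}" for t
      proof -
        have "(1 - t / (2 * \<epsilon>)) *\<^sub>R x + (t / (2 * \<epsilon>)) *\<^sub>R (x + (2 * \<epsilon>) *\<^sub>R h) \<in> ?N"
          using t \<epsilon> by (intro convexD[OF convex_cball xn(1) end_N]) (auto simp: field_simps)
        moreover have "(1 - t / (2 * \<epsilon>)) *\<^sub>R x + (t / (2 * \<epsilon>)) *\<^sub>R (x + (2 * \<epsilon>) *\<^sub>R h) = x + t *\<^sub>R h"
          using \<epsilon> by (simp add: algebra_simps)
        ultimately show ?thesis by simp
      qed
      have der: "(f has_real_derivative 2 * ?k (x + t *\<^sub>R h) (levi_civita G (x + t *\<^sub>R h) h h) h) (at t)"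
        if t: "t \<in> {0..2 * \<epsilon>}" for t
        unfolding f_def using seg[OF t] K by (intro killing_along_line) auto
      have bound: "\<bar>2 * ?k (x + t *\<^sub>R h) (levi_civita G (x + t *\<^sub>R h) h h) h\<bar> \<le> 4 * \<kappa> * Q"
        if t: "t \<in> {0..2 * \<epsilon>}" for t
      proof -
        let ?y = "x + t *\<^sub>R h"
        have "\<bar>?k ?y (levi_civita G ?y h h) h\<bar> \<le> \<kappa> * (norm (levi_civita G ?y h h) * norm h)"
          by (rule bil[OF seg[OF t]])
        also have "\<dots> \<le> \<kappa> * ((Q * (norm h)\<^sup>2) * norm h)"
          by (intro mult_left_mono mult_right_mono Q(2) seg t \<kappa>0) auto
        also have "\<dots> = \<kappa> * Q * (norm h) ^ 3" by (simp add: power2_eq_square power3_eq_cube)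
        also have "\<dots> \<le> \<kappa> * Q * (5/4) ^ 3"
          using nh \<kappa>0 Q(1) by (intro mult_left_mono power_mono mult_nonneg_nonneg) auto
        also have "\<dots> \<le> \<kappa> * Q * 2"
          using \<kappa>0 Q(1) by (intro mult_left_mono mult_nonneg_nonneg) (simp_all add: power3_eq_cube)
        finally show ?thesis by simp
      qed
      obtain s where s: "0 < s" "s < 2 * \<epsilon>"
        "f (2 * \<epsilon>) - f 0 = (2 * \<epsilon> - 0) * (2 * ?k (x + s *\<^sub>R h) (levi_civita G (x + s *\<^sub>R h) h h) h)"
        using MVT2[of 0 "2 * \<epsilon>" f "\<lambda>t. 2 * ?k (x + t *\<^sub>R h) (levi_civita G (x + t *\<^sub>R h) h h) h"] der \<epsilon>(1)
        by (metis (no_types, lifting) atLeastAtMost_iff mult_pos_pos zero_less_numeral)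
      have "f (2 * \<epsilon>) = 0" unfolding f_def by (rule zero[OF end_in])
      then have "- f 0 = (2 * \<epsilon>) * (2 * ?k (x + s *\<^sub>R h) (levi_civita G (x + s *\<^sub>R h) h h) h)"
        using s(3) by simp
      from arg_cong[OF this, of abs]
      have "\<bar>f 0\<bar> = 2 * \<epsilon> * \<bar>2 * ?k (x + s *\<^sub>R h) (levi_civita G (x + s *\<^sub>R h) h h) h\<bar>"
        using \<epsilon>(1) by (simp add: abs_mult)
      also have "\<dots> \<le> 2 * \<epsilon> * (4 * \<kappa> * Q)" using s \<epsilon> by (intro mult_left_mono bound) auto
      finally show ?thesis by (simp add: f_def mult_ac)
    qed
    note bl = bilinear_killing[OF xU, of C]
    \<comment> \<open>The values on the cone determine all others by a second difference.\<close>
    have "?k x (e + (1/4) *\<^sub>R n) (e + (1/4) *\<^sub>R n) + ?k x (e - (1/4) *\<^sub>R n) (e - (1/4) *\<^sub>R n) - 2 * ?k x e e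
        = (1/8) * ?k x n n"
      by (simp add: bilinear_ladd[OF bl] bilinear_radd[OF bl] bilinear_lsub[OF bl] bilinear_rsub[OF bl]
          bilinear_lmul[OF bl] bilinear_rmul[OF bl] add_divide_distrib diff_divide_distrib)
    moreover have "\<bar>?k x (e + (1/4) *\<^sub>R n) (e + (1/4) *\<^sub>R n)\<bar> \<le> 8 * \<epsilon> * Q * \<kappa>"
      "\<bar>?k x (e - (1/4) *\<^sub>R n) (e - (1/4) *\<^sub>R n)\<bar> \<le> 8 * \<epsilon> * Q * \<kappa>" "\<bar>?k x e e\<bar> \<le> 8 * \<epsilon> * Q * \<kappa>"
      by (rule cone; simp add: xn)+
    ultimately have "(1/8) * \<kappa> \<le> 4 * (8 * \<epsilon> * Q * \<kappa>)" unfolding \<kappa>_def by linarith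
    then have "\<kappa> \<le> (256 * Q * \<epsilon>) * \<kappa>" by (simp add: mult_ac)
    then have "(1 - 256 * Q * \<epsilon>) * \<kappa> \<le> 0" by (simp add: algebra_simps)
    then show ?thesis using \<epsilon>(3) \<kappa>0 by (simp add: mult_le_0_iff)
  qed
  then show ?thesis using quad[OF v, of h] by simp
qed

text \<open>The width \<open>d\<close> of the shell in the previous lemma can be chosen once and for all on a compact ball, so
  that finitely many steps are enough.\<close>

lemma killing_zero_on_larger_ball:
  assumes K: "cball w R' \<subseteq> U" and R: "0 < R" 
    and zero: "\<And>v h. v \<in> ball w R \<Longrightarrow> killing C v h h = 0"
    and v: "v \<in> ball w R'"
  shows "killing C v h h = 0"
proof -
  obtain Q where Q: "Q \<ge> 0" "\<And>v h. v \<in> cball w R' \<Longrightarrow> norm (levi_civita G v h h) \<le> Q * (norm h)\<^sup>2"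
    using M.levi_civita_bounded_on_compact[OF compact_cball K] by metis
  define d where "d = min (R / 2) (1 / (256 * Q + 1))"
  have dpos: "d > 0" "d \<le> R / 2" using R Q(1) by (auto simp: d_def)
  have dQ: "256 * Q * \<epsilon> < 1" if "0 < \<epsilon>" "\<epsilon> \<le> d" for \<epsilon>
  proof -
    have "256 * Q * \<epsilon> \<le> 256 * Q * (1 / (256 * Q + 1))"
      using that Q(1) by (intro mult_left_mono) (auto simp: d_def)
    also have "\<dots> < 1" using Q(1) by (simp add: field_simps)
    finally show ?thesis .
  qed
  have step: "killing C v h h = 0" if "v \<in> ball w (min R' (R + real n * d))" for n v h
    using that
  proof (induction n arbitrary: v h)
    case 0
    then show ?case using zero by simp
  next
    case (Suc n)
    let ?r = "min R' (R + real n * d)"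
    show ?case
    proof (cases "v \<in> ball w ?r")
      case True
      then show ?thesis by (rule Suc.IH)
    next
      case False
      let ?\<epsilon> = "min (R' - R - real n * d) d"
      have "?r \<le> dist w v" "dist w v < R'" using False Suc.prems by simp_all
      then have "min R' (R + real n * d) < R'" by linarith
      then have lt: "R + real n * d < R'" by (simp add: min_less_iff_disj)
      have r: "?r = R + real n * d" "?\<epsilon> > 0" using lt dpos(1) by simp_all
      have eps: "?r + ?\<epsilon> = min R' (R + real (Suc n) * d)" unfolding r(1) by (auto simp: algebra_simps min_def)
      have sub: "cball w (?r + ?\<epsilon>) \<subseteq> cball w R'" unfolding eps by auto
      have nd: "0 \<le> real n * d" using dpos by simp
      show ?thesis
      proof (rule killing_zero_step[where w = w and R = ?r and \<epsilon> = ?\<epsilon> and Q = Q])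
        have "?\<epsilon> \<le> d" by simp
        also have "d \<le> R / 2 + real n * d / 2" using dpos(2) nd by (intro add_increasing2) auto
        finally show "?\<epsilon> \<le> ?r / 2" unfolding r(1) by (simp add: add_divide_distrib)
        show "256 * Q * ?\<epsilon> < 1" using dQ r(2) by simp
        show "cball w (?r + ?\<epsilon>) \<subseteq> U" using sub K by blast
        show "v \<in> cball w (?r + ?\<epsilon>)" unfolding eps using Suc.prems by simp
        show "norm (levi_civita G y k k) \<le> Q * (norm k)\<^sup>2" if "y \<in> cball w (?r + ?\<epsilon>)" for y k
          using Q(2) that sub by blast
      qed (use r(2) Q(1) Suc.IH in auto)
    qed
  qed
  obtain n where "real n * d > R' - R" using reals_Archimedean3[OF dpos(1)] by blast
  then have "min R' (R + real n * d) = R'" by simp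
  then show ?thesis using step v by metis
qed

text \<open>On the small ball the conformal factor is constant, so the density is constant as well and \<open>C\<close> can be
  chosen such that the Killing tensor vanishes there. It then vanishes on the large ball, where \<open>G\<close> and
  \<open>G'\<close> are therefore conformal, and the factor is constant by the previous results.\<close>

lemma proportionality_continues:
  assumes K: "cball w R' \<subseteq> U" and R: "0 < R" "R \<le> R'" and c: "c > 0"
    and eq: "\<And>v h k. v \<in> ball w R \<Longrightarrow> G v h k = c\<^sup>2 * G' v h k"
    and v: "v \<in> ball w R'"
  shows "G v h k = c\<^sup>2 * G' v h k"
proof -
  have BU: "ball w R \<subseteq> U" "ball w R' \<subseteq> U" using K R(2) by auto
  have w: "w \<in> ball w R" using R by simp
  have weight0: "weight v = (\<lambda>k. 0)" if "v \<in> ball w R" for v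
    using conformal_factor_constant[OF open_ball connected_ball BU(1)] eq that by blast
  have "(density has_derivative (\<lambda>k. 0)) (at v)" if "v \<in> ball w R" for v
    using density_has_derivative[of v] that BU weight0[OF that] by auto
  then obtain \<phi> where \<phi>: "\<And>v. v \<in> ball w R \<Longrightarrow> density v = \<phi>"
    using has_derivative_zero_unique_connected[OF open_ball connected_ball, of w R density] by metis
  have \<phi>0: "\<phi> > 0" using \<phi>[OF w] density_pos[of w] by simp
  define C where "C = \<phi> / c\<^sup>2"
  have C0: "C > 0" using \<phi>0 c by (simp add: C_def)
  have zero: "killing C v h h = 0" if "v \<in> ball w R" for v h
    using c by (simp add: killing_def \<phi>[OF that] eq[OF that] C_def)
  have kz: "killing C v h h = 0" if "v \<in> ball w R'" for v h
    by (rule killing_zero_on_larger_ball[OF K R(1) zero that])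
  have conf: "G v h k = (density v / C) * G' v h k" if v: "v \<in> ball w R'" for v h k
  proof -
    have vU: "v \<in> U" using v BU by auto
    have "killing C v h k = 0"
      using sym_bilinear_polarization[OF bilinear_killing[OF vU] killing_sym[OF vU], of C h k] kz[OF v] by simp
    then show ?thesis using C0 by (simp add: killing_def field_simps)
  qed
  obtain l where l: "\<forall>v\<in>ball w R'. (\<forall>h k. G v h k = l * G' v h k) \<and> weight v = (\<lambda>k. 0)"
    using conformal_factor_constant[OF open_ball connected_ball BU(2)] conf by blast
  obtain e where e: "(e::'e) \<noteq> 0" using nonempty_Basis nonzero_Basis by blast
  have "w \<in> U" using w BU by auto
  then have "G' w e e > 0" using M'.G_pos e by auto
  moreover have "l * G' w e e = c\<^sup>2 * G' w e e" using l eq[OF w, of e e] R w by auto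
  ultimately have "l = c\<^sup>2" by simp
  then show ?thesis using l v by blast
qed

end

section \<open>Consequences of the projective relation at a point\<close>

text \<open>The skew operator of the exterior derivative.\<close>

definition magnetic_op ::
    "('e::euclidean_space \<Rightarrow> 'e \<Rightarrow> 'e \<Rightarrow> real) \<Rightarrow> ('e \<Rightarrow> 'e \<Rightarrow> real) \<Rightarrow> 'e \<Rightarrow> 'e \<Rightarrow> 'e" where
  "magnetic_op G W u h = (SOME a. \<forall>e. G u a e = curl W u e h)"

context local_randers begin

lemma magnetic_op:
  assumes u: "u \<in> U"
  shows "G u (magnetic_op G W u h) e = curl W u e h"
proof -
  from riesz_bilinear[OF bilinear_G[OF u] G_pos[OF u] linear_curl_left[OF u, of h]]
  have "\<exists>a. \<forall>e. G u a e = curl W u e h" by metis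
  from someI_ex[OF this] show ?thesis unfolding magnetic_op_def by blast
qed

lemma linear_magnetic_op: assumes u: "u \<in> U" shows "linear (magnetic_op G W u)"
  by (intro linearI; rule G_eqI[OF u])
    (simp_all add: magnetic_op[OF u] linear_simps[OF G_linear(2)[OF u]]
      linear_simps[OF linear_curl_right[OF u]])

text \<open>The Euler-Lagrange equation solved for the acceleration, modulo the velocity.\<close>

lemma euler_lagrange_span:
  assumes u: "u \<in> U" and h: "h \<noteq> 0" and EL: "\<And>e. euler_lagrange G W u h a e = 0"
  shows "a + levi_civita G u h h - sqrt (G u h h) *\<^sub>R magnetic_op G W u h \<in> span {h}"
proof -
  let ?y = "a + levi_civita G u h h - sqrt (G u h h) *\<^sub>R magnetic_op G W u h"
  define s where "s = G u a h + christoffel G u h h"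
  note lin = G_linear(2)[OF u]
  have pos: "G u h h > 0" by (rule G_pos[OF u h])
  have eq: "G u h h *\<^sub>R ?y = s *\<^sub>R h"
  proof (rule G_eqI[OF u])
    fix e
    have "sqrt (G u h h) ^ 3 = G u h h * sqrt (G u h h)" using pos by (simp add: power3_eq_cube)
    then have "G u h h * (G u a e + christoffel G u h e - sqrt (G u h h) * curl W u e h) = G u h e * s"
      using EL[of e] by (simp add: euler_lagrange_def s_def algebra_simps)
    then show "G u (G u h h *\<^sub>R ?y) e = G u (s *\<^sub>R h) e"
      by (simp add: linear_cmul[OF lin] linear_add[OF lin] linear_diff[OF lin] G_levi_civita_same[OF u]
          magnetic_op[OF u] mult.commute)
  qed
  have "?y = (1 / G u h h) *\<^sub>R (G u h h *\<^sub>R ?y)" using pos by simp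
  also have "\<dots> = (s / G u h h) *\<^sub>R h" unfolding eq by simp
  finally show ?thesis by (metis span_base span_scale singletonI)
qed

text \<open>Velocity and acceleration of a reparametrized curve are \<open>l h\<close> and \<open>m h + l\<^sup>2 a\<close>.\<close>

lemma euler_lagrange_reparam:
  assumes u: "u \<in> U" and l: "l > 0"
  shows "euler_lagrange G W u (l *\<^sub>R h) (m *\<^sub>R h + l\<^sup>2 *\<^sub>R a) e = l ^ 4 * euler_lagrange G W u h a e"
proof -
  note s = linear_simps[OF G_linear(1)[OF u]]
    linear_simps[OF G_linear(2)[OF u]]
    linear_cmul[OF linear_curl_right[OF u]]
  note d = linear_cmul[OF linear_metric_deriv(1)[OF u]] linear_cmul[OF linear_metric_deriv(2)[OF u]]
    linear_cmul[OF linear_metric_deriv(3)[OF u]]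
  have c: "christoffel G u (l *\<^sub>R h) e = l\<^sup>2 * christoffel G u h e" for e
    by (simp add: christoffel_def d power2_eq_square algebra_simps)
  have c': "christoffel G u h (l *\<^sub>R h) = l * christoffel G u h h"
    by (rule linear_cmul[OF linear_christoffel[OF u], simplified])
  have n: "sqrt (G u (l *\<^sub>R h) (l *\<^sub>R h)) = l * sqrt (G u h h)"
    using l by (simp add: s real_sqrt_mult)
  show ?thesis unfolding euler_lagrange_def n c c'
    by (simp add: s power2_eq_square power3_eq_cube power4_eq_xxxx algebra_simps)
qed

end

lemma local_randers_uminus: "local_randers U G W \<Longrightarrow> local_randers U G (\<lambda>u h. - W u h)"
  unfolding local_randers_def using local_form_uminus by blast

lemma (in local_randers) magnetic_op_uminus:
  assumes u: "u \<in> U"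
  shows "magnetic_op G (\<lambda>u h. - W u h) u h = - magnetic_op G W u h"
proof -
  interpret N: local_randers U G "\<lambda>u h. - W u h"
    by (rule local_randers_uminus) unfold_locales
  show ?thesis
    by (rule G_eqI[OF u]) (simp add: N.magnetic_op[OF u] magnetic_op[OF u] curl_uminus[OF u] linear_neg[OF G_linear(2)[OF u]])
qed

text \<open>Every direction at \<open>u\<close> has a common acceleration of a geodesic of \<open>(G, W)\<close> and of a
  forward or backward geodesic of \<open>(G', W')\<close>.\<close>

definition related_at :: "('e::euclidean_space \<Rightarrow> 'e \<Rightarrow> 'e \<Rightarrow> real) \<Rightarrow> ('e \<Rightarrow> 'e \<Rightarrow> real)
    \<Rightarrow> ('e \<Rightarrow> 'e \<Rightarrow> 'e \<Rightarrow> real) \<Rightarrow> ('e \<Rightarrow> 'e \<Rightarrow> real) \<Rightarrow> 'e \<Rightarrow> bool" where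
  "related_at G W G' W' u \<longleftrightarrow> (\<forall>h. h \<noteq> 0 \<longrightarrow> (\<exists>a. (\<forall>e. euler_lagrange G W u h a e = 0) \<and>
     ((\<forall>e. euler_lagrange G' W' u h a e = 0) \<or> (\<forall>e. euler_lagrange G' (\<lambda>u h. - W' u h) u h a e = 0))))"

text \<open>Subtract the two expressions for the common acceleration.\<close>

lemma inner_pair_related:
  assumes R: "local_randers U G W" and R': "local_randers U G' W'" and u: "u \<in> U"
    and rel: "related_at G W G' W' u"
  shows "inner_pair (G u) (G' u) (magnetic_op G W u) (magnetic_op G' W' u)
     (\<lambda>h. levi_civita G' u h h - levi_civita G u h h)"
proof -
  interpret R: local_randers U G W by fact
  interpret R': local_randers U G' W' by fact
  interpret N: local_randers U G' "\<lambda>u h. - W' u h" by (rule local_randers_uminus[OF R'])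
  note b = R.bilinear_levi_civita[OF u] and b' = R'.bilinear_levi_civita[OF u]
  show ?thesis
  proof (rule inner_pair.intro)
    show "bilinear (G u)" "bilinear (G' u)" by (rule R.bilinear_G[OF u], rule R'.bilinear_G[OF u])
    show "G u h k = G u k h" "G' u h k = G' u k h" for h k by (rule R.G_sym[OF u], rule R'.G_sym[OF u])
    show "h \<noteq> 0 \<Longrightarrow> 0 < G u h h" "h \<noteq> 0 \<Longrightarrow> 0 < G' u h h" for h
      by (rule R.G_pos[OF u], assumption, rule R'.G_pos[OF u])
    show "linear (magnetic_op G W u)" "linear (magnetic_op G' W' u)"
      by (rule R.linear_magnetic_op[OF u], rule R'.linear_magnetic_op[OF u])
    show "G u (magnetic_op G W u h) h = 0" "G' u (magnetic_op G' W' u h) h = 0" for h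
      by (simp_all add: R.magnetic_op[OF u] R'.magnetic_op[OF u])
    show "levi_civita G' u (- h) (- h) - levi_civita G u (- h) (- h) = levi_civita G' u h h - levi_civita G u h h" for h
      by (simp add: bilinear_lneg[OF b] bilinear_rneg[OF b] bilinear_lneg[OF b'] bilinear_rneg[OF b'])
    show "continuous_on UNIV (\<lambda>h. levi_civita G' u h h - levi_civita G u h h)"
      by (intro continuous_intros continuous_on_bilinear_compose[OF b] continuous_on_bilinear_compose[OF b'])
    fix h :: 'a assume h: "h \<noteq> 0"
    obtain a where a: "\<And>e. euler_lagrange G W u h a e = 0"
      "(\<forall>e. euler_lagrange G' W' u h a e = 0) \<or> (\<forall>e. euler_lagrange G' (\<lambda>u h. - W' u h) u h a e = 0)"
      using rel h unfolding related_at_def by blast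
    let ?w = "sqrt (G' u h h) *\<^sub>R magnetic_op G' W' u h"
    have 1: "a + levi_civita G u h h - sqrt (G u h h) *\<^sub>R magnetic_op G W u h \<in> span {h}"
      by (rule R.euler_lagrange_span[OF u h a(1)])
    have "\<exists>\<sigma>\<in>{1, -1}. a + levi_civita G' u h h - \<sigma> *\<^sub>R ?w \<in> span {h}"
    proof (cases "\<forall>e. euler_lagrange G' W' u h a e = 0")
      case True
      then show ?thesis using R'.euler_lagrange_span[OF u h, of a] by auto
    next
      case False
      then show ?thesis using a(2) N.euler_lagrange_span[OF u h, of a] 
        by (auto simp: R'.magnetic_op_uminus[OF u])
    qed
    then obtain s where s: "s \<in> {1, -1}" "a + levi_civita G' u h h - s *\<^sub>R ?w \<in> span {h}" by blast
    have "levi_civita G' u h h - levi_civita G u h h + sqrt (G u h h) *\<^sub>R magnetic_op G W u h - s *\<^sub>R ?w \<in> span {h}"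
      using span_diff[OF s(2) 1] by (simp add: algebra_simps)
    then show "\<exists>\<sigma>\<in>{1, -1}. levi_civita G' u h h - levi_civita G u h h + sqrt (G u h h) *\<^sub>R magnetic_op G W u h
        - (\<sigma> * sqrt (G' u h h)) *\<^sub>R magnetic_op G' W' u h \<in> span {h}"
      using s(1) by (metis scaleR_scaleR)
  qed
qed

lemma related_at_consequences:
  assumes R: "local_randers U G W" and R': "local_randers U G' W'" and u: "u \<in> U"
    and rel: "related_at G W G' W' u" "related_at G' W' G W u"
  shows "h \<noteq> 0 \<Longrightarrow> levi_civita G' u h h - levi_civita G u h h \<in> span {h}"
    and "curl W u k l \<noteq> 0 \<Longrightarrow> \<exists>c>0. (\<forall>h k. G u h k = c\<^sup>2 * G' u h k) \<and>
       ((\<forall>h k. curl W u h k = c * curl W' u h k) \<or> (\<forall>h k. curl W u h k = - c * curl W' u h k))"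
    and "\<forall>h k. curl W u h k = 0 \<Longrightarrow> curl W' u k l = 0"
proof -
  interpret R: local_randers U G W by fact
  interpret R': local_randers U G' W' by fact
  let ?B = "magnetic_op G W u" and ?B' = "magnetic_op G' W' u"
  note P = inner_pair_related[OF R R' u rel(1)]
  have P': "inner_pair (G' u) (G u) ?B' ?B (\<lambda>h. - (levi_civita G' u h h - levi_civita G u h h))"
    using inner_pair_related[OF R' R u rel(2)] by simp
  note dich = inner_pair_dichotomy[OF P P']
  show "h \<noteq> 0 \<Longrightarrow> levi_civita G' u h h - levi_civita G u h h \<in> span {h}"
    by (rule dich(1))
  have B0: "(\<forall>k. ?B k = 0) \<longleftrightarrow> (\<forall>h k. curl W u h k = 0)"
    using R.magnetic_op[OF u] R.G_eqI[OF u, of "?B _" 0] linear_0[OF R.G_linear(2)[OF u]] by metis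
  have B0': "(\<forall>k. ?B' k = 0) \<longleftrightarrow> (\<forall>h k. curl W' u h k = 0)"
    using R'.magnetic_op[OF u] R'.G_eqI[OF u, of "?B' _" 0] linear_0[OF R'.G_linear(2)[OF u]] by metis
  obtain b where b: "(b::'a) \<noteq> 0" using nonempty_Basis nonzero_Basis by blast
  show "curl W' u k l = 0" if "\<forall>h k. curl W u h k = 0"
    using dich(2)[OF b] that B0 B0' by blast
  show "\<exists>c>0. (\<forall>h k. G u h k = c\<^sup>2 * G' u h k) \<and>
       ((\<forall>h k. curl W u h k = c * curl W' u h k) \<or> (\<forall>h k. curl W u h k = - c * curl W' u h k))"
    if nonzero: "curl W u k l \<noteq> 0"
  proof -
    obtain p where p: "?B p \<noteq> 0" using nonzero B0 by blast
    obtain c where c: "c > 0" and G: "\<And>h k. G u h k = c\<^sup>2 * G' u h k"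
      and B: "(\<forall>h. c *\<^sub>R ?B h = ?B' h) \<or> (\<forall>h. c *\<^sub>R ?B h = - ?B' h)"
      using inner_pair.proportional[OF P p] by metis
    have curl: "curl W u h k = c * G' u (c *\<^sub>R ?B k) h" for h k
    proof -
      have "curl W u h k = c\<^sup>2 * G' u (?B k) h" using R.magnetic_op[OF u, of k h] G by simp
      then show ?thesis by (simp add: linear_cmul[OF R'.G_linear(2)[OF u]] power2_eq_square)
    qed
    from B have "(\<forall>h k. curl W u h k = c * curl W' u h k) \<or> (\<forall>h k. curl W u h k = - c * curl W' u h k)"
    proof
      assume "\<forall>h. c *\<^sub>R ?B h = ?B' h"
      then show ?thesis by (simp add: curl R'.magnetic_op[OF u])
    next
      assume "\<forall>h. c *\<^sub>R ?B h = - ?B' h"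
      then show ?thesis by (simp add: curl R'.magnetic_op[OF u] linear_neg[OF R'.G_linear(2)[OF u]])
    qed
    with c G show ?thesis by blast
  qed
qed

section \<open>Charts\<close>

lemma is_chartD:
  assumes "is_chart \<phi>"
  shows "open (fst \<phi>)" "open (chart_image \<phi>)"
    "continuous_on (fst \<phi>) (snd \<phi>)" "continuous_on (chart_image \<phi>) (chart_inv \<phi>)"
    "p \<in> fst \<phi> \<Longrightarrow> snd \<phi> p \<in> chart_image \<phi>" "u \<in> chart_image \<phi> \<Longrightarrow> chart_inv \<phi> u \<in> fst \<phi>"
    "p \<in> fst \<phi> \<Longrightarrow> chart_inv \<phi> (snd \<phi> p) = p" "u \<in> chart_image \<phi> \<Longrightarrow> snd \<phi> (chart_inv \<phi> u) = u"
  using assms unfolding is_chart_def homeomorphism_def by auto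

locale manifold_atlas =
  fixes A :: "('a::{t2_space,second_countable_topology}, 'e::euclidean_space) chart set"
  assumes atlas: "smooth_atlas A"
begin

lemma chart: "\<phi> \<in> A \<Longrightarrow> is_chart \<phi>"
  using atlas by (simp add: smooth_atlas_def)

lemma overlap_Ck:
  "\<phi> \<in> A \<Longrightarrow> \<psi> \<in> A \<Longrightarrow> Ck_on k (snd \<psi> \<circ> chart_inv \<phi>) (snd \<phi> ` (fst \<phi> \<inter> fst \<psi>))"
  using atlas by (simp add: smooth_atlas_def)

lemma overlap_open:
  assumes "\<phi> \<in> A" "\<psi> \<in> A" shows "open (snd \<phi> ` (fst \<phi> \<inter> fst \<psi>))"
proof -
  note \<phi> = is_chartD[OF chart[OF assms(1)]] and \<psi> = is_chartD[OF chart[OF assms(2)]]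
  have "snd \<phi> ` (fst \<phi> \<inter> fst \<psi>) = chart_image \<phi> \<inter> chart_inv \<phi> -` fst \<psi>"
  proof (intro equalityI subsetI)
    fix u assume "u \<in> chart_image \<phi> \<inter> chart_inv \<phi> -` fst \<psi>"
    then show "u \<in> snd \<phi> ` (fst \<phi> \<inter> fst \<psi>)"
      using \<phi>(6,8) by (intro image_eqI[of _ _ "chart_inv \<phi> u"]) auto
  qed (use \<phi>(5,7) in auto)
  then show ?thesis using continuous_open_preimage[OF \<phi>(4) \<phi>(2) \<psi>(1)] by simp
qed

lemma transition_has_derivative:
  assumes "\<phi> \<in> A" "\<psi> \<in> A" "p \<in> fst \<phi>" "p \<in> fst \<psi>"
  shows "((snd \<psi> \<circ> chart_inv \<phi>) has_derivative transition_deriv p \<phi> \<psi>) (at (snd \<phi> p))"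
proof -
  have "snd \<phi> p \<in> snd \<phi> ` (fst \<phi> \<inter> fst \<psi>)" using assms by auto
  then have "(snd \<psi> \<circ> chart_inv \<phi>) differentiable (at (snd \<phi> p))"
    using overlap_Ck[OF assms(1,2), of "Suc 0"] unfolding Ck_on_open_Suc_iff[OF overlap_open[OF assms(1,2)]] by blast
  then show ?thesis unfolding transition_deriv_def frechet_derivative_works .
qed

lemma linear_transition:
  assumes "\<phi> \<in> A" "\<psi> \<in> A" "p \<in> fst \<phi>" "p \<in> fst \<psi>" shows "linear (transition_deriv p \<phi> \<psi>)"
  using has_derivative_linear[OF transition_has_derivative[OF assms]] .

lemma transition_cocycle:
  assumes "\<xi> \<in> A" "\<phi> \<in> A" "\<psi> \<in> A" and p: "p \<in> fst \<xi>" "p \<in> fst \<phi>" "p \<in> fst \<psi>"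
  shows "transition_deriv p \<xi> \<psi> h = transition_deriv p \<phi> \<psi> (transition_deriv p \<xi> \<phi> h)"
proof -
  note \<xi> = is_chartD[OF chart[OF assms(1)]] and \<phi> = is_chartD[OF chart[OF assms(2)]]
  have e: "(snd \<phi> \<circ> chart_inv \<xi>) (snd \<xi> p) = snd \<phi> p" using \<xi>(7) p by simp
  have "((snd \<psi> \<circ> chart_inv \<phi>) has_derivative transition_deriv p \<phi> \<psi>)
     (at ((snd \<phi> \<circ> chart_inv \<xi>) (snd \<xi> p)))"
    unfolding e by (rule transition_has_derivative) (use assms in auto)
  from has_derivative_compose[OF transition_has_derivative[OF assms(1,2) p(1,2)] this]
  have d: "((\<lambda>u. (snd \<psi> \<circ> chart_inv \<phi>) ((snd \<phi> \<circ> chart_inv \<xi>) u)) has_derivative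
     (\<lambda>h. transition_deriv p \<phi> \<psi> (transition_deriv p \<xi> \<phi> h))) (at (snd \<xi> p))" .
  have "((snd \<psi> \<circ> chart_inv \<xi>) has_derivative
     (\<lambda>h. transition_deriv p \<phi> \<psi> (transition_deriv p \<xi> \<phi> h))) (at (snd \<xi> p))"
    by (rule has_derivative_transform_within_open[OF d overlap_open[OF assms(1,2)]])
      (use p \<xi>(7) \<phi>(7) in auto)
  from has_derivative_unique[OF transition_has_derivative[OF assms(1,3) p(1,3)] this]
  show ?thesis by metis
qed

lemma transition_self:
  assumes "\<phi> \<in> A" "p \<in> fst \<phi>" shows "transition_deriv p \<phi> \<phi> h = h"
proof -
  note \<phi> = is_chartD[OF chart[OF assms(1)]]
  have "((snd \<phi> \<circ> chart_inv \<phi>) has_derivative (\<lambda>h. h)) (at (snd \<phi> p))"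
    by (rule has_derivative_transform_within_open[OF has_derivative_ident \<phi>(2) \<phi>(5)[OF assms(2)]])
      (simp add: \<phi>(8))
  from has_derivative_unique[OF transition_has_derivative[OF assms(1,1,2,2)] this]
  show ?thesis by metis
qed

lemma coord_vector_at: "\<phi> \<in> A \<Longrightarrow> p \<in> fst \<phi> \<Longrightarrow> coord_vector A \<phi> p h \<phi> = h"
  by (simp add: coord_vector_def charts_at_def transition_self)

text \<open>Together with the next lemma: a chart identifies the tangent spaces at its points with the model
  space.\<close>

lemma tangent_space_coord:
  assumes "\<phi> \<in> A" "p \<in> fst \<phi>" "v \<in> tangent_space A p"
  shows "v = coord_vector A \<phi> p (v \<phi>)"
proof
  fix \<psi>
  have \<phi>: "\<phi> \<in> charts_at A p" using assms by (simp add: charts_at_def)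
  have 1: "\<forall>\<phi>\<in>charts_at A p. \<forall>\<psi>\<in>charts_at A p. v \<psi> = transition_deriv p \<phi> \<psi> (v \<phi>)"
    and 2: "\<forall>\<phi>. \<phi> \<notin> charts_at A p \<longrightarrow> v \<phi> = 0"
    using assms(3) unfolding tangent_space_def by blast+
  show "v \<psi> = coord_vector A \<phi> p (v \<phi>) \<psi>"
  proof (cases "\<psi> \<in> charts_at A p")
    case True
    show ?thesis using bspec[OF bspec[OF 1 \<phi>] True] unfolding coord_vector_def if_P[OF True] .
  next
    case False
    then show ?thesis using 2 unfolding coord_vector_def by (simp only: if_False) blast
  qed
qed

lemma coord_vector_tangent:
  assumes "\<phi> \<in> A" "p \<in> fst \<phi>" shows "coord_vector A \<phi> p h \<in> tangent_space A p"
proof -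
  have "transition_deriv p \<phi> \<psi> h = transition_deriv p \<xi> \<psi> (transition_deriv p \<phi> \<xi> h)"
    if "\<xi> \<in> charts_at A p" "\<psi> \<in> charts_at A p" for \<xi> \<psi>
    using that assms transition_cocycle[of \<phi> \<xi> \<psi> p h] by (simp add: charts_at_def)
  then have "coord_vector A \<phi> p h \<psi> = transition_deriv p \<xi> \<psi> (coord_vector A \<phi> p h \<xi>)"
    if "\<xi> \<in> charts_at A p" "\<psi> \<in> charts_at A p" for \<xi> \<psi>
    unfolding coord_vector_def if_P[OF that(1)] if_P[OF that(2)] using that by blast
  moreover have "coord_vector A \<phi> p h \<psi> = 0" if "\<psi> \<notin> charts_at A p" for \<psi>
    unfolding coord_vector_def if_not_P[OF that] ..
  ultimately show ?thesis unfolding tangent_space_def by blast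
qed

lemma coord_vector_uminus:
  assumes "\<phi> \<in> A" "p \<in> fst \<phi>"
  shows "(\<lambda>\<psi>. - coord_vector A \<phi> p h \<psi>) = coord_vector A \<phi> p (- h)"
proof
  fix \<psi>
  show "- coord_vector A \<phi> p h \<psi> = coord_vector A \<phi> p (- h) \<psi>"
  proof (cases "\<psi> \<in> charts_at A p")
    case True
    then have "linear (transition_deriv p \<phi> \<psi>)" using assms by (auto simp: charts_at_def intro: linear_transition)
    then show ?thesis using True by (simp add: coord_vector_def linear_neg)
  qed (simp add: coord_vector_def)
qed

text \<open>The components of a velocity in the other charts follow from those in one chart by the chain rule. It
  can be applied because the curve stays in the domain of that chart.\<close>

lemma velocity_coord:
  assumes \<phi>: "\<phi> \<in> A" and c: "c ` I \<subseteq> fst \<phi>" and t: "t \<in> I" "at t within I \<noteq> bot"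
    and d: "((snd \<phi> \<circ> c) has_vector_derivative v) (at t within I)"
  shows "velocity A I c t = coord_vector A \<phi> (c t) v"
proof
  fix \<psi>
  show "velocity A I c t \<psi> = coord_vector A \<phi> (c t) v \<psi>"
  proof (cases "\<psi> \<in> charts_at A (c t)")
    case True
    then have \<psi>: "\<psi> \<in> A" "c t \<in> fst \<psi>" by (auto simp: charts_at_def)
    have ct: "c t \<in> fst \<phi>" using c t by auto
    have "((snd \<psi> \<circ> chart_inv \<phi>) has_derivative transition_deriv (c t) \<phi> \<psi>) (at ((snd \<phi> \<circ> c) t))"
      using transition_has_derivative[OF \<phi> \<psi>(1) ct \<psi>(2)] by simp
    from has_derivative_compose[OF d[unfolded has_vector_derivative_def] this]
    have "((\<lambda>s. (snd \<psi> \<circ> chart_inv \<phi>) ((snd \<phi> \<circ> c) s)) has_derivative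
        (\<lambda>k. transition_deriv (c t) \<phi> \<psi> (k *\<^sub>R v))) (at t within I)" .
    then have "((snd \<psi> \<circ> c) has_derivative (\<lambda>k. transition_deriv (c t) \<phi> \<psi> (k *\<^sub>R v))) (at t within I)"
      by (rule has_derivative_transform[OF t(1), rotated])
        (use c is_chartD(7)[OF chart[OF \<phi>]] in auto)
    then have "((snd \<psi> \<circ> c) has_vector_derivative transition_deriv (c t) \<phi> \<psi> v) (at t within I)"
      by (simp add: has_vector_derivative_def linear_cmul[OF linear_transition[OF \<phi> \<psi>(1) ct \<psi>(2)]])
    then have "vector_derivative (snd \<psi> \<circ> c) (at t within I) = transition_deriv (c t) \<phi> \<psi> v"
      by (rule vector_derivative_within[OF t(2)])
    then show ?thesis using True by (simp add: velocity_def coord_vector_def)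
  qed (simp add: velocity_def coord_vector_def)
qed

end

section \<open>Geodesics of a Randers metric in a chart\<close>

lemma Ck_on_2_curve:
  fixes x :: "real \<Rightarrow> 'e::euclidean_space"
  assumes "\<And>t. t \<in> I \<Longrightarrow> (x has_vector_derivative v t) (at t within I)"
    "\<And>t. t \<in> I \<Longrightarrow> (v has_vector_derivative w t) (at t within I)" "continuous_on I w"
  shows "Ck_on 2 x I"
proof -
  have "Ck_on 1 (\<lambda>t. k *\<^sub>R v t) I" for k
    unfolding One_nat_def Ck_on.simps
  proof (intro exI[of _ "\<lambda>t h. k *\<^sub>R h *\<^sub>R w t"] conjI ballI allI)
    show "((\<lambda>t. k *\<^sub>R v t) has_derivative (\<lambda>h. k *\<^sub>R h *\<^sub>R w t)) (at t within I)" if "t \<in> I" for t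
      using assms(2)[OF that] unfolding has_vector_derivative_def by (rule has_derivative_scaleR_right)
    show "continuous_on I (\<lambda>t. k *\<^sub>R h *\<^sub>R w t)" for h by (intro continuous_intros assms(3))
  qed
  then have "Ck_on (Suc 1) x I" unfolding Ck_on.simps(2)
    by (intro exI[of _ "\<lambda>t k. k *\<^sub>R v t"]) (use assms(1) in \<open>simp add: has_vector_derivative_def\<close>)
  then show ?thesis by (simp only: one_add_one[symmetric] Suc_eq_plus1)
qed

lemma Ck_on_2_curveD:
  fixes x :: "real \<Rightarrow> 'e::euclidean_space"
  assumes "Ck_on 2 x I"
  obtains v w where "\<And>t. t \<in> I \<Longrightarrow> (x has_vector_derivative v t) (at t within I)"
    "\<And>t. t \<in> I \<Longrightarrow> (v has_vector_derivative w t) (at t within I)" "continuous_on I w"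
proof -
  have lin: "(f has_vector_derivative D t 1) (at t within I)" 
    if "\<forall>t\<in>I. (f has_derivative D t) (at t within I)" "t \<in> I" for f :: "real \<Rightarrow> 'e" and D t
  proof -
    have d: "(f has_derivative D t) (at t within I)" using that by blast
    have "linear (D t)" using has_derivative_linear[OF d] .
    then have "D t = (\<lambda>k. k *\<^sub>R D t 1)" by (metis linear_cmul mult.right_neutral real_scaleR_def)
    then show ?thesis unfolding has_vector_derivative_def using d by metis
  qed
  obtain D where D: "\<forall>t\<in>I. (x has_derivative D t) (at t within I)" "\<forall>h. Ck_on 1 (\<lambda>t. D t h) I"
    using assms unfolding numeral_2_eq_2 Ck_on.simps(2)[of "Suc 0"] One_nat_def by blast
  obtain E where E: "\<forall>t\<in>I. ((\<lambda>t. D t 1) has_derivative E t) (at t within I)" "\<forall>h. continuous_on I (\<lambda>t. E t h)"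
    using D(2)[rule_format, of 1] unfolding One_nat_def Ck_on.simps by blast
  show thesis using that[of "\<lambda>t. D t 1" "\<lambda>t. E t 1"] lin[OF D(1)] lin[OF E(1)] E(2) by blast
qed

text \<open>The partial derivatives in the form in which the length functional and the first variation refer to them.\<close>

lemma Ck_on_2_strip_derivatives:
  fixes y :: "real \<times> real \<Rightarrow> 'e::euclidean_space"
  assumes "Ck_on 2 y ({-\<epsilon><..<\<epsilon>} \<times> {a..b})" "\<epsilon> > 0" "t \<in> {a..b}"
  shows "s \<in> {-\<epsilon><..<\<epsilon>} \<Longrightarrow>
     ((\<lambda>t. y (s, t)) has_vector_derivative vector_derivative (\<lambda>t. y (s, t)) (at t within {a..b})) (at t within {a..b})"
    and "((\<lambda>s. y (s, t)) has_vector_derivative vector_derivative (\<lambda>s. y (s, t)) (at 0)) (at 0)"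
proof -
  let ?S = "{-\<epsilon><..<\<epsilon>} \<times> {a..b}"
  obtain D where D: "\<forall>z\<in>?S. (y has_derivative D z) (at z within ?S)"
    using assms(1) unfolding numeral_2_eq_2 Ck_on.simps(2)[of "Suc 0"] by blast
  show "((\<lambda>t. y (s, t)) has_vector_derivative vector_derivative (\<lambda>t. y (s, t)) (at t within {a..b})) (at t within {a..b})"
    if s: "s \<in> {-\<epsilon><..<\<epsilon>}"
    using differentiableI_vector[OF strip_partial_derivatives(1)[OF D s assms(3)]]
    by (simp add: vector_derivative_works)
  have "(\<lambda>s. y (s, t)) differentiable (at 0)"
    using differentiableI_vector[OF strip_partial_derivatives(2)[OF D _ assms(3), of 0]] assms(2)
    by (simp add: at_0_within_open_interval)
  then show "((\<lambda>s. y (s, t)) has_vector_derivative vector_derivative (\<lambda>s. y (s, t)) (at 0)) (at 0)"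
    by (simp add: vector_derivative_works)
qed

context manifold_atlas begin

definition randers_in_chart :: "('a, 'e) chart \<Rightarrow> ('a, 'e) tfun
    \<Rightarrow> ('e \<Rightarrow> 'e \<Rightarrow> 'e \<Rightarrow> real) \<Rightarrow> ('e \<Rightarrow> 'e \<Rightarrow> real) \<Rightarrow> bool" where
  "randers_in_chart \<phi> F G W \<longleftrightarrow> \<phi> \<in> A \<and> local_randers (chart_image \<phi>) G W \<and>
     (\<forall>u\<in>chart_image \<phi>. \<forall>h. loc1 A \<phi> F u h = sqrt (G u h h) + W u h)"

lemma length_functional_in_chart:
  assumes F: "randers_in_chart \<phi> F G W" and ab: "a < b" and c: "c ` {a..b} \<subseteq> fst \<phi>"
    and d: "\<And>t. t \<in> {a..b} \<Longrightarrow> ((snd \<phi> \<circ> c) has_vector_derivative q t) (at t within {a..b})"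
  shows "length_functional A F a b c
    = integral {a..b} (\<lambda>t. sqrt (G (snd \<phi> (c t)) (q t) (q t)) + W (snd \<phi> (c t)) (q t))"
  unfolding length_functional_def
proof (rule integral_cong)
  fix t assume t: "t \<in> {a..b}"
  have \<phi>: "\<phi> \<in> A" using F by (simp add: randers_in_chart_def)
  note ch = is_chartD[OF chart[OF \<phi>]]
  have ct: "c t \<in> fst \<phi>" by (rule subsetD[OF c imageI[OF t]])
  have "at t within {a..b} \<noteq> bot" using t ab by (simp add: trivial_limit_within islimpt_Icc)
  from velocity_coord[OF \<phi> c t this d[OF t]]
  have "F (c t) (velocity A {a..b} c t) = loc1 A \<phi> F (snd \<phi> (c t)) (q t)"
    by (simp add: loc1_def ch(7)[OF ct])
  then show "F (c t) (velocity A {a..b} c t) = sqrt (G (snd \<phi> (c t)) (q t) (q t)) + W (snd \<phi> (c t)) (q t)"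
    using F ch(5)[OF ct] by (simp add: randers_in_chart_def)
qed

text \<open>Curves of the variation with small parameter stay in the chart that contains the central curve, so the
  first variation formula in that chart applies.\<close>

lemma variation_derivative:
  fixes \<Gamma> :: "real \<times> real \<Rightarrow> 'a"
  assumes F: "randers_in_chart \<phi> F G W" and ab: "a < b" and eps: "\<epsilon> > 0"
    and \<Gamma>: "Ck_map A 2 ({-\<epsilon><..<\<epsilon>} \<times> {a..b}) \<Gamma>" "\<And>t. t \<in> {a..b} \<Longrightarrow> \<Gamma> (0, t) = c t"
      "\<And>s. s \<in> {-\<epsilon><..<\<epsilon>} \<Longrightarrow> \<Gamma> (s, a) = c a \<and> \<Gamma> (s, b) = c b"
    and c: "c ` {a..b} \<subseteq> fst \<phi>"
    and v: "\<And>t. t \<in> {a..b} \<Longrightarrow> ((snd \<phi> \<circ> c) has_vector_derivative v t) (at t within {a..b})"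
    and w: "\<And>t. t \<in> {a..b} \<Longrightarrow> (v has_vector_derivative w t) (at t within {a..b})"
    and reg: "\<And>t. t \<in> {a..b} \<Longrightarrow> v t \<noteq> 0"
  shows "((\<lambda>s. length_functional A F a b (\<lambda>t. \<Gamma> (s, t))) has_real_derivative
     - integral {a..b} (\<lambda>t. euler_lagrange G W (snd \<phi> (c t)) (v t) (w t)
            (vector_derivative (\<lambda>s. snd \<phi> (\<Gamma> (s, t))) (at 0))
         / sqrt (G (snd \<phi> (c t)) (v t) (v t)) ^ 3)) (at 0)"
proof -
  have \<phi>: "\<phi> \<in> A" using F by (simp add: randers_in_chart_def)
  interpret local_randers "chart_image \<phi>" G W using F by (simp add: randers_in_chart_def)
  note ch = is_chartD[OF chart[OF \<phi>]]
  have \<Gamma>c: "continuous_on ({-\<epsilon><..<\<epsilon>} \<times> {a..b}) \<Gamma>" using \<Gamma>(1) by (simp add: Ck_map_def)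
  obtain \<delta> where \<delta>: "\<delta> > 0" "\<delta> \<le> \<epsilon>"
    "\<And>s t. s \<in> {-\<delta><..<\<delta>} \<Longrightarrow> t \<in> {a..b} \<Longrightarrow> \<Gamma> (s, t) \<in> fst \<phi>"
    using tube_around_zero[OF \<Gamma>c ch(1) eps] \<Gamma>(2) c by (metis image_subset_iff)
  let ?T = "{-\<delta><..<\<delta>} \<times> {a..b}"
  define y where "y z = snd \<phi> (\<Gamma> z)" for z
  have "Ck_on 2 (snd \<phi> \<circ> \<Gamma>) (({-\<epsilon><..<\<epsilon>} \<times> {a..b}) \<inter> \<Gamma> -` fst \<phi>)"
    using \<Gamma>(1) \<phi> by (simp add: Ck_map_def)
  then have "Ck_on 2 (snd \<phi> \<circ> \<Gamma>) ?T" by (rule Ck_on_subset) (use \<delta> in auto)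
  then have y2: "Ck_on 2 y ?T" by (simp add: y_def[abs_def] comp_def)
  have yU: "y ` ?T \<subseteq> chart_image \<phi>" using \<delta>(3) ch(5) by (auto simp: y_def)
  have y0: "y (0, t) = snd \<phi> (c t)" if "t \<in> {a..b}" for t using \<Gamma>(2) that by (simp add: y_def)
  note sd = Ck_on_2_strip_derivatives[OF y2 \<delta>(1)]
  let ?q = "\<lambda>s t. vector_derivative (\<lambda>t. y (s, t)) (at t within {a..b})"
  have fv: "((\<lambda>s. integral {a..b} (\<lambda>t. sqrt (G (y (s, t)) (?q s t) (?q s t)) + W (y (s, t)) (?q s t)))
      has_real_derivative
      - integral {a..b} (\<lambda>t. euler_lagrange G W (y (0, t)) (v t) (w t) (vector_derivative (\<lambda>s. y (s, t)) (at 0))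
           / sqrt (G (y (0, t)) (v t) (v t)) ^ 3)) (at 0)"
  proof (rule first_variation[OF ab \<delta>(1) y2 yU])
    show "y (s, a) = y (0, a)" "y (s, b) = y (0, b)" if "s \<in> {-\<delta><..<\<delta>}" for s
      using \<Gamma>(3)[of s] \<Gamma>(3)[of 0] that \<delta> ab eps by (auto simp: y_def)
    show "((\<lambda>t. y (0, t)) has_vector_derivative v t) (at t within {a..b})" if t: "t \<in> {a..b}" for t
      by (rule has_vector_derivative_transform[OF t _ v[OF t]]) (simp add: y0)
    show "((\<lambda>s. y (s, t)) has_vector_derivative vector_derivative (\<lambda>s. y (s, t)) (at 0)) (at 0)" if t: "t \<in> {a..b}" for t
      by (rule sd(2)[OF t])
  qed (use w reg in auto)
  have len: "integral {a..b} (\<lambda>t. sqrt (G (y (s, t)) (?q s t) (?q s t)) + W (y (s, t)) (?q s t))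
    = length_functional A F a b (\<lambda>t. \<Gamma> (s, t))" if s: "s \<in> {-\<delta><..<\<delta>}" for s
    unfolding y_def
    by (rule length_functional_in_chart[OF F ab, symmetric])
      (use \<delta>(3) s sd(1)[OF _ s] in \<open>auto simp: y_def comp_def\<close>)
  have eq: "integral {a..b} (\<lambda>t. euler_lagrange G W (y (0, t)) (v t) (w t) (vector_derivative (\<lambda>s. y (s, t)) (at 0))
           / sqrt (G (y (0, t)) (v t) (v t)) ^ 3)
    = integral {a..b} (\<lambda>t. euler_lagrange G W (snd \<phi> (c t)) (v t) (w t)
            (vector_derivative (\<lambda>s. snd \<phi> (\<Gamma> (s, t))) (at 0)) / sqrt (G (snd \<phi> (c t)) (v t) (v t)) ^ 3)"
    by (rule integral_cong) (simp only: y0, simp add: y_def)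
  show ?thesis
    by (rule has_field_derivative_transform_within_open[OF fv[unfolded eq], of "{-\<delta><..<\<delta>}"])
      (use \<delta>(1) len in auto)
qed

lemma extremal_if_euler_lagrange:
  assumes F: "randers_in_chart \<phi> F G W" and ab: "a \<le> b"
    and c: "c ` {a..b} \<subseteq> fst \<phi>"
    and v: "\<And>t. t \<in> {a..b} \<Longrightarrow> ((snd \<phi> \<circ> c) has_vector_derivative v t) (at t within {a..b})"
    and w: "\<And>t. t \<in> {a..b} \<Longrightarrow> (v has_vector_derivative w t) (at t within {a..b})"
    and reg: "\<And>t. t \<in> {a..b} \<Longrightarrow> v t \<noteq> 0"
    and EL: "\<And>t e. t \<in> {a..b} \<Longrightarrow> euler_lagrange G W (snd \<phi> (c t)) (v t) (w t) e = 0"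
  shows "extremal A F a b c"
proof (cases "a = b")
  case True
  then show ?thesis by (simp add: extremal_def length_functional_def)
next
  case False
  show ?thesis unfolding extremal_def
  proof (intro allI impI)
    fix \<epsilon> :: real and \<Gamma> :: "real \<times> real \<Rightarrow> 'a"
    assume \<Gamma>: "\<epsilon> > 0" "Ck_map A 2 ({-\<epsilon><..<\<epsilon>} \<times> {a..b}) \<Gamma>" "\<forall>t\<in>{a..b}. \<Gamma> (0, t) = c t"
      "\<forall>s\<in>{-\<epsilon><..<\<epsilon>}. \<Gamma> (s, a) = c a \<and> \<Gamma> (s, b) = c b"
    have "((\<lambda>s. length_functional A F a b (\<lambda>t. \<Gamma> (s, t))) has_real_derivative
     - integral {a..b} (\<lambda>t. euler_lagrange G W (snd \<phi> (c t)) (v t) (w t)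
            (vector_derivative (\<lambda>s. snd \<phi> (\<Gamma> (s, t))) (at 0))
         / sqrt (G (snd \<phi> (c t)) (v t) (v t)) ^ 3)) (at 0)"
      by (rule variation_derivative[OF F _ \<Gamma>(1,2) _ _ c v w reg]) (use False ab \<Gamma> in auto)
    moreover have "integral {a..b} (\<lambda>t. euler_lagrange G W (snd \<phi> (c t)) (v t) (w t)
            (vector_derivative (\<lambda>s. snd \<phi> (\<Gamma> (s, t))) (at 0))
         / sqrt (G (snd \<phi> (c t)) (v t) (v t)) ^ 3) = integral {a..b} (\<lambda>t. 0)"
      by (rule integral_cong) (simp add: EL)
    ultimately show "((\<lambda>s. length_functional A F a b (\<lambda>t. \<Gamma> (s, t))) has_real_derivative 0) (at 0)" by simp
  qed
qed

text \<open>Test with the variations that in the chart read \<open>x t + s * (t - a) * (b - t) * p t *\<^sub>R e\<close> with a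
  polynomial \<open>p\<close>. They fix the end points.\<close>

lemma euler_lagrange_if_extremal:
  assumes F: "randers_in_chart \<phi> F G W" and ab: "a < b" and ext: "extremal A F a b c"
    and c: "c ` {a..b} \<subseteq> fst \<phi>"
    and v: "\<And>t. t \<in> {a..b} \<Longrightarrow> ((snd \<phi> \<circ> c) has_vector_derivative v t) (at t within {a..b})"
    and w: "\<And>t. t \<in> {a..b} \<Longrightarrow> (v has_vector_derivative w t) (at t within {a..b})"
    and wc: "continuous_on {a..b} w"
    and reg: "\<And>t. t \<in> {a..b} \<Longrightarrow> v t \<noteq> 0"
    and t: "t \<in> {a..b}"
  shows "euler_lagrange G W (snd \<phi> (c t)) (v t) (w t) e = 0"
proof -
  have \<phi>: "\<phi> \<in> A" using F by (simp add: randers_in_chart_def)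
  interpret local_randers "chart_image \<phi>" G W using F by (simp add: randers_in_chart_def)
  note ch = is_chartD[OF chart[OF \<phi>]]
  define x where "x t = snd \<phi> (c t)" for t
  have x: "(x has_vector_derivative v t) (at t within {a..b})" if "t \<in> {a..b}" for t
    using v[OF that] by (simp add: x_def[abs_def] comp_def)
  have x2: "Ck_on 2 x {a..b}" by (rule Ck_on_2_curve[OF x w wc])
  have xc: "continuous_on {a..b} x" by (rule Ck_on_continuous[OF x2])
  have vc: "continuous_on {a..b} v"
    unfolding continuous_on_eq_continuous_within using has_vector_derivative_continuous[OF w] by blast
  have xU: "x t \<in> chart_image \<phi>" if "t \<in> {a..b}" for t
    unfolding x_def by (rule ch(5)[OF subsetD[OF c imageI[OF that]]])
  define N where "N t = sqrt (G (x t) (v t) (v t))" for t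
  have Npos: "N t > 0" if "t \<in> {a..b}" for t
    unfolding N_def using G_pos[OF xU[OF that] reg[OF that]] by simp
  define f where "f t = euler_lagrange G W (x t) (v t) (w t) e / N t ^ 3" for t
  have Nc: "continuous_on {a..b} N" unfolding N_def
    using xU by (intro continuous_intros G_continuous xc vc) auto
  have fc: "continuous_on {a..b} f" unfolding f_def
    using xU Npos by (intro continuous_intros euler_lagrange_continuous xc vc wc Nc) force+
  have "f t = 0"
  proof (rule fundamental_lemma_polynomial[OF ab fc _ t])
    fix p :: "real \<Rightarrow> real" assume p: "real_polynomial_function p"
    define r where "r t = (t - a) * (b - t) * p t" for t
    define y where "y z = x (snd z) + (fst z * r (snd z)) *\<^sub>R e" for z :: "real \<times> real"
    let ?S = "\<lambda>\<epsilon>. {-\<epsilon><..<\<epsilon>} \<times> {a..b}"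
    have r2: "Ck_on 2 r {a..b}" 
    proof -
      have "Ck_on 2 (\<lambda>t. (t + - a) * (b + - t) * p t) {a..b}"
        by (intro Ck_on_mult Ck_on_add Ck_on_minus Ck_on_const Ck_on_ident real_polynomial_function_Ck p)
      then show ?thesis by (simp add: r_def[abs_def])
    qed
    have y2: "Ck_on 2 y (?S \<epsilon>)" for \<epsilon> unfolding y_def
      by (intro Ck_on_add Ck_on_scaleR Ck_on_mult Ck_on_const Ck_on_fst Ck_on_ident
          Ck_on_compose[OF x2 Ck_on_snd[OF Ck_on_ident]] Ck_on_compose[OF r2 Ck_on_snd[OF Ck_on_ident]]) auto
    obtain \<epsilon> where \<epsilon>: "\<epsilon> > 0" "\<And>s t. s \<in> {-\<epsilon><..<\<epsilon>} \<Longrightarrow> t \<in> {a..b} \<Longrightarrow> y (s, t) \<in> chart_image \<phi>"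
    proof -
      have "y (0, t) \<in> chart_image \<phi>" if "t \<in> {a..b}" for t using xU[OF that] by (simp add: y_def)
      from tube_around_zero[OF Ck_on_continuous[OF y2[of 1]] ch(2) zero_less_one this]
      show thesis using that by metis
    qed
    define \<Gamma> where "\<Gamma> z = chart_inv \<phi> (y z)" for z
    have yU: "y ` ?S \<epsilon> \<subseteq> chart_image \<phi>" using \<epsilon>(2) by auto
    have \<Gamma>\<phi>: "\<Gamma> z \<in> fst \<phi>" "snd \<phi> (\<Gamma> z) = y z" if "z \<in> ?S \<epsilon>" for z
      using yU that ch(6,8) by (auto simp: \<Gamma>_def)
    have \<Gamma>0: "\<Gamma> (0, t) = c t" if "t \<in> {a..b}" for t
      using ch(7)[OF subsetD[OF c imageI[OF that]]] by (simp add: \<Gamma>_def y_def x_def)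
    have \<Gamma>ab: "\<Gamma> (s, a) = c a \<and> \<Gamma> (s, b) = c b" for s
      using ch(7)[OF subsetD[OF c imageI[of a]]] ch(7)[OF subsetD[OF c imageI[of b]]] ab
      by (simp add: \<Gamma>_def y_def x_def r_def)
    have "Ck_map A 2 (?S \<epsilon>) \<Gamma>" unfolding Ck_map_def
    proof (intro conjI ballI)
      show "\<Gamma> ` ?S \<epsilon> \<subseteq> points A" using \<Gamma>\<phi>(1) \<phi> by (auto simp: points_def)
      show "continuous_on (?S \<epsilon>) \<Gamma>" unfolding \<Gamma>_def
        by (rule continuous_on_compose2[OF ch(4) Ck_on_continuous[OF y2] yU])
      fix \<psi> assume \<psi>: "\<psi> \<in> A"
      have "Ck_on 2 (\<lambda>z. (snd \<psi> \<circ> chart_inv \<phi>) (y z)) (?S \<epsilon> \<inter> \<Gamma> -` fst \<psi>)"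
      proof (rule Ck_on_compose[OF overlap_Ck[OF \<phi> \<psi>] Ck_on_subset[OF y2]])
        show "y ` (?S \<epsilon> \<inter> \<Gamma> -` fst \<psi>) \<subseteq> snd \<phi> ` (fst \<phi> \<inter> fst \<psi>)"
        proof
          fix q assume "q \<in> y ` (?S \<epsilon> \<inter> \<Gamma> -` fst \<psi>)"
          then obtain z where z: "z \<in> ?S \<epsilon>" "\<Gamma> z \<in> fst \<psi>" "q = y z" by auto
          then show "q \<in> snd \<phi> ` (fst \<phi> \<inter> fst \<psi>)"
            using \<Gamma>\<phi>[OF z(1)] by (intro image_eqI[of _ _ "\<Gamma> z"]) auto
        qed
      qed auto
      then show "Ck_on 2 (snd \<psi> \<circ> \<Gamma>) (?S \<epsilon> \<inter> \<Gamma> -` fst \<psi>)" by (simp add: comp_def \<Gamma>_def[abs_def])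
    qed
    note \<Gamma> = \<epsilon>(1) this \<Gamma>0 \<Gamma>ab
    have "((\<lambda>s. length_functional A F a b (\<lambda>t. \<Gamma> (s, t))) has_real_derivative 0) (at 0)"
      using ext \<Gamma> unfolding extremal_def by blast
    from DERIV_unique[OF this variation_derivative[OF F ab \<Gamma> c v w reg]]
    have zero: "integral {a..b} (\<lambda>t. euler_lagrange G W (snd \<phi> (c t)) (v t) (w t)
            (vector_derivative (\<lambda>s. snd \<phi> (\<Gamma> (s, t))) (at 0))
         / sqrt (G (snd \<phi> (c t)) (v t) (v t)) ^ 3) = 0" by simp
    have integrand: "euler_lagrange G W (snd \<phi> (c t)) (v t) (w t)
            (vector_derivative (\<lambda>s. snd \<phi> (\<Gamma> (s, t))) (at 0))
         / sqrt (G (snd \<phi> (c t)) (v t) (v t)) ^ 3 = f t * ((t - a) * (b - t) * p t)" if t: "t \<in> {a..b}" for t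
    proof -
      have "((\<lambda>s. x t + (s * r t) *\<^sub>R e) has_vector_derivative r t *\<^sub>R e) (at 0)"
        by (auto intro!: derivative_eq_intros simp: has_vector_derivative_def)
      then have "((\<lambda>s. snd \<phi> (\<Gamma> (s, t))) has_vector_derivative r t *\<^sub>R e) (at 0)"
        by (rule has_vector_derivative_transform_within_open[of _ _ _ "{-\<epsilon><..<\<epsilon>}"])
          (use \<epsilon>(1) t \<Gamma>\<phi>(2) in \<open>auto simp: y_def\<close>)
      then have "vector_derivative (\<lambda>s. snd \<phi> (\<Gamma> (s, t))) (at 0) = r t *\<^sub>R e"
        by (rule vector_derivative_at)
      then show ?thesis
        by (simp add: f_def N_def x_def[symmetric] r_def linear_cmul[OF linear_euler_lagrange[OF xU[OF t]]])
    qed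
    show "integral {a..b} (\<lambda>t. f t * ((t - a) * (b - t) * p t)) = 0"
      by (rule trans[OF _ zero], rule integral_cong, rule integrand[symmetric])
  qed
  then show ?thesis using Npos[OF t] by (simp add: f_def x_def)
qed

text \<open>The Euler-Lagrange equation holds on a small interval on one side of the parameter \<open>s0\<close> that \<open>\<tau>\<close>
  sends to \<open>0\<close>, end points included, and its invariance under reparametrization carries it back to
  \<open>c\<close>.\<close>

lemma euler_lagrange_of_reparametrized_geodesic:
  assumes F: "randers_in_chart \<phi> F G W" and geo: "forward_geodesic A F J (c \<circ> \<tau>)"
    and \<tau>: "increasing_reparam J {0..T} \<tau>"
    and T: "T > 0" and c: "c ` {0..T} \<subseteq> fst \<phi>"
    and v: "\<And>t. t \<in> {0..T} \<Longrightarrow> ((snd \<phi> \<circ> c) has_vector_derivative v t) (at t within {0..T})"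
    and w: "\<And>t. t \<in> {0..T} \<Longrightarrow> (v has_vector_derivative w t) (at t within {0..T})"
    and wc: "continuous_on {0..T} w"
    and reg: "\<And>t. t \<in> {0..T} \<Longrightarrow> v t \<noteq> 0"
  shows "euler_lagrange G W (snd \<phi> (c 0)) (v 0) (w 0) e = 0"
proof -
  have \<phi>: "\<phi> \<in> A" using F by (simp add: randers_in_chart_def)
  interpret local_randers "chart_image \<phi>" G W using F by (simp add: randers_in_chart_def)
  note ch = is_chartD[OF chart[OF \<phi>]]
  have J: "is_interval J" "interior J \<noteq> {}" and img: "\<tau> ` J = {0..T}" and \<tau>2: "Ck_on 2 \<tau> J"
    and \<tau>pos: "\<And>s. s \<in> J \<Longrightarrow> vector_derivative \<tau> (at s within J) > 0"
    using \<tau> by (auto simp: increasing_reparam_def nontrivial_interval_def)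
  obtain s0 where s0: "s0 \<in> J" "\<tau> s0 = 0" using img T by (metis (no_types, lifting) atLeastAtMost_iff imageE less_imp_le order_refl)
  obtain \<delta> where \<delta>: "\<delta> > 0" "\<forall>a\<in>J. \<forall>b\<in>J. \<bar>a - s0\<bar> < \<delta> \<longrightarrow> \<bar>b - s0\<bar> < \<delta> \<longrightarrow> a \<le> b \<longrightarrow> extremal A F a b (c \<circ> \<tau>)"
    using geo s0(1) unfolding forward_geodesic_def by blast
  obtain a b where ab: "a < b" "{a..b} \<subseteq> J" "s0 \<in> {a..b}" "\<bar>a - s0\<bar> < \<delta>" "\<bar>b - s0\<bar> < \<delta>"
  proof -
    obtain s1 where s1: "s1 \<in> J" "s1 \<noteq> s0"
    proof -
      have "\<not> J \<subseteq> {s0}"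
      proof
        assume "J \<subseteq> {s0}"
        then have "interior J \<subseteq> {s0}" using interior_subset[of J] by (rule order.trans[rotated])
        then have "finite (interior J)" by (rule finite_subset) simp
        from finite_imp_not_open[OF this open_interior] show False using J(2) by contradiction
      qed
      then show thesis using that by blast
    qed
    have int: "{x..y} \<subseteq> J" if "x \<in> J" "y \<in> J" for x y
      using mem_is_interval_1_I[OF J(1) that] by (simp add: subset_iff)
    show thesis
    proof (cases "s0 < s1")
      case True
      have "s0 + min (\<delta> / 2) (s1 - s0) \<in> J" using int[OF s0(1) s1(1)] True \<delta>(1) by (auto simp: min_def)
      from int[OF s0(1) this] show thesis
        by (intro that[of s0 "s0 + min (\<delta> / 2) (s1 - s0)"]) (use True \<delta>(1) in \<open>auto simp: min_def\<close>)
    next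
      case False
      then have lt: "s1 < s0" using s1 by simp
      have "s0 - min (\<delta> / 2) (s0 - s1) \<in> J" using int[OF s1(1) s0(1)] lt \<delta>(1) by (auto simp: min_def)
      from int[OF this s0(1)] show thesis
        by (intro that[of "s0 - min (\<delta> / 2) (s0 - s1)" s0]) (use lt \<delta>(1) in \<open>auto simp: min_def\<close>)
    qed
  qed
  have ext: "extremal A F a b (c \<circ> \<tau>)" using \<delta>(2) ab by (auto simp: subset_iff)
  obtain \<tau>' \<tau>'' where \<tau>': "\<And>s. s \<in> J \<Longrightarrow> (\<tau> has_vector_derivative \<tau>' s) (at s within J)"
    "\<And>s. s \<in> J \<Longrightarrow> (\<tau>' has_vector_derivative \<tau>'' s) (at s within J)" "continuous_on J \<tau>''"
    using Ck_on_2_curveD[OF \<tau>2] by blast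
  note sub = has_vector_derivative_within_subset[OF _ ab(2)]
  have nb: "at s within {a..b} \<noteq> bot" if "s \<in> {a..b}" for s
    using that ab(1) by (simp add: trivial_limit_within islimpt_Icc)
  have l: "\<tau>' s > 0" if s: "s \<in> {a..b}" for s
  proof -
    have sJ: "s \<in> J" using s ab(2) by blast
    have "at s within J \<noteq> bot" using nb[OF s] at_le[OF ab(2), of s] by (metis bot.extremum_uniqueI)
    from vector_derivative_within[OF this \<tau>'(1)[OF sJ]] show ?thesis using \<tau>pos[OF sJ] by simp
  qed
  have \<tau>T: "\<tau> s \<in> {0..T}" if "s \<in> {a..b}" for s using img that ab(2) by blast
  have comp: "((\<lambda>s. f (\<tau> s)) has_vector_derivative \<tau>' s *\<^sub>R f' (\<tau> s)) (at s within {a..b})"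
    if s: "s \<in> {a..b}" and f: "\<And>t. t \<in> {0..T} \<Longrightarrow> (f has_vector_derivative f' t) (at t within {0..T})"
    for f f' :: "real \<Rightarrow> 'e" and s
  proof -
    have "(\<tau> has_vector_derivative \<tau>' s) (at s within {a..b})" using sub[OF \<tau>'(1)] s ab(2) by blast
    moreover have "(f has_vector_derivative f' (\<tau> s)) (at (\<tau> s) within \<tau> ` {a..b})"
      by (rule has_vector_derivative_within_subset[OF f]) (use \<tau>T s in auto)
    ultimately have "((f \<circ> \<tau>) has_vector_derivative \<tau>' s *\<^sub>R f' (\<tau> s)) (at s within {a..b})"
      by (rule vector_diff_chain_within)
    then show ?thesis by (simp add: comp_def)
  qed
  have "euler_lagrange G W (snd \<phi> ((c \<circ> \<tau>) s0)) (\<tau>' s0 *\<^sub>R v (\<tau> s0))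
     (\<tau>'' s0 *\<^sub>R v (\<tau> s0) + (\<tau>' s0)\<^sup>2 *\<^sub>R w (\<tau> s0)) e = 0"
  proof (rule euler_lagrange_if_extremal[OF F ab(1) ext, where v = "\<lambda>s. \<tau>' s *\<^sub>R v (\<tau> s)"
        and w = "\<lambda>s. \<tau>'' s *\<^sub>R v (\<tau> s) + (\<tau>' s)\<^sup>2 *\<^sub>R w (\<tau> s)"])
    show "(c \<circ> \<tau>) ` {a..b} \<subseteq> fst \<phi>" using c \<tau>T by auto
    fix s assume s: "s \<in> {a..b}"
    then have sJ: "s \<in> J" using ab(2) by blast
    show "((snd \<phi> \<circ> (c \<circ> \<tau>)) has_vector_derivative \<tau>' s *\<^sub>R v (\<tau> s)) (at s within {a..b})"
      using comp[OF s, of "snd \<phi> \<circ> c" v] v by (simp add: comp_def)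
    have "((\<lambda>s. \<tau>' s *\<^sub>R v (\<tau> s)) has_vector_derivative \<tau>' s *\<^sub>R (\<tau>' s *\<^sub>R w (\<tau> s)) + \<tau>'' s *\<^sub>R v (\<tau> s)) (at s within {a..b})"
      by (intro has_vector_derivative_scaleR comp[OF s w])
        (use sub[OF \<tau>'(2)[OF sJ]] in \<open>auto simp: has_real_derivative_iff_has_vector_derivative\<close>)
    then show "((\<lambda>s. \<tau>' s *\<^sub>R v (\<tau> s)) has_vector_derivative \<tau>'' s *\<^sub>R v (\<tau> s) + (\<tau>' s)\<^sup>2 *\<^sub>R w (\<tau> s)) (at s within {a..b})"
      by (simp add: power2_eq_square add.commute)
    show "\<tau>' s *\<^sub>R v (\<tau> s) \<noteq> 0" using l[OF s] reg[OF \<tau>T[OF s]] by simp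
  next
    have vc: "continuous_on {0..T} v"
      unfolding continuous_on_eq_continuous_within using has_vector_derivative_continuous[OF w] by blast
    have \<tau>c: "continuous_on {a..b} \<tau>" "continuous_on {a..b} \<tau>'" "continuous_on {a..b} \<tau>''"
      using continuous_on_subset[OF Ck_on_continuous[OF \<tau>2] ab(2)] continuous_on_subset[OF \<tau>'(3) ab(2)]
      unfolding continuous_on_eq_continuous_within
      using has_vector_derivative_continuous[OF sub[OF \<tau>'(2)]] ab(2) by auto
    show "continuous_on {a..b} (\<lambda>s. \<tau>'' s *\<^sub>R v (\<tau> s) + (\<tau>' s)\<^sup>2 *\<^sub>R w (\<tau> s))"
      by (intro continuous_intros \<tau>c continuous_on_compose2[OF vc \<tau>c(1)] continuous_on_compose2[OF wc \<tau>c(1)])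
        (use \<tau>T in auto)
  qed (rule ab(3))
  moreover have "snd \<phi> (c 0) \<in> chart_image \<phi>"
    by (rule ch(5)[OF subsetD[OF c imageI[of 0]]]) (use T in simp)
  ultimately show ?thesis
    using euler_lagrange_reparam[of "snd \<phi> (c 0)" "\<tau>' s0" "v 0" "\<tau>'' s0" "w 0" e] l[OF ab(3)] s0(2) by simp
qed

text \<open>Start a geodesic of the first metric with velocity \<open>h\<close> at \<open>u\<close>, on an interval \<open>{0..T}\<close> so short that it
  stays in the chart. Its reparametrization as a geodesic of the second metric has the same acceleration
  at \<open>u\<close> up to the ambiguity of parameters. A backward geodesic is a forward geodesic for the form with the
  opposite sign.\<close>

lemma related_if_geodesics_contained:
  assumes F: "randers_in_chart \<phi> F G W" and F': "randers_in_chart \<phi> F' G' W'"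
    and cont: "geodesics_contained A F F'" and u: "u \<in> chart_image \<phi>"
  shows "related_at G W G' W' u"
  unfolding related_at_def
proof (intro allI impI)
  fix h :: 'e assume h: "h \<noteq> 0"
  have \<phi>: "\<phi> \<in> A" using F by (simp add: randers_in_chart_def)
  interpret local_randers "chart_image \<phi>" G W using F by (simp add: randers_in_chart_def)
  note ch = is_chartD[OF chart[OF \<phi>]]
  obtain T x v w where T: "T > 0" and x0: "x 0 = u" "v 0 = h"
    and xU: "\<And>t. t \<in> {0..T} \<Longrightarrow> x t \<in> chart_image \<phi>" and reg: "\<And>t. t \<in> {0..T} \<Longrightarrow> v t \<noteq> 0"
    and x: "\<And>t. t \<in> {0..T} \<Longrightarrow> (x has_vector_derivative v t) (at t within {0..T})"
    and w: "\<And>t. t \<in> {0..T} \<Longrightarrow> (v has_vector_derivative w t) (at t within {0..T})"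
    and wc: "continuous_on {0..T} w"
    and EL: "\<And>t e. t \<in> {0..T} \<Longrightarrow> euler_lagrange G W (x t) (v t) (w t) e = 0"
    using geodesic_exists[OF u h] by blast
  define c where "c t = chart_inv \<phi> (x t)" for t
  have c\<phi>: "c ` {0..T} \<subseteq> fst \<phi>" using xU ch(6) by (auto simp: c_def)
  have cx: "snd \<phi> (c t) = x t" if "t \<in> {0..T}" for t using xU[OF that] ch(8) by (simp add: c_def)
  have v: "((snd \<phi> \<circ> c) has_vector_derivative v t) (at t within {0..T})" if t: "t \<in> {0..T}" for t
    by (rule has_vector_derivative_transform[OF t _ x[OF t]]) (simp add: cx)
  have x2: "Ck_on 2 x {0..T}" by (rule Ck_on_2_curve[OF x w wc])
  have "Ck_map A 2 {0..T} c" unfolding Ck_map_def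
  proof (intro conjI ballI)
    show "c ` {0..T} \<subseteq> points A" using c\<phi> \<phi> by (auto simp: points_def)
    show "continuous_on {0..T} c" unfolding c_def
      by (rule continuous_on_compose2[OF ch(4) Ck_on_continuous[OF x2]]) (use xU in auto)
    fix \<psi> assume \<psi>: "\<psi> \<in> A"
    have "Ck_on 2 (\<lambda>t. (snd \<psi> \<circ> chart_inv \<phi>) (x t)) ({0..T} \<inter> c -` fst \<psi>)"
    proof (rule Ck_on_compose[OF overlap_Ck[OF \<phi> \<psi>] Ck_on_subset[OF x2]])
      show "x ` ({0..T} \<inter> c -` fst \<psi>) \<subseteq> snd \<phi> ` (fst \<phi> \<inter> fst \<psi>)"
      proof
        fix q assume "q \<in> x ` ({0..T} \<inter> c -` fst \<psi>)"
        then obtain t where t: "t \<in> {0..T}" "c t \<in> fst \<psi>" "q = x t" by auto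
        then show "q \<in> snd \<phi> ` (fst \<phi> \<inter> fst \<psi>)"
          using cx[OF t(1)] c\<phi> by (intro image_eqI[of _ _ "c t"]) auto
      qed
    qed auto
    then show "Ck_on 2 (snd \<psi> \<circ> c) ({0..T} \<inter> c -` fst \<psi>)" by (simp add: comp_def c_def[abs_def])
  qed
  moreover have "velocity A {0..T} c t \<noteq> (\<lambda>\<phi>. 0)" if t: "t \<in> {0..T}" for t
  proof -
    have "at t within {0..T} \<noteq> bot" using t T by (simp add: trivial_limit_within islimpt_Icc)
    from velocity_coord[OF \<phi> c\<phi> t this v[OF t]]
    have "velocity A {0..T} c t \<phi> = v t" using coord_vector_at[OF \<phi> subsetD[OF c\<phi> imageI[OF t]]] by simp
    then show ?thesis using reg[OF t] by metis
  qed
  moreover have ext: "extremal A F a b c" if "a \<in> {0..T}" "b \<in> {0..T}" "a \<le> b" for a b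
  proof (rule extremal_if_euler_lagrange[OF F that(3)])
    have sub: "{a..b} \<subseteq> {0..T}" using that by auto
    show "c ` {a..b} \<subseteq> fst \<phi>" using c\<phi> sub by auto
    fix t assume "t \<in> {a..b}"
    then have t: "t \<in> {0..T}" using sub by blast
    show "((snd \<phi> \<circ> c) has_vector_derivative v t) (at t within {a..b})"
      by (rule has_vector_derivative_within_subset[OF v[OF t] sub])
    show "(v has_vector_derivative w t) (at t within {a..b})"
      by (rule has_vector_derivative_within_subset[OF w[OF t] sub])
    show "v t \<noteq> 0" by (rule reg[OF t])
    show "euler_lagrange G W (snd \<phi> (c t)) (v t) (w t) e = 0" for e unfolding cx[OF t] by (rule EL[OF t])
  qed
  moreover have "nontrivial_interval {0..T}" using T by (simp add: nontrivial_interval_def is_interval_cc)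
  ultimately have "forward_geodesic A F {0..T} c"
    unfolding forward_geodesic_def regular_curve_def by (metis zero_less_one)
  then obtain J \<tau> where J: "increasing_reparam J {0..T} \<tau>"
    "forward_geodesic A F' J (c \<circ> \<tau>) \<or> backward_geodesic A F' J (c \<circ> \<tau>)"
    using cont unfolding geodesics_contained_def by blast
  have F'': "randers_in_chart \<phi> (\<lambda>x \<xi>. F' x (\<lambda>\<phi>. - \<xi> \<phi>)) G' (\<lambda>u h. - W' u h)"
  proof -
    interpret R': local_randers "chart_image \<phi>" G' W' using F' by (simp add: randers_in_chart_def)
    have "loc1 A \<phi> (\<lambda>x \<xi>. F' x (\<lambda>\<phi>. - \<xi> \<phi>)) u h = loc1 A \<phi> F' u (- h)" if "u \<in> chart_image \<phi>" for u h
      using coord_vector_uminus[OF \<phi> ch(6)[OF that]] by (simp add: loc1_def)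
    then have "loc1 A \<phi> (\<lambda>x \<xi>. F' x (\<lambda>\<phi>. - \<xi> \<phi>)) u h = sqrt (G' u h h) + - W' u h" if "u \<in> chart_image \<phi>" for u h
      using F' that bilinear_lneg[OF R'.bilinear_G[OF that]] bilinear_rneg[OF R'.bilinear_G[OF that]] linear_neg[OF R'.linear_W[OF that]]
      by (simp add: randers_in_chart_def)
    moreover have "local_randers (chart_image \<phi>) G' (\<lambda>u h. - W' u h)"
      by (rule local_randers_uminus) unfold_locales
    ultimately show ?thesis using \<phi> by (simp add: randers_in_chart_def)
  qed
  have 0: "(0::real) \<in> {0..T}" using T by simp
  have e0: "snd \<phi> (c 0) = u" using cx[OF 0] x0 by simp
  have "(\<forall>e. euler_lagrange G' W' u h (w 0) e = 0) \<or> (\<forall>e. euler_lagrange G' (\<lambda>u h. - W' u h) u h (w 0) e = 0)"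
    using J(2)
  proof
    assume "forward_geodesic A F' J (c \<circ> \<tau>)"
    from euler_lagrange_of_reparametrized_geodesic[OF F' this J(1) T c\<phi> v w wc reg]
    show ?thesis by (simp add: e0 x0)
  next
    assume "backward_geodesic A F' J (c \<circ> \<tau>)"
    from euler_lagrange_of_reparametrized_geodesic[OF F'' this[unfolded backward_geodesic_def] J(1) T c\<phi> v w wc reg]
    show ?thesis by (simp add: e0 x0)
  qed
  moreover have "\<forall>e. euler_lagrange G W u h (w 0) e = 0" using EL[OF 0] x0 by simp
  ultimately show "\<exists>a. (\<forall>e. euler_lagrange G W u h a e = 0) \<and>
     ((\<forall>e. euler_lagrange G' W' u h a e = 0) \<or> (\<forall>e. euler_lagrange G' (\<lambda>u h. - W' u h) u h a e = 0))" by blast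
qed

end

section \<open>From charts to the manifold\<close>

context manifold_atlas begin

lemma local_randers_chart:
  assumes "riemannian_metric A g" "one_form A \<omega>" "\<phi> \<in> A"
  shows "local_randers (chart_image \<phi>) (loc2 A \<phi> g) (loc1 A \<phi> \<omega>)"
  using assms is_chartD(2)[OF chart[OF assms(3)]]
  unfolding local_randers_def local_metric_def local_form_def riemannian_metric_def one_form_def by blast

lemma randers_in_chart:
  assumes "riemannian_metric A g" "one_form A \<omega>" "\<phi> \<in> A"
  shows "randers_in_chart \<phi> (randers g \<omega>) (loc2 A \<phi> g) (loc1 A \<phi> \<omega>)"
  using local_randers_chart[OF assms] assms(3)
  by (simp add: randers_in_chart_def loc1_def loc2_def randers_def)

text \<open>All forms are differentiated in the same chart, the one chosen at \<open>p\<close>, so that two exterior derivatives can be compared there.\<close>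

lemma ext_deriv_chart:
  assumes "p \<in> points A"
  obtains \<phi> where "\<phi> \<in> A" "p \<in> fst \<phi>"
    "\<And>\<omega> v w. ext_deriv A \<omega> p v w = curl (loc1 A \<phi> \<omega>) (snd \<phi> p) (v \<phi>) (w \<phi>)"
proof -
  define \<phi> where "\<phi> = (SOME \<phi>. \<phi> \<in> charts_at A p)"
  have "\<exists>\<phi>. \<phi> \<in> charts_at A p" using assms by (auto simp: points_def charts_at_def)
  then have "\<phi> \<in> charts_at A p" unfolding \<phi>_def by (rule someI_ex)
  moreover have "ext_deriv A \<omega> p v w = curl (loc1 A \<phi> \<omega>) (snd \<phi> p) (v \<phi>) (w \<phi>)" for \<omega> v w
    by (simp add: ext_deriv_def Let_def \<phi>_def[symmetric] curl_def form_deriv_def)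
  moreover from \<open>\<phi> \<in> charts_at A p\<close> have "\<phi> \<in> A" "p \<in> fst \<phi>" by (simp_all add: charts_at_def)
  ultimately show thesis using that by blast
qed

text \<open>Formulated with tangent vectors, so that it does not depend on a chart.\<close>

definition proportional_at :: "('a, 'e) tform2 \<Rightarrow> real \<Rightarrow> ('a, 'e) tform2 \<Rightarrow> 'a \<Rightarrow> bool" where
  "proportional_at g k g' p \<longleftrightarrow>
     (\<forall>v\<in>tangent_space A p. \<forall>w\<in>tangent_space A p. g p v w = k * g' p v w)"

lemma proportional_at_iff:
  assumes \<phi>: "\<phi> \<in> A" and p: "p \<in> fst \<phi>"
  shows "proportional_at g k g' p \<longleftrightarrow>
     (\<forall>h l. loc2 A \<phi> g (snd \<phi> p) h l = k * loc2 A \<phi> g' (snd \<phi> p) h l)"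
proof -
  have loc: "loc2 A \<phi> g (snd \<phi> p) h l = g p (coord_vector A \<phi> p h) (coord_vector A \<phi> p l)" for g :: "('a, 'e) tform2" and h l
    using is_chartD(7)[OF chart[OF \<phi>] p] by (simp add: loc2_def)
  show ?thesis unfolding proportional_at_def loc
  proof (intro iffI allI ballI)
    fix v w assume *: "\<forall>h l. g p (coord_vector A \<phi> p h) (coord_vector A \<phi> p l) = k * g' p (coord_vector A \<phi> p h) (coord_vector A \<phi> p l)"
      and vw: "v \<in> tangent_space A p" "w \<in> tangent_space A p"
    show "g p v w = k * g' p v w"
      using *[rule_format, of "v \<phi>" "w \<phi>"] tangent_space_coord[OF \<phi> p vw(1), symmetric] tangent_space_coord[OF \<phi> p vw(2), symmetric]
      by simp
  next
    fix h l assume "\<forall>v\<in>tangent_space A p. \<forall>w\<in>tangent_space A p. g p v w = k * g' p v w"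
    then show "g p (coord_vector A \<phi> p h) (coord_vector A \<phi> p l) = k * g' p (coord_vector A \<phi> p h) (coord_vector A \<phi> p l)"
      using coord_vector_tangent[OF \<phi> p] by blast
  qed
qed

lemma open_chart_preimage:
  assumes "\<phi> \<in> A" "open V" shows "open (fst \<phi> \<inter> snd \<phi> -` V)"
  using continuous_open_preimage[OF is_chartD(3)[OF chart[OF assms(1)]] is_chartD(1)[OF chart[OF assms(1)]] assms(2)] .

lemma open_chart_inv_preimage:
  assumes "\<phi> \<in> A" "open V" shows "open (chart_image \<phi> \<inter> chart_inv \<phi> -` V)"
  using continuous_open_preimage[OF is_chartD(4)[OF chart[OF assms(1)]] is_chartD(2)[OF chart[OF assms(1)]] assms(2)] .

text \<open>The interior of the set where the metrics are proportional with factor \<open>c\<^sup>2\<close> is open by definition. It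
  is closed because a point of its closure is the centre of a ball in a chart on which unique continuation
  applies, starting from a smaller ball that need not have the same centre.\<close>

lemma proportional_everywhere:
  assumes conn: "connected (points A)" and c: "c > 0"
    and pair: "\<And>\<phi>. \<phi> \<in> A \<Longrightarrow> projective_pair (chart_image \<phi>) (loc2 A \<phi> g) (loc2 A \<phi> g')"
    and V: "open V" "V \<noteq> {}" "V \<subseteq> points A" "\<And>p. p \<in> V \<Longrightarrow> proportional_at g (c\<^sup>2) g' p"
    and p: "p \<in> points A"
  shows "proportional_at g (c\<^sup>2) g' p"
proof -
  let ?E = "{p \<in> points A. proportional_at g (c\<^sup>2) g' p}"
  let ?S = "interior ?E"
  have VS: "V \<subseteq> ?S" using V by (intro interior_maximal) auto
  have closed: "q \<in> ?S" if q: "q \<in> points A" "q \<in> closure ?S" for q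
  proof -
    obtain \<phi> where \<phi>: "\<phi> \<in> A" "q \<in> fst \<phi>" using q(1) by (auto simp: points_def)
    note ch = is_chartD[OF chart[OF \<phi>(1)]]
    interpret projective_pair "chart_image \<phi>" "loc2 A \<phi> g" "loc2 A \<phi> g'" by (rule pair[OF \<phi>(1)])
    define u where "u = snd \<phi> q"
    obtain \<rho> where \<rho>: "\<rho> > 0" "cball u \<rho> \<subseteq> chart_image \<phi>"
      using ch(2) ch(5)[OF \<phi>(2)] open_contains_cball unfolding u_def by blast
    define N where "N = fst \<phi> \<inter> snd \<phi> -` ball u (\<rho> / 4)"
    have N: "open N" "q \<in> N"
      using open_chart_preimage[OF \<phi>(1) open_ball] \<phi>(2) \<rho>(1) by (auto simp: N_def u_def)
    then obtain r where r: "r \<in> N" "r \<in> ?S"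
      using q(2) open_Int_closure_eq_empty[of N ?S] by blast
    define w where "w = snd \<phi> r"
    have rN: "r \<in> fst \<phi>" "dist u w < \<rho> / 4" using r(1) by (auto simp: N_def w_def)
    have "open (chart_image \<phi> \<inter> chart_inv \<phi> -` ?S)" by (rule open_chart_inv_preimage[OF \<phi>(1) open_interior])
    moreover have "w \<in> chart_image \<phi> \<inter> chart_inv \<phi> -` ?S"
      using ch(5)[OF rN(1)] ch(7)[OF rN(1)] r(2) by (simp add: w_def)
    ultimately obtain R0 where R0: "R0 > 0" "ball w R0 \<subseteq> chart_image \<phi> \<inter> chart_inv \<phi> -` ?S"
      using openE by blast
    define R where "R = min R0 (3 * \<rho> / 4)"
    have R: "0 < R" "R \<le> 3 * \<rho> / 4" "ball w R \<subseteq> ball w R0" using R0(1) \<rho>(1) by (auto simp: R_def)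
    have big: "cball w (3 * \<rho> / 4) \<subseteq> chart_image \<phi>"
    proof
      fix y assume "y \<in> cball w (3 * \<rho> / 4)"
      then have "dist u y \<le> \<rho>" using rN(2) dist_triangle[of u y w] by simp
      then show "y \<in> chart_image \<phi>" using \<rho>(2) by auto
    qed
    have small: "loc2 A \<phi> g v h k = c\<^sup>2 * loc2 A \<phi> g' v h k" if v: "v \<in> ball w R" for v h k
    proof -
      have v': "v \<in> chart_image \<phi>" "chart_inv \<phi> v \<in> ?S" using v R(3) R0(2) by auto
      then have "proportional_at g (c\<^sup>2) g' (chart_inv \<phi> v)" using interior_subset by blast
      then show ?thesis
        using proportional_at_iff[OF \<phi>(1) ch(6)[OF v'(1)]] ch(8)[OF v'(1)] by simp
    qed
    have "N \<subseteq> ?E"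
    proof
      fix x assume x: "x \<in> N"
      then have xf: "x \<in> fst \<phi>" "dist u (snd \<phi> x) < \<rho> / 4" by (auto simp: N_def)
      have "dist w (snd \<phi> x) < 3 * \<rho> / 4"
        using xf(2) rN(2) dist_triangle[of w "snd \<phi> x" u] \<rho>(1) by (simp add: dist_commute)
      then have "snd \<phi> x \<in> ball w (3 * \<rho> / 4)" by simp
      from proportionality_continues[OF big R(1,2) c small this]
      have "proportional_at g (c\<^sup>2) g' x" using proportional_at_iff[OF \<phi>(1) xf(1)] by blast
      then show "x \<in> ?E" using xf(1) \<phi>(1) by (auto simp: points_def)
    qed
    then have "N \<subseteq> ?S" using N(1) by (rule interior_maximal)
    then show ?thesis using N(2) by blast
  qed
  have "?S \<inter> points A = {} \<or> (- closure ?S) \<inter> points A = {}"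
  proof (rule connectedD[OF conn])
    show "open ?S" "open (- closure ?S)" by auto
    show "?S \<inter> (- closure ?S) \<inter> points A = {}" using closure_subset by blast
    show "points A \<subseteq> ?S \<union> (- closure ?S)" using closed by blast
  qed
  moreover have "?S \<inter> points A \<noteq> {}" using VS V by blast
  ultimately have "p \<in> closure ?S" using p by blast
  from closed[OF p this] show ?thesis using interior_subset by blast
qed

end

theorem corollary5:
  fixes A :: "('a::{t2_space,second_countable_topology}, 'e::euclidean_space) chart set"
    and g g' :: "('a, 'e) tform2"
    and \<omega> \<omega>' :: "('a, 'e) tfun"
  assumes "smooth_atlas A"
    and "connected (points A)"
    and "DIM('e) \<ge> 2"
    and "riemannian_metric A g" and "one_form A \<omega>"
    and "riemannian_metric A g'" and "one_form A \<omega>'"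
    and "finsler_metric A (randers g \<omega>)"
    and "finsler_metric A (randers g' \<omega>')"
    and "pointwise_projectively_related A (randers g \<omega>) (randers g' \<omega>')"
    and "\<not> closed_form A \<omega>"
  shows "\<exists>c>0.
    (\<forall>x\<in>points A. \<forall>v\<in>tangent_space A x. \<forall>w\<in>tangent_space A x. g x v w = c\<^sup>2 * g' x v w) \<and>
    (\<forall>x\<in>points A.
       (\<forall>v\<in>tangent_space A x. \<forall>w\<in>tangent_space A x.
          ext_deriv A \<omega> x v w = c * ext_deriv A \<omega>' x v w) \<or>
       (\<forall>v\<in>tangent_space A x. \<forall>w\<in>tangent_space A x.
          ext_deriv A \<omega> x v w = - c * ext_deriv A \<omega>' x v w))"
proof -
  interpret manifold_atlas A by (rule manifold_atlas.intro[OF assms(1)])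
  let ?G = "\<lambda>\<phi>. loc2 A \<phi> g" and ?G' = "\<lambda>\<phi>. loc2 A \<phi> g'"
  let ?W = "\<lambda>\<phi>. loc1 A \<phi> \<omega>" and ?W' = "\<lambda>\<phi>. loc1 A \<phi> \<omega>'"
  have R: "local_randers (chart_image \<phi>) (?G \<phi>) (?W \<phi>)" and R': "local_randers (chart_image \<phi>) (?G' \<phi>) (?W' \<phi>)"
    if "\<phi> \<in> A" for \<phi>
    using local_randers_chart that assms(4-7) by blast+
  have rel: "related_at (?G \<phi>) (?W \<phi>) (?G' \<phi>) (?W' \<phi>) u" "related_at (?G' \<phi>) (?W' \<phi>) (?G \<phi>) (?W \<phi>) u"
    if "\<phi> \<in> A" "u \<in> chart_image \<phi>" for \<phi> u
    using related_if_geodesics_contained[OF randers_in_chart[OF assms(4,5) that(1)] randers_in_chart[OF assms(6,7) that(1)] _ that(2)]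
      related_if_geodesics_contained[OF randers_in_chart[OF assms(6,7) that(1)] randers_in_chart[OF assms(4,5) that(1)] _ that(2)]
      assms(10) unfolding pointwise_projectively_related_def by blast+
  note cons = related_at_consequences[OF R R' _ rel]
  have pair: "projective_pair (chart_image \<phi>) (?G \<phi>) (?G' \<phi>)" if \<phi>: "\<phi> \<in> A" for \<phi>
    using R[OF \<phi>] R'[OF \<phi>] cons(1)[OF \<phi> \<phi> _ \<phi> _ \<phi>] assms(3)
    unfolding projective_pair_def projective_pair_axioms_def local_randers_def by blast
  obtain p v w where p: "p \<in> points A" and nonzero: "ext_deriv A \<omega> p v w \<noteq> 0"
    using assms(11) unfolding closed_form_def by blast
  obtain \<phi> where \<phi>: "\<phi> \<in> A" "p \<in> fst \<phi>"
    and ext: "\<And>\<omega> v w. ext_deriv A \<omega> p v w = curl (loc1 A \<phi> \<omega>) (snd \<phi> p) (v \<phi>) (w \<phi>)"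
    by (rule ext_deriv_chart[OF p]) blast
  note ch = is_chartD[OF chart[OF \<phi>(1)]]
  interpret P: projective_pair "chart_image \<phi>" "?G \<phi>" "?G' \<phi>" by (rule pair[OF \<phi>(1)])
  interpret L: local_randers "chart_image \<phi>" "?G \<phi>" "?W \<phi>" by (rule R[OF \<phi>(1)])
  let ?f = "\<lambda>u. curl (?W \<phi>) u (v \<phi>) (w \<phi>)"
  have u: "snd \<phi> p \<in> chart_image \<phi>" by (rule ch(5)[OF \<phi>(2)])
  have fu: "?f (snd \<phi> p) \<noteq> 0" using nonzero ext by simp
  have "continuous_on (chart_image \<phi>) ?f"
    by (intro L.curl_continuous continuous_intros) auto
  from continuous_open_preimage[OF this ch(2), of "- {0}"]
  have "open (chart_image \<phi> \<inter> ?f -` (- {0}))" by auto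
  moreover have "snd \<phi> p \<in> chart_image \<phi> \<inter> ?f -` (- {0})" using u fu by simp
  ultimately obtain r where r: "r > 0" "ball (snd \<phi> p) r \<subseteq> chart_image \<phi> \<inter> ?f -` (- {0})"
    using openE by blast
  let ?V = "ball (snd \<phi> p) r"
  have VU: "?V \<subseteq> chart_image \<phi>" using r(2) by auto
  have pos': "?G' \<phi> u e e > 0" if "u \<in> chart_image \<phi>" "e \<noteq> 0" for u e
    using P.M'.G_pos that by blast
  obtain e where e: "(e::'e) \<noteq> 0" using nonempty_Basis nonzero_Basis by blast
  have "\<exists>l. \<forall>h k. ?G \<phi> q h k = l * ?G' \<phi> q h k" if q: "q \<in> ?V" for q
  proof -
    have "q \<in> chart_image \<phi>" "?f q \<noteq> 0" using q r(2) by auto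
    then show ?thesis using cons(2)[OF \<phi>(1) \<phi>(1) _ \<phi>(1) _ \<phi>(1)] by metis
  qed
  from P.conformal_factor_constant[OF open_ball connected_ball VU this]
  obtain l where l: "\<And>q h k. q \<in> ?V \<Longrightarrow> ?G \<phi> q h k = l * ?G' \<phi> q h k" by blast
  obtain c where c: "c > 0" "\<And>h k. ?G \<phi> (snd \<phi> p) h k = c\<^sup>2 * ?G' \<phi> (snd \<phi> p) h k"
    using cons(2)[OF \<phi>(1) \<phi>(1) u \<phi>(1) u \<phi>(1) u fu] by blast
  have "l * ?G' \<phi> (snd \<phi> p) e e = c\<^sup>2 * ?G' \<phi> (snd \<phi> p) e e"
    using l[of "snd \<phi> p" e e] c(2)[of e e] r(1) by (metis centre_in_ball)
  then have lc: "l = c\<^sup>2" using pos'[OF u e] by simp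
  let ?N = "fst \<phi> \<inter> snd \<phi> -` ?V"
  have ratio: "proportional_at g (c\<^sup>2) g' x" if x: "x \<in> points A" for x
  proof (rule proportional_everywhere[OF assms(2) c(1) pair _ _ _ _ x])
    show "open ?N" by (rule open_chart_preimage[OF \<phi>(1) open_ball])
    show "?N \<noteq> {}" using \<phi>(2) r(1) by auto
    show "?N \<subseteq> points A" using \<phi>(1) by (auto simp: points_def)
    show "proportional_at g (c\<^sup>2) g' q" if "q \<in> ?N" for q
      unfolding proportional_at_iff[OF \<phi>(1) IntD1[OF that]] using l[of "snd \<phi> q"] that lc by simp
  qed
  have sign: "(\<forall>v\<in>tangent_space A x. \<forall>w\<in>tangent_space A x. ext_deriv A \<omega> x v w = c * ext_deriv A \<omega>' x v w) \<or>
       (\<forall>v\<in>tangent_space A x. \<forall>w\<in>tangent_space A x. ext_deriv A \<omega> x v w = - c * ext_deriv A \<omega>' x v w)"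
    if x: "x \<in> points A" for x
  proof -
    obtain \<psi> where \<psi>: "\<psi> \<in> A" "x \<in> fst \<psi>"
      and ext: "\<And>\<omega> v w. ext_deriv A \<omega> x v w = curl (loc1 A \<psi> \<omega>) (snd \<psi> x) (v \<psi>) (w \<psi>)"
      by (rule ext_deriv_chart[OF x]) blast
    let ?y = "snd \<psi> x"
    have y: "?y \<in> chart_image \<psi>" by (rule is_chartD(5)[OF chart[OF \<psi>(1)] \<psi>(2)])
    note cons' = cons[OF \<psi>(1) \<psi>(1) y \<psi>(1) y \<psi>(1) y]
    show ?thesis
    proof (cases "\<exists>h k. curl (?W \<psi>) ?y h k \<noteq> 0")
      case True
      then obtain d where d: "d > 0" "\<And>h k. ?G \<psi> ?y h k = d\<^sup>2 * ?G' \<psi> ?y h k"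
        "(\<forall>h k. curl (?W \<psi>) ?y h k = d * curl (?W' \<psi>) ?y h k) \<or> (\<forall>h k. curl (?W \<psi>) ?y h k = - d * curl (?W' \<psi>) ?y h k)"
        using cons'(2) by blast
      interpret Q: projective_pair "chart_image \<psi>" "?G \<psi>" "?G' \<psi>" by (rule pair[OF \<psi>(1)])
      have "c\<^sup>2 * ?G' \<psi> ?y e e = d\<^sup>2 * ?G' \<psi> ?y e e"
        using ratio[OF x] proportional_at_iff[OF \<psi>] d(2)[of e e] by simp
      then have "c\<^sup>2 = d\<^sup>2" using Q.M'.G_pos[OF y e] by simp
      then have "c = d" using c(1) d(1) by simp
      then show ?thesis using d(3) unfolding ext by blast
    next
      case False
      then have "curl (?W \<psi>) ?y h k = 0" "curl (?W' \<psi>) ?y h k = 0" for h k using cons'(3) by blast+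
      then show ?thesis unfolding ext by simp
    qed
  qed
  show ?thesis using c(1) ratio sign unfolding proportional_at_def by blast
qed

end
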